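(* Let $(\alpha,H)\in(0,2)\times(0,1)$ and let $a,b\in\mathbb{R}$. Let $L=(L_t)_{t\in\mathbb{R}}$ be a (two-sided) rotationally invariant complex-valued Lévy process without Gaussian component, with Lévy measure $\nu$ on $\mathbb{C}\cong\mathbb{R}^2$. Suppose that $\nu$ is absolutely continuous with respect to two-dimensional Lebesgue measure with a density $f:\mathbb{R}^2\to\mathbb{R}_+$ for which there are constants $c_0,C>0$ such that $$f(x)\sim c_0\|x\|^{-2-\alpha}\ \text{ as }\|x\|\to\infty,\ \text{ i.e. }\ \lim_{\|x\|\to\infty}\frac{f(x)}{c_0\|x\|^{-2-\alpha}}=1,\qquad\text{and}\qquad f(x)\le C\|x\|^{-2-\alpha}\quad\text{for all }x\in\mathbb{R}^2 .$$ Then the harmonizable fractional Lévy motion $$X_t=\int_{\mathbb{R}}\frac{e^{its}-1}{is}\Big(a(s_+)^{-H-1/\alpha+1}+b(s_-)^{-H-1/\alpha+1}\Big)\,dL_s,\qquad t\in\mathbb{R},$$ is well-defined (that is, for every $t\in\mathbb{R}$ the integrand is $L$-integrable), and it is locally asymptotically self-similar with index $H$ and tangent process the harmonizable fractional stable motion, that is, $$\Big(\frac{X_{\epsilon t}}{\epsilon^{H}}\Big)_{t\in\mathbb{R}}\longrightarrow (C_t)_{t\in\mathbb{R}}\qquad\text{as }\epsilon\to0_+,$$ where the convergence is in finite dimensional distributions and $(C_t)_{t\in\mathbb{R}}$ denotes a harmonizable fractional stable motion with parameters $(\alpha,H)$.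
   Context: Notation: $s_+=\max\{s,0\}$, $s_-=-\min\{s,0\}$; in the integrand $(s_+)^p$ is read as $0$ when $s\le 0$ and $(s_-)^p$ as $0$ when $s\ge0$. $\mathbb{C}$ is identified with $\mathbb{R}^2$. Rotational invariance: a complex-valued random variable $X$ is rotationally invariant if $e^{i\theta}X$ has the same distribution as $X$ for all $\theta\in[0,2\pi)$; a complex-valued process is rotationally invariant if every complex linear combination $\sum_{n=1}^N z_nX_{t_n}$ is rotationally invariant. Stochastic integral: a two-sided complex-valued Lévy process $L$ induces a complex-valued independently scattered infinitely divisible random measure $M$ on the bounded Borel sets of $\mathbb{R}$, determined by $M((s,t])=L_t-L_s$ for $s<t$. For a simple function $g=\sum_{j=1}^n z_j\mathbf{1}_{A_j}$ ($z_j\in\mathbb{C}$, $A_j$ disjoint bounded Borel sets) and a Borel set $A$, $\int_A g\,dL=\sum_j z_jM(A\cap A_j)$. A measurable $g:\mathbb{R}\to\mathbb{C}$ is $L$-integrable if there are simple functions $g_n\to g$ Lebesgue-almost everywhere such that for every Borel set $A$ the sequence $\int_A g_n\,dL$ converges in probability; then $\int_A g\,dL$ is this limit in probability (it does not depend on the approximating sequence). Local asymptotic self-similarity: a process $(X_t)_{t\in\mathbb{R}}$ is locally asymptotically self-similar if there exist a number $H\in\mathbb{R}$ (the index) and a non-degenerate process $T=(T_t)_{t\in\mathbb{R}}$ (the tangent process) such that $(\epsilon^{-H}X_{\epsilon t})_{t\in\mathbb{R}}\to (T_t)_{t\in\mathbb{R}}$ in finite dimensional distributions as $\epsilon\to0_+$.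 Harmonizable fractional stable motion with parameters $(\alpha,H)$: a process of the form $$C_t=\int_{\mathbb{R}}\frac{e^{its}-1}{is}\Big(a'(s_+)^{-H-1/\alpha+1}+b'(s_-)^{-H-1/\alpha+1}\Big)\,d\widetilde L_s,\quad t\in\mathbb{R},$$ with $a',b'\in\mathbb{R}$ and $\widetilde L$ a two-sided complex-valued rotationally invariant $\alpha$-stable Lévy process, i.e. one whose Lévy measure on $\mathbb{R}^2$ is a positive constant times $\|x\|^{-2-\alpha}\,dx$, with no Gaussian component and symmetric increments.
   Formalization: For a = b = 0 the process X vanishes and its limit is degenerate, so local asymptotic self-similarity with a non-degenerate tangent process is claimed only when a or b is nonzero; well-definedness and the convergence are claimed for all a, b. *)

theory Defs
  imports "HOL-Probability.Probability"
begin

section \<open>Probabilistic preliminaries\<close>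

definition tendsto_in_prob ::
  "'a measure \<Rightarrow> ('i \<Rightarrow> 'a \<Rightarrow> 'b::metric_space) \<Rightarrow> ('a \<Rightarrow> 'b) \<Rightarrow> 'i filter \<Rightarrow> bool" where
  "tendsto_in_prob P Y Z F \<longleftrightarrow>
     (\<forall>e>0. ((\<lambda>i. measure P {\<omega> \<in> space P. dist (Y i \<omega>) (Z \<omega>) > e}) \<longlongrightarrow> 0) F)"

definition infinitely_divisible :: "complex measure \<Rightarrow> bool" where
  "infinitely_divisible \<mu> \<longleftrightarrow>
     (\<forall>n\<ge>1. \<exists>\<rho>. prob_space \<rho> \<and> sets \<rho> = sets borel \<and>
        \<mu> = distr (Pi\<^sub>M {..<n::nat} (\<lambda>_. \<rho>)) borel (\<lambda>x. \<Sum>i<n. x i))"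

definition rot_invariant :: "'a measure \<Rightarrow> ('a \<Rightarrow> complex) \<Rightarrow> bool" where
  "rot_invariant P X \<longleftrightarrow>
     (\<forall>\<theta>\<in>{0..<2*pi}. distr P borel (\<lambda>\<omega>. exp (\<i> * of_real \<theta>) * X \<omega>) = distr P borel X)"

definition rot_invariant_process :: "'a measure \<Rightarrow> (real \<Rightarrow> 'a \<Rightarrow> complex) \<Rightarrow> bool" where
  "rot_invariant_process P X \<longleftrightarrow>
     (\<forall>(N::nat) (z::nat \<Rightarrow> complex) (t::nat \<Rightarrow> real).
        rot_invariant P (\<lambda>\<omega>. \<Sum>n<N. z n * X (t n) \<omega>))"

definition nondegenerate_process :: "'a measure \<Rightarrow> (real \<Rightarrow> 'a \<Rightarrow> complex) \<Rightarrow> bool" where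
  "nondegenerate_process P T \<longleftrightarrow> (\<exists>t. \<not> (\<exists>c. AE \<omega> in P. T t \<omega> = c))"

text \<open>
  Convergence in distribution of the vectors \<open>(Y i (t 0), \<dots>, Y i (t (n - 1)))\<close> to
  \<open>(T (t 0), \<dots>, T (t (n - 1)))\<close> is tested on bounded continuous functions. A vector in
  \<open>\<complex>\<^sup>n\<close> is encoded as a function on the naturals that is padded with \<open>0\<close> from \<open>n\<close> on; the test
  function \<open>h\<close> is continuous for the product topology, so its restrictions to the padded
  vectors are exactly the bounded continuous functions on \<open>\<complex>\<^sup>n\<close>.
\<close>
definition tendsto_fdd ::
  "'a measure \<Rightarrow> ('i \<Rightarrow> real \<Rightarrow> 'a \<Rightarrow> complex) \<Rightarrow> 'b measure \<Rightarrow> (real \<Rightarrow> 'b \<Rightarrow> complex) \<Rightarrow>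
   'i filter \<Rightarrow> bool" where
  "tendsto_fdd P Y Q T F \<longleftrightarrow>
     (\<forall>(n::nat) (t::nat \<Rightarrow> real) (h::(nat \<Rightarrow> complex) \<Rightarrow> real).
        continuous_on UNIV h \<longrightarrow> bounded (range h) \<longrightarrow>
        ((\<lambda>i. \<integral>\<omega>. h (\<lambda>k. if k < n then Y i (t k) \<omega> else 0) \<partial>P) \<longlongrightarrow>
           (\<integral>\<omega>. h (\<lambda>k. if k < n then T (t k) \<omega> else 0) \<partial>Q)) F)"

definition locally_asymp_self_similar ::
  "'a measure \<Rightarrow> (real \<Rightarrow> 'a \<Rightarrow> complex) \<Rightarrow> real \<Rightarrow> 'b measure \<Rightarrow> (real \<Rightarrow> 'b \<Rightarrow> complex) \<Rightarrow> bool" where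
  "locally_asymp_self_similar P X H Q T \<longleftrightarrow>
     nondegenerate_process Q T \<and>
     tendsto_fdd P (\<lambda>\<epsilon> t \<omega>. of_real (\<epsilon> powr (-H)) * X (\<epsilon> * t) \<omega>) Q T (at_right 0)"


section \<open>Complex-valued Levy processes\<close>

text \<open>
  Processes are not required to have cadlag paths; stochastic continuity is imposed instead.
\<close>
definition levy_process :: "'a measure \<Rightarrow> (real \<Rightarrow> 'a \<Rightarrow> complex) \<Rightarrow> bool" where
  "levy_process P L \<longleftrightarrow>
     prob_space P \<and>
     (\<forall>t. L t \<in> borel_measurable P) \<and>
     (AE \<omega> in P. L 0 \<omega> = 0) \<and>
     (\<forall>(n::nat) (t::nat \<Rightarrow> real). strict_mono t \<longrightarrow>
        prob_space.indep_vars P (\<lambda>_. borel) (\<lambda>k \<omega>. L (t (Suc k)) \<omega> - L (t k) \<omega>) {..<n}) \<and>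
     (\<forall>s t h. s \<le> t \<longrightarrow>
        distr P borel (\<lambda>\<omega>. L (t + h) \<omega> - L (s + h) \<omega>) = distr P borel (\<lambda>\<omega>. L t \<omega> - L s \<omega>)) \<and>
     (\<forall>t. tendsto_in_prob P L (L t) (at t))"

definition levy_measure :: "complex measure \<Rightarrow> bool" where
  "levy_measure \<nu> \<longleftrightarrow>
     sets \<nu> = sets borel \<and> emeasure \<nu> {0} = 0 \<and>
     (\<integral>\<^sup>+x. ennreal (min 1 ((norm x)\<^sup>2)) \<partial>\<nu>) < \<infinity>"

text \<open>
  Throughout, \<open>\<complex>\<close> is identified with the Euclidean plane: \<open>\<bullet>\<close> is the real inner product
  \<open>x \<bullet> y = Re (x * cnj y)\<close>, and \<open>lborel\<close> on \<^typ>\<open>complex\<close> is two-dimensional Lebesgue measure.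
  The Gaussian covariance is given as a real-linear operator \<open>Q\<close>.
\<close>
definition levy_exponent ::
  "(complex \<Rightarrow> complex) \<Rightarrow> complex measure \<Rightarrow> complex \<Rightarrow> complex \<Rightarrow> complex" where
  "levy_exponent Q \<nu> \<gamma> z =
     \<i> * of_real (\<gamma> \<bullet> z) - of_real ((z \<bullet> Q z) / 2) +
     (\<integral>x. exp (\<i> * of_real (z \<bullet> x)) - 1
           - \<i> * of_real (z \<bullet> x) * indicator (cball 0 1) x \<partial>\<nu>)"

definition has_levy_triplet ::
  "'a measure \<Rightarrow> (real \<Rightarrow> 'a \<Rightarrow> complex) \<Rightarrow> (complex \<Rightarrow> complex) \<Rightarrow> complex measure \<Rightarrow> complex \<Rightarrow> bool"
  where
  "has_levy_triplet P L Q \<nu> \<gamma> \<longleftrightarrow>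
     linear Q \<and> (\<forall>x y. x \<bullet> Q y = Q x \<bullet> y) \<and> (\<forall>x. 0 \<le> x \<bullet> Q x) \<and> levy_measure \<nu> \<and>
     (\<forall>t\<ge>0. \<forall>z. (\<integral>\<omega>. exp (\<i> * of_real (z \<bullet> L t \<omega>)) \<partial>P) = exp (of_real t * levy_exponent Q \<nu> \<gamma> z))"

definition purely_non_gaussian ::
  "'a measure \<Rightarrow> (real \<Rightarrow> 'a \<Rightarrow> complex) \<Rightarrow> complex measure \<Rightarrow> bool" where
  "purely_non_gaussian P L \<nu> \<longleftrightarrow> (\<exists>\<gamma>. has_levy_triplet P L (\<lambda>_. 0) \<nu> \<gamma>)"

definition symmetric_increments :: "'a measure \<Rightarrow> (real \<Rightarrow> 'a \<Rightarrow> complex) \<Rightarrow> bool" where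
  "symmetric_increments P L \<longleftrightarrow>
     (\<forall>s t. distr P borel (\<lambda>\<omega>. - (L t \<omega> - L s \<omega>)) = distr P borel (\<lambda>\<omega>. L t \<omega> - L s \<omega>))"

text \<open>
  The density below takes the value \<open>0\<close> at the origin because \<open>0 powr p = 0\<close>.
\<close>
definition rot_invariant_stable_levy ::
  "'a measure \<Rightarrow> real \<Rightarrow> (real \<Rightarrow> 'a \<Rightarrow> complex) \<Rightarrow> bool" where
  "rot_invariant_stable_levy P \<alpha> L \<longleftrightarrow>
     levy_process P L \<and> symmetric_increments P L \<and>
     (\<exists>c>0. purely_non_gaussian P L
        (density lborel (\<lambda>x. ennreal (c * norm x powr (-2 - \<alpha>)))))"


section \<open>Stochastic integration\<close>

text \<open>
  A random measure is defined on the bounded Borel sets only; its values elsewhere are irrelevant.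
\<close>
definition indep_scattered_id_measure :: "'a measure \<Rightarrow> (real set \<Rightarrow> 'a \<Rightarrow> complex) \<Rightarrow> bool" where
  "indep_scattered_id_measure P M \<longleftrightarrow>
     (\<forall>A. A \<in> sets borel \<longrightarrow> bounded A \<longrightarrow>
        M A \<in> borel_measurable P \<and> infinitely_divisible (distr P borel (M A))) \<and>
     (\<forall>A::nat \<Rightarrow> real set. (\<forall>n. A n \<in> sets borel \<and> bounded (A n)) \<longrightarrow> disjoint_family A \<longrightarrow>
        prob_space.indep_vars P (\<lambda>_. borel) (\<lambda>n. M (A n)) UNIV \<and>
        (bounded (\<Union>n. A n) \<longrightarrow>
           (AE \<omega> in P. (\<lambda>n. M (A n) \<omega>) sums M (\<Union>n. A n) \<omega>)))"

definition induced_random_measure ::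
  "'a measure \<Rightarrow> (real \<Rightarrow> 'a \<Rightarrow> complex) \<Rightarrow> (real set \<Rightarrow> 'a \<Rightarrow> complex) \<Rightarrow> bool" where
  "induced_random_measure P L M \<longleftrightarrow>
     indep_scattered_id_measure P M \<and>
     (\<forall>s t. s < t \<longrightarrow> (AE \<omega> in P. M {s<..t} \<omega> = L t \<omega> - L s \<omega>))"

definition bounded_simple :: "(real \<Rightarrow> complex) \<Rightarrow> bool" where
  "bounded_simple g \<longleftrightarrow> simple_function borel g \<and> bounded {s. g s \<noteq> 0}"

text \<open>
  The canonical representation \<open>g = (\<Sum>z. z * indicator (g -` {z}))\<close> over the nonzero values of
  \<open>g\<close> is used; the value \<open>0\<close> is left out because its preimage is unbounded.
\<close>
definition simple_integral_rm ::
  "(real set \<Rightarrow> 'a \<Rightarrow> complex) \<Rightarrow> (real \<Rightarrow> complex) \<Rightarrow> real set \<Rightarrow> 'a \<Rightarrow> complex" where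
  "simple_integral_rm M g A \<omega> = (\<Sum>z\<in>range g - {0}. z * M (A \<inter> g -` {z}) \<omega>)"

definition approximates ::
  "'a measure \<Rightarrow> (real set \<Rightarrow> 'a \<Rightarrow> complex) \<Rightarrow> (real \<Rightarrow> complex) \<Rightarrow> (nat \<Rightarrow> real \<Rightarrow> complex) \<Rightarrow> bool"
  where
  "approximates P M g G \<longleftrightarrow>
     (\<forall>n. bounded_simple (G n)) \<and> (AE s in lborel. (\<lambda>n. G n s) \<longlonglongrightarrow> g s) \<and>
     (\<forall>A\<in>sets borel. \<exists>Z\<in>borel_measurable P.
        tendsto_in_prob P (\<lambda>n. simple_integral_rm M (G n) A) Z sequentially)"

text \<open>
  The random measure induced by a Levy process is unique up to null sets, so \<open>\<exists>M\<close>
  below picks that measure (and asserts that there is one).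
\<close>
definition levy_integrable ::
  "'a measure \<Rightarrow> (real \<Rightarrow> 'a \<Rightarrow> complex) \<Rightarrow> (real \<Rightarrow> complex) \<Rightarrow> bool" where
  "levy_integrable P L g \<longleftrightarrow>
     g \<in> borel_measurable borel \<and> (\<exists>M G. induced_random_measure P L M \<and> approximates P M g G)"

text \<open>
  \<open>has_levy_integral P L g A Y\<close> says that \<open>Y\<close> is a version of the integral of \<open>g\<close> over \<open>A\<close>
  with respect to \<open>L\<close>, which is determined up to almost sure equality.
\<close>
definition has_levy_integral ::
  "'a measure \<Rightarrow> (real \<Rightarrow> 'a \<Rightarrow> complex) \<Rightarrow> (real \<Rightarrow> complex) \<Rightarrow> real set \<Rightarrow> ('a \<Rightarrow> complex) \<Rightarrow> bool"
  where
  "has_levy_integral P L g A Y \<longleftrightarrow>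
     g \<in> borel_measurable borel \<and> Y \<in> borel_measurable P \<and>
     (\<exists>M G. induced_random_measure P L M \<and> approximates P M g G \<and>
        tendsto_in_prob P (\<lambda>n. simple_integral_rm M (G n) A) Y sequentially)"


section \<open>Harmonizable fractional motions\<close>

text \<open>
  Since \<open>0 powr p = 0\<close>, the two one-sided powers vanish off their half-lines. The value at the
  single point \<open>s = 0\<close> (here \<open>0\<close>) does not affect the integral.
\<close>
definition hf_kernel :: "real \<Rightarrow> real \<Rightarrow> real \<Rightarrow> real \<Rightarrow> real \<Rightarrow> real \<Rightarrow> complex" where
  "hf_kernel \<alpha> H a b t s =
     (exp (\<i> * of_real (t * s)) - 1) / (\<i> * of_real s) *
     of_real (a * (max s 0) powr (-H - 1/\<alpha> + 1) + b * (- min s 0) powr (-H - 1/\<alpha> + 1))"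

definition harmonizable_motion ::
  "'a measure \<Rightarrow> (real \<Rightarrow> 'a \<Rightarrow> complex) \<Rightarrow> real \<Rightarrow> real \<Rightarrow> real \<Rightarrow> real \<Rightarrow> (real \<Rightarrow> 'a \<Rightarrow> complex) \<Rightarrow> bool"
  where
  "harmonizable_motion P L \<alpha> H a b X \<longleftrightarrow>
     (\<forall>t. has_levy_integral P L (hf_kernel \<alpha> H a b t) UNIV (X t))"

definition harmonizable_fractional_stable_motion ::
  "'a measure \<Rightarrow> real \<Rightarrow> real \<Rightarrow> (real \<Rightarrow> 'a \<Rightarrow> complex) \<Rightarrow> bool" where
  "harmonizable_fractional_stable_motion P \<alpha> H C \<longleftrightarrow>
     (\<exists>a' b' L. rot_invariant_stable_levy P \<alpha> L \<and> harmonizable_motion P L \<alpha> H a' b' C)"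

end

theory Submission
  imports Defs
begin

text \<open>
  Everything is read off from characteristic functions. The law of a rotation invariant \<open>L\<close> is
  given by \<open>E (exp (\<i> Re (z L_t))) = exp (- t \<psi>(z))\<close> with \<open>\<psi>(z) = \<integral> f(x) (1 - cos (z \<bullet> x)) dx\<close>:
  invariance under rotations makes the exponent a function of \<open>\<bar>z\<bar>\<close>, and since replacing \<open>z\<close> by
  \<open>-z\<close> conjugates a characteristic function, the exponent is real. The domination of \<open>f\<close> by a
  stable Levy density gives \<open>\<psi>(z) \<le> K \<bar>z\<bar>^\<alpha>\<close>. Hence \<open>\<integral> g dL\<close> exists for every \<open>g\<close> with
  \<open>\<integral> \<bar>g\<bar>^\<alpha> < \<infinity>\<close>, with characteristic function \<open>exp (- \<integral> \<psi>(z g(s)) ds)\<close>. The kernel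
  \<open>g_t\<close> of the motion has this property: near \<open>0\<close> it is at most of order \<open>\<bar>s\<bar>^(1-H-1/\<alpha>)\<close> and at infinity
  of order \<open>\<bar>s\<bar>^(-H-1/\<alpha>)\<close>, and \<open>0 < H < 1\<close> is what makes the \<open>\<alpha>\<close>-th powers integrable.

  The kernel satisfies \<open>g_(\<epsilon>t)(r/\<epsilon>) = \<epsilon>^(H+1/\<alpha>) g_t(r)\<close>. With \<open>G = (\<Sum>k. z_k g_(t_k))\<close>, the
  substitution \<open>s = r/\<epsilon>\<close> shows that the combination \<open>(\<Sum>k. z_k \<epsilon>^(-H) X_(\<epsilon>t_k))\<close> has exponent
  \<open>\<integral> \<psi>(\<epsilon>^(1/\<alpha>) G(r)) / \<epsilon> dr\<close>. Small frequencies see only the large jumps, so the tail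
  equivalence for \<open>f\<close> turns into \<open>\<psi>(r z) / r^\<alpha> \<longrightarrow> k \<bar>z\<bar>^\<alpha>\<close> as \<open>r \<longrightarrow> 0\<close>
  (\<open>psi_scaling_limit\<close>), and dominated convergence gives the limit \<open>\<integral> k \<bar>G(r)\<bar>^\<alpha> dr\<close>
  (\<open>rescaled_exponent_limit\<close>). That is the exponent of the same combination of the integrals of the
  \<open>g_t\<close> with respect to a rotation invariant stable process, and a continuity theorem for complex
  vectors (\<open>multivariate_levy_continuity\<close>) concludes.

  Three constructions carry this argument.

  The stochastic integral is handled through the relation \<open>isI g Y\<close>, the closure of the elementary
  integral of step functions. The characteristic function of an integral
  (\<open>isI_chf\<close>) bounds its tails by \<open>chf_tail_bound\<close>, and existence (\<open>isI_exists\<close>) and uniqueness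
  (\<open>isI_unique\<close>) come from that one estimate. The integrals of indicator functions form the random measure induced by \<open>L\<close>; its almost sure
  \<open>\<sigma>\<close>-additivity is a consequence of a maximal inequality for symmetric sums (\<open>M0_sums\<close>).

  An integral may be defined by any sequence of simple functions \<open>G_n\<close> that converges to \<open>g\<close> almost
  everywhere and whose integrals over each Borel set converge in probability. Such a sequence need not
  be known to converge to \<open>g\<close> in the \<open>\<alpha>\<close>-th mean. A gliding hump argument shows that
  \<open>\<integral> \<psi>(z (G_n - g))\<close> nevertheless tends to \<open>0\<close>, so that the limit is the integral in the sense of
  \<open>isI\<close> (\<open>isI_if_has_levy_integral\<close>).

  The stable process must be constructed. Its law at time \<open>1\<close> is the limit of the laws of
  \<open>n^(-1/\<alpha>) L_n\<close> (\<open>stable_law_exists\<close>); its finite-dimensional laws are images of product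
  measures, and Kolmogorov's extension theorem produces the process (\<open>stable_process_exists\<close>).
\<close>

section \<open>A weighted continuity theorem on the line\<close>

text \<open>
  The characteristic function of a complex variable at the frequency \<open>1\<close>; all other frequencies are
  reached as \<open>chf P (\<lambda>\<omega>. z * Y \<omega>)\<close>, and the joint ones as \<open>chf P (\<lambda>\<omega>. \<Sum>k<n. z k * Y k \<omega>)\<close>. The pairing is
  \<open>Re (z * y)\<close>, which avoids a conjugation when the frequency is moved into an integrand.
\<close>
definition chf :: "'a measure \<Rightarrow> ('a \<Rightarrow> complex) \<Rightarrow> complex" where
  "chf P Y = (CLINT \<omega>|P. cis (Re (Y \<omega>)))"

lemma cis_measurable [measurable]: "cis \<in> borel_measurable borel"
  by (intro borel_measurable_continuous_onI continuous_intros)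

lemma integrable_bounded_times_cis:
  assumes "prob_space P" and [measurable]: "w \<in> borel_measurable P" "u \<in> borel_measurable P"
    and "\<And>x. \<bar>w x\<bar> \<le> B"
  shows "integrable P (\<lambda>x. w x *\<^sub>R cis (u x))"
proof -
  interpret prob_space P by fact
  show ?thesis
    using assms(4) by (intro integrable_const_bound[where B=B]) (auto intro!: AE_I2)
qed

lemma integrable_cis_prob:
  assumes "prob_space P" and "u \<in> borel_measurable P"
  shows "integrable P (\<lambda>x. cis (u x))"
  using prob_space.integrable_iexp[OF assms(1), of u] assms(2) by (simp add: cis_conv_exp)

lemma integrable_bounded_times_bounded:
  fixes w :: "'a \<Rightarrow> real"
  assumes "prob_space P" and [measurable]: "w \<in> borel_measurable P" "u \<in> borel_measurable P"
    and "\<And>x. \<bar>w x\<bar> \<le> B" "\<And>x. \<bar>u x\<bar> \<le> D"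
  shows "integrable P (\<lambda>x. w x * u x)"
proof -
  interpret prob_space P by fact
  show ?thesis
    using assms(4,5) by (intro integrable_const_bound[where B="B*D"])
      (auto intro!: AE_I2 mult_mono' simp: abs_mult)
qed

text \<open>
  A weight that is bounded below can be normalised to a probability density with respect to \<open>P\<close>. The
  hypothesis then says that the characteristic functions of \<open>U n\<close> under the tilted measures converge,
  up to normalising constants whose convergence is the case \<open>t = 0\<close>, so the classical theorem
  applies.
\<close>
lemma weighted_levy_continuity_ge_1:
  fixes P :: "'a measure" and Q :: "'b measure"
    and U :: "nat \<Rightarrow> 'a \<Rightarrow> real" and W :: "nat \<Rightarrow> 'a \<Rightarrow> real"
  assumes P: "prob_space P" and Q: "prob_space Q"
    and [measurable]: "\<And>n. U n \<in> borel_measurable P" "V \<in> borel_measurable Q"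
      "\<And>n. W n \<in> borel_measurable P" "W' \<in> borel_measurable Q"
    and W: "\<And>n x. 1 \<le> W n x" "\<And>n x. W n x \<le> B" "\<And>x. 1 \<le> W' x" "\<And>x. W' x \<le> B"
    and conv: "\<And>t. (\<lambda>n. CLINT x|P. W n x *\<^sub>R cis (t * U n x)) \<longlonglongrightarrow> (CLINT x|Q. W' x *\<^sub>R cis (t * V x))"
    and f: "continuous_on UNIV f" "\<And>x. \<bar>f x\<bar> \<le> (D::real)"
  shows "(\<lambda>n. \<integral>x. W n x * f (U n x) \<partial>P) \<longlonglongrightarrow> (\<integral>x. W' x * f (V x) \<partial>Q)"
proof -
  have [measurable]: "f \<in> borel_measurable borel"
    using f(1) by (rule borel_measurable_continuous_onI)
  \<comment> \<open>Applied below to both sides, which live on different probability spaces.\<close>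
  have gen: "real_distribution (distr (density R (\<lambda>x. ennreal (w x / (\<integral>x. w x \<partial>R)))) borel u) \<and>
     char (distr (density R (\<lambda>x. ennreal (w x / (\<integral>x. w x \<partial>R)))) borel u) t
       = (CLINT x|R. w x *\<^sub>R cis (t * u x)) /\<^sub>R (\<integral>x. w x \<partial>R) \<and>
     (\<integral>x. f x \<partial>(distr (density R (\<lambda>x. ennreal (w x / (\<integral>x. w x \<partial>R)))) borel u))
       = (\<integral>x. w x * f (u x) \<partial>R) / (\<integral>x. w x \<partial>R) \<and> 1 \<le> (\<integral>x. w x \<partial>R)"
    if R: "prob_space R" and [measurable]: "u \<in> borel_measurable R" "w \<in> borel_measurable R"
      and w: "\<And>x. 1 \<le> w x" "\<And>x. w x \<le> B" for R :: "'c measure" and u w :: "'c \<Rightarrow> real" and t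
  proof -
    interpret prob_space R by fact
    have iw: "integrable R w"
      using w order_trans[OF zero_le_one w(1)] by (intro integrable_const_bound[where B=B]) (auto intro!: AE_I2 simp: abs_of_nonneg)
    have m1: "1 \<le> (\<integral>x. w x \<partial>R)"
      using integral_mono[OF integrable_const iw, of 1] w prob_space by simp
    define m where "m = (\<integral>x. w x \<partial>R)"
    have m: "1 \<le> m" using m1 m_def by simp
    have wpos: "0 \<le> w x / m" for x using w(1)[of x] m by simp
    define D' where "D' = density R (\<lambda>x. ennreal (w x / m))"
    have em: "emeasure D' (space D') = 1"
    proof -
      have "emeasure D' (space D') = (\<integral>\<^sup>+x. ennreal (w x / m) \<partial>R)"
        unfolding D'_def by (simp add: emeasure_density cong: nn_integral_cong)
      also have "\<dots> = ennreal (\<integral>x. w x / m \<partial>R)"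
        using iw wpos by (intro nn_integral_eq_integral) auto
      also have "\<dots> = 1" using m m_def by simp
      finally show ?thesis .
    qed
    have [measurable]: "u \<in> borel_measurable D'" unfolding D'_def by simp
    have pD: "prob_space D'" by (rule prob_spaceI) fact
    have rd: "real_distribution (distr D' borel u)"
      by (intro real_distribution.intro prob_space.prob_space_distr pD)
        (auto simp: real_distribution_axioms_def)
    have 1: "char (distr D' borel u) t = (CLINT x|R. w x *\<^sub>R cis (t * u x)) /\<^sub>R m"
      unfolding char_def D'_def cis_conv_exp[symmetric] using wpos
      by (simp add: integral_distr integral_density divide_inverse mult.commute scaleR_scaleR[symmetric] del: scaleR_scaleR)
    have 2: "(\<integral>x. f x \<partial>(distr D' borel u)) = (\<integral>x. w x * f (u x) \<partial>R) / m"
      unfolding D'_def using wpos by (simp add: integral_distr integral_density)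
    show ?thesis using rd 1 2 m1 unfolding D'_def m_def by blast
  qed
  define \<mu> where "\<mu> n = distr (density P (\<lambda>x. ennreal (W n x / (\<integral>x. W n x \<partial>P)))) borel (U n)" for n
  define \<mu>' where "\<mu>' = distr (density Q (\<lambda>x. ennreal (W' x / (\<integral>x. W' x \<partial>Q)))) borel V"
  have g1: "real_distribution (\<mu> n) \<and>
     char (\<mu> n) t = (CLINT x|P. W n x *\<^sub>R cis (t * U n x)) /\<^sub>R (\<integral>x. W n x \<partial>P) \<and>
     (\<integral>x. f x \<partial>\<mu> n) = (\<integral>x. W n x * f (U n x) \<partial>P) / (\<integral>x. W n x \<partial>P) \<and> 1 \<le> (\<integral>x. W n x \<partial>P)" for n t
    unfolding \<mu>_def by (rule gen[OF P _ _ W(1,2)]) measurable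
  have g2: "real_distribution \<mu>' \<and>
     char \<mu>' t = (CLINT x|Q. W' x *\<^sub>R cis (t * V x)) /\<^sub>R (\<integral>x. W' x \<partial>Q) \<and>
     (\<integral>x. f x \<partial>\<mu>') = (\<integral>x. W' x * f (V x) \<partial>Q) / (\<integral>x. W' x \<partial>Q) \<and> 1 \<le> (\<integral>x. W' x \<partial>Q)" for t
    unfolding \<mu>'_def by (rule gen[OF Q _ _ W(3,4)]) measurable
  have ne: "(\<integral>x. W' x \<partial>Q) \<noteq> 0" "(\<integral>x. W n x \<partial>P) \<noteq> 0" for n
    using g1[of n 0] g2[of 0] by linarith+
  have "(\<lambda>n. CLINT x|P. of_real (W n x)) \<longlonglongrightarrow> (CLINT x|Q. of_real (W' x))"
    using conv[of 0] by (simp add: scaleR_conv_of_real)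
  then have mconv: "(\<lambda>n. \<integral>x. W n x \<partial>P) \<longlonglongrightarrow> (\<integral>x. W' x \<partial>Q)"
    by (simp add: tendsto_of_real_iff)
  have "weak_conv_m \<mu> \<mu>'"
  proof (rule levy_continuity)
    show "(\<lambda>n. char (\<mu> n) t) \<longlonglongrightarrow> char \<mu>' t" for t
      using ne g1[of _ t] g2[of t] by (auto intro!: tendsto_intros mconv conv)
    show "real_distribution (\<mu> n)" "real_distribution \<mu>'" for n
      using g1 g2 by blast+
  qed
  then have "(\<lambda>n. \<integral>x. f x \<partial>\<mu> n) \<longlonglongrightarrow> (\<integral>x. f x \<partial>\<mu>')"
    by (rule weak_conv_imp_integral_bdd_continuous_conv[rotated 2, where B=D])
      (use g1 g2 f in \<open>auto simp: continuous_on_eq_continuous_at\<close>)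
  from tendsto_mult[OF mconv this] show ?thesis
    using ne g1[of _ 0] g2[of 0] by simp
qed

text \<open>
  A signed weight is the difference of the weights \<open>B + 1 + W n \<ge> 1\<close> and \<open>B + 1\<close>.
\<close>
lemma weighted_levy_continuity:
  fixes P :: "'a measure" and Q :: "'b measure"
    and U :: "nat \<Rightarrow> 'a \<Rightarrow> real" and W :: "nat \<Rightarrow> 'a \<Rightarrow> real"
  assumes P: "prob_space P" and Q: "prob_space Q"
    and [measurable]: "\<And>n. U n \<in> borel_measurable P" "V \<in> borel_measurable Q"
      "\<And>n. W n \<in> borel_measurable P" "W' \<in> borel_measurable Q"
    and W: "\<And>n x. \<bar>W n x\<bar> \<le> B" "\<And>x. \<bar>W' x\<bar> \<le> B"
    and conv0: "\<And>t. (\<lambda>n. CLINT x|P. cis (t * U n x)) \<longlonglongrightarrow> (CLINT x|Q. cis (t * V x))"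
    and conv: "\<And>t. (\<lambda>n. CLINT x|P. W n x *\<^sub>R cis (t * U n x)) \<longlonglongrightarrow> (CLINT x|Q. W' x *\<^sub>R cis (t * V x))"
    and f: "continuous_on UNIV f" "\<And>x. \<bar>f x\<bar> \<le> (D::real)"
  shows "(\<lambda>n. \<integral>x. W n x * f (U n x) \<partial>P) \<longlonglongrightarrow> (\<integral>x. W' x * f (V x) \<partial>Q)"
proof -
  interpret P: prob_space P by fact
  interpret Q: prob_space Q by fact
  have [measurable]: "f \<in> borel_measurable borel"
    using f(1) by (rule borel_measurable_continuous_onI)
  have 1: "(\<lambda>n. \<integral>x. (B + 1) * f (U n x) \<partial>P) \<longlonglongrightarrow> (\<integral>x. (B + 1) * f (V x) \<partial>Q)"
  proof -
    have "(\<lambda>n. \<integral>x. 1 * f (U n x) \<partial>P) \<longlonglongrightarrow> (\<integral>x. 1 * f (V x) \<partial>Q)"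
      by (rule weighted_levy_continuity_ge_1[OF P Q _ _ _ _ _ _ _ _ _ f, where B=1]) (use conv0 in auto)
    then show ?thesis by (simp add: tendsto_mult_left)
  qed
  have i1: "integrable P (\<lambda>x. (B+1) *\<^sub>R cis (t * U n x))" for t n
    by (intro integrable_scaleR_right integrable_cis_prob P) simp
  have i2: "integrable Q (\<lambda>x. (B+1) *\<^sub>R cis (t * V x))" for t
    by (intro integrable_scaleR_right integrable_cis_prob Q) simp
  have i3: "integrable P (\<lambda>x. W n x *\<^sub>R cis (t * U n x))" for t n
    by (rule integrable_bounded_times_cis[OF P _ _ W(1)]) auto
  have i4: "integrable Q (\<lambda>x. W' x *\<^sub>R cis (t * V x))" for t
    by (rule integrable_bounded_times_cis[OF Q _ _ W(2)]) auto
  have i5: "integrable P (\<lambda>x. (B+1) * f (U n x))" for n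
    by (rule integrable_bounded_times_bounded[OF P _ _ _ f(2), where B="\<bar>B+1\<bar>"]) auto
  have i6: "integrable Q (\<lambda>x. (B+1) * f (V x))"
    by (rule integrable_bounded_times_bounded[OF Q _ _ _ f(2), where B="\<bar>B+1\<bar>"]) auto
  have i7: "integrable P (\<lambda>x. W n x * f (U n x))" for n
    by (rule integrable_bounded_times_bounded[OF P _ _ W(1) f(2)]) auto
  have i8: "integrable Q (\<lambda>x. W' x * f (V x))"
    by (rule integrable_bounded_times_bounded[OF Q _ _ W(2) f(2)]) auto
  have 2: "(\<lambda>n. \<integral>x. (B + 1 + W n x) * f (U n x) \<partial>P) \<longlonglongrightarrow> (\<integral>x. (B + 1 + W' x) * f (V x) \<partial>Q)"
  proof (rule weighted_levy_continuity_ge_1[OF P Q _ _ _ _ _ _ _ _ _ f, where B="2*B+1"])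
    show "1 \<le> B + 1 + W n x" "B + 1 + W n x \<le> 2*B+1" for n x using W(1)[of n x] by auto
    show "1 \<le> B + 1 + W' x" "B + 1 + W' x \<le> 2*B+1" for x using W(2)[of x] by auto
    show "(\<lambda>n. CLINT x|P. (B + 1 + W n x) *\<^sub>R cis (t * U n x)) \<longlonglongrightarrow> (CLINT x|Q. (B + 1 + W' x) *\<^sub>R cis (t * V x))" for t
      unfolding scaleR_add_left[of "B+1"] Bochner_Integration.integral_add[OF i1 i3] Bochner_Integration.integral_add[OF i2 i4]
      by (intro tendsto_add conv) (auto intro!: tendsto_intros conv0)
  qed auto
  have "(\<lambda>n. (\<integral>x. (B + 1 + W n x) * f (U n x) \<partial>P) - (\<integral>x. (B + 1) * f (U n x) \<partial>P)) \<longlonglongrightarrow>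
     (\<integral>x. (B + 1 + W' x) * f (V x) \<partial>Q) - (\<integral>x. (B + 1) * f (V x) \<partial>Q)"
    by (intro tendsto_diff 1 2)
  then show ?thesis
    unfolding distrib_right[of "B+1"] Bochner_Integration.integral_add[OF i5 i7] Bochner_Integration.integral_add[OF i6 i8]
    by simp
qed

text \<open>
  The step from one to several coordinates. Exponentials are replaced by test functions one coordinate
  at a time: the factors that were already replaced, together with the real or imaginary part of the
  remaining exponential, form a bounded weight, and the weighted theorem replaces the next
  coordinate.
\<close>
lemma product_test_functions_converge:
  fixes P :: "'a measure" and Q :: "'b measure"
    and U :: "nat \<Rightarrow> nat \<Rightarrow> 'a \<Rightarrow> real" and V :: "nat \<Rightarrow> 'b \<Rightarrow> real" and u :: "nat \<Rightarrow> real"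
  assumes P: "prob_space P" and Q: "prob_space Q"
    and mU[measurable]: "\<And>n j. U n j \<in> borel_measurable P" and mV[measurable]: "\<And>j. V j \<in> borel_measurable Q"
    and conv: "\<And>u :: nat \<Rightarrow> real. (\<lambda>n. CLINT x|P. cis (\<Sum>j<N. u j * U n j x)) \<longlonglongrightarrow> (CLINT x|Q. cis (\<Sum>j<N. u j * V j x))"
    and f: "\<And>j. continuous_on UNIV (f j)" "\<And>j x. \<bar>f j x\<bar> \<le> (D j::real)"
    and "m \<le> N"
  shows "(\<lambda>n. CLINT x|P. (\<Prod>j<m. f j (U n j x)) *\<^sub>R cis (\<Sum>j=m..<N. u j * U n j x))
      \<longlonglongrightarrow> (CLINT x|Q. (\<Prod>j<m. f j (V j x)) *\<^sub>R cis (\<Sum>j=m..<N. u j * V j x))"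
  using f \<open>m \<le> N\<close>
proof (induction m arbitrary: f D u)
  case 0
  show ?case using conv by (simp add: atLeast0LessThan)
next
  case (Suc m)
  have [measurable]: "f j \<in> borel_measurable borel" for j
    using Suc.prems(1) by (rule borel_measurable_continuous_onI)
  have m: "m < N" using Suc.prems by simp
  have split: "{m..<N} = insert m {Suc m..<N}" using m by auto
  have D: "0 \<le> D j" for j using Suc.prems(2)[of j 0] by linarith
  define p where "p = (\<lambda>y::nat\<Rightarrow>real. \<Prod>j<m. f j (y j))"
  have pm[measurable]: "(\<lambda>x. p (\<lambda>j. U n j x)) \<in> borel_measurable P" "(\<lambda>x. p (\<lambda>j. V j x)) \<in> borel_measurable Q" for n
    unfolding p_def by measurable
  have pb: "\<bar>p y\<bar> \<le> (\<Prod>j<m. D j)" for y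
    unfolding p_def abs_prod using Suc.prems(2) by (intro prod_mono) auto
  have *: "(\<lambda>n. \<integral>x. (p (\<lambda>j. U n j x) * cos (c + (\<Sum>j=Suc m..<N. u j * U n j x))) * f m (U n m x) \<partial>P)
    \<longlonglongrightarrow> (\<integral>x. (p (\<lambda>j. V j x) * cos (c + (\<Sum>j=Suc m..<N. u j * V j x))) * f m (V m x) \<partial>Q)" for c
  proof (rule weighted_levy_continuity[OF P Q _ _ _ _ _ _ _ _ Suc.prems(1,2)])
    show "\<bar>p (\<lambda>j. U n j x) * cos (c + (\<Sum>j=Suc m..<N. u j * U n j x))\<bar> \<le> (\<Prod>j<m. D j)" for n x
      unfolding abs_mult using mult_mono'[OF pb[of "\<lambda>j. U n j x"] abs_cos_le_one] by simp
    show "\<bar>p (\<lambda>j. V j x) * cos (c + (\<Sum>j=Suc m..<N. u j * V j x))\<bar> \<le> (\<Prod>j<m. D j)" for x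
      unfolding abs_mult using mult_mono'[OF pb[of "\<lambda>j. V j x"] abs_cos_le_one] by simp
    fix t
    show "(\<lambda>n. CLINT x|P. cis (t * U n m x)) \<longlonglongrightarrow> (CLINT x|Q. cis (t * V m x))"
    proof -
      have "(\<Sum>j<N. (if j = m then t else 0) * y j) = t * y m" for y :: "nat \<Rightarrow> real"
        using m by (simp add: if_distrib[of "\<lambda>a. a * _"] cong: if_cong)
      then show ?thesis using conv[of "\<lambda>j. if j = m then t else 0"] by simp
    qed
    \<comment> \<open>Euler's formula turns the cosine weight into two exponentials in all of the remaining coordinates, to
      which the induction hypothesis applies.\<close>
    have eq: "(p y * cos (c + S)) *\<^sub>R cis (t * y m) =
      cis c / 2 * (p y *\<^sub>R cis (t * y m + S)) + cis (-c) / 2 * (p y *\<^sub>R cis (t * y m + - S))" for y S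
      by (simp add: complex_eq_iff cos_add sin_add cos_diff sin_diff field_simps)
    define ua where "ua = u(m := t)"
    define ub where "ub = (\<lambda>j. - u j)(m := t)"
    have sa: "(\<Sum>j=m..<N. ua j * y j) = t * y m + (\<Sum>j=Suc m..<N. u j * y j)" for y :: "nat \<Rightarrow> real"
      unfolding split ua_def by (simp add: sum.insert)
    have sb: "(\<Sum>j=m..<N. ub j * y j) = t * y m + - (\<Sum>j=Suc m..<N. u j * y j)" for y :: "nat \<Rightarrow> real"
      unfolding split ub_def by (simp add: sum.insert sum_negf)
    have eq': "(p y * cos (c + (\<Sum>j=Suc m..<N. u j * y j))) *\<^sub>R cis (t * y m) =
      cis c / 2 * (p y *\<^sub>R cis (\<Sum>j=m..<N. ua j * y j)) + cis (-c) / 2 * (p y *\<^sub>R cis (\<Sum>j=m..<N. ub j * y j))" for y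
      unfolding eq sa sb ..
    have int: "integrable P (\<lambda>x. p (\<lambda>j. U n j x) *\<^sub>R cis (\<Sum>j=m..<N. v j * U n j x))"
         "integrable Q (\<lambda>x. p (\<lambda>j. V j x) *\<^sub>R cis (\<Sum>j=m..<N. v j * V j x))" for v :: "nat \<Rightarrow> real" and n
      by (rule integrable_bounded_times_cis[OF P _ _ pb] integrable_bounded_times_cis[OF Q _ _ pb]; measurable)+
    have IH: "(\<lambda>n. CLINT x|P. p (\<lambda>j. U n j x) *\<^sub>R cis (\<Sum>j=m..<N. v j * U n j x))
      \<longlonglongrightarrow> (CLINT x|Q. p (\<lambda>j. V j x) *\<^sub>R cis (\<Sum>j=m..<N. v j * V j x))" for v :: "nat \<Rightarrow> real"
      using Suc.IH[where u=v, OF Suc.prems(1,2) less_imp_le[OF m]] unfolding p_def .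
    have eP: "(CLINT x|P. (p (\<lambda>j. U n j x) * cos (c + (\<Sum>j=Suc m..<N. u j * U n j x))) *\<^sub>R cis (t * U n m x)) =
      cis c / 2 * (CLINT x|P. p (\<lambda>j. U n j x) *\<^sub>R cis (\<Sum>j=m..<N. ua j * U n j x)) +
      cis (-c) / 2 * (CLINT x|P. p (\<lambda>j. U n j x) *\<^sub>R cis (\<Sum>j=m..<N. ub j * U n j x))" for n
      unfolding eq'[of "\<lambda>j. U n j _"]
      by (subst Bochner_Integration.integral_add) (intro integrable_mult_right int, intro integrable_mult_right int, simp only: integral_mult_right_zero)
    have eQ: "(CLINT x|Q. (p (\<lambda>j. V j x) * cos (c + (\<Sum>j=Suc m..<N. u j * V j x))) *\<^sub>R cis (t * V m x)) =
      cis c / 2 * (CLINT x|Q. p (\<lambda>j. V j x) *\<^sub>R cis (\<Sum>j=m..<N. ua j * V j x)) +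
      cis (-c) / 2 * (CLINT x|Q. p (\<lambda>j. V j x) *\<^sub>R cis (\<Sum>j=m..<N. ub j * V j x))"
      unfolding eq'[of "\<lambda>j. V j _"]
      by (subst Bochner_Integration.integral_add) (intro integrable_mult_right int, intro integrable_mult_right int, simp only: integral_mult_right_zero)
    show "(\<lambda>n. CLINT x|P. (p (\<lambda>j. U n j x) * cos (c + (\<Sum>j=Suc m..<N. u j * U n j x))) *\<^sub>R cis (t * U n m x))
      \<longlonglongrightarrow> (CLINT x|Q. (p (\<lambda>j. V j x) * cos (c + (\<Sum>j=Suc m..<N. u j * V j x))) *\<^sub>R cis (t * V m x))"
      unfolding eP eQ by (intro tendsto_add tendsto_mult_left IH)
  qed measurable
  \<comment> \<open>The choices \<open>c = 0\<close> and \<open>c = - pi / 2\<close> recover the cosine and the sine of the remaining phase.\<close>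
  have e2: "(\<Prod>j<Suc m. f j (y j)) *\<^sub>R cis S =
     complex_of_real ((p y * cos (0 + S)) * f m (y m)) + \<i> * complex_of_real ((p y * cos (-(pi/2) + S)) * f m (y m))" for y S
  proof -
    have "cis S = complex_of_real (cos S) + \<i> * complex_of_real (sin S)"
      by (simp add: complex_eq_iff)
    moreover have "cos (-(pi/2) + S) = sin S" by (simp add: cos_add cos_diff)
    ultimately show ?thesis unfolding p_def by (simp add: scaleR_conv_of_real algebra_simps)
  qed
  have bd: "\<bar>(p y * cos s) * f m (y m)\<bar> \<le> (\<Prod>j<m. D j) * 1 * D m" for y s
    unfolding abs_mult using pb[of y] Suc.prems(2)[of m "y m"] D
    by (intro mult_mono) (auto intro: prod_nonneg)
  interpret P: prob_space P by fact
  interpret Q: prob_space Q by fact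
  have int: "integrable P (\<lambda>x. (p (\<lambda>j. U n j x) * cos (c + (\<Sum>j=Suc m..<N. u j * U n j x))) * f m (U n m x))"
    "integrable Q (\<lambda>x. (p (\<lambda>j. V j x) * cos (c + (\<Sum>j=Suc m..<N. u j * V j x))) * f m (V m x))" for c n
    using bd by (auto intro!: P.integrable_const_bound[where B="(\<Prod>j<m. D j) * 1 * D m"]
        Q.integrable_const_bound[where B="(\<Prod>j<m. D j) * 1 * D m"] AE_I2)
  have e3: "(CLINT x|P. (\<Prod>j<Suc m. f j (U n j x)) *\<^sub>R cis (\<Sum>j=Suc m..<N. u j * U n j x)) =
     complex_of_real (\<integral>x. (p (\<lambda>j. U n j x) * cos (0 + (\<Sum>j=Suc m..<N. u j * U n j x))) * f m (U n m x) \<partial>P) +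
     \<i> * complex_of_real (\<integral>x. (p (\<lambda>j. U n j x) * cos (-(pi/2) + (\<Sum>j=Suc m..<N. u j * U n j x))) * f m (U n m x) \<partial>P)" for n
    unfolding e2[of "\<lambda>j. U n j _"]
    by (subst Bochner_Integration.integral_add) (intro integrable_of_real int, intro integrable_mult_right integrable_of_real int, simp only: integral_mult_right_zero integral_complex_of_real)
  have e4: "(CLINT x|Q. (\<Prod>j<Suc m. f j (V j x)) *\<^sub>R cis (\<Sum>j=Suc m..<N. u j * V j x)) =
     complex_of_real (\<integral>x. (p (\<lambda>j. V j x) * cos (0 + (\<Sum>j=Suc m..<N. u j * V j x))) * f m (V m x) \<partial>Q) +
     \<i> * complex_of_real (\<integral>x. (p (\<lambda>j. V j x) * cos (-(pi/2) + (\<Sum>j=Suc m..<N. u j * V j x))) * f m (V m x) \<partial>Q)"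
    unfolding e2[of "\<lambda>j. V j _"]
    by (subst Bochner_Integration.integral_add) (intro integrable_of_real int, intro integrable_mult_right integrable_of_real int, simp only: integral_mult_right_zero integral_complex_of_real)
  show ?case unfolding e3 e4 by (intro tendsto_intros *)
qed

section \<open>The continuity theorem for complex vectors\<close>

definition padded :: "nat \<Rightarrow> (nat \<Rightarrow> 'a \<Rightarrow> complex) \<Rightarrow> 'a \<Rightarrow> nat \<Rightarrow> complex" where
  "padded n Y \<omega> = (\<lambda>k. if k < n then Y k \<omega> else 0)"

lemma padded_measurable [measurable (raw)]:
  "(\<And>k. Y k \<in> borel_measurable P) \<Longrightarrow> padded n Y \<in> borel_measurable P"
  unfolding padded_def by (intro measurable_coordinatewise_then_product) auto

text \<open>
  The \<open>2n\<close> real coordinates of a vector in \<open>\<complex>\<^sup>n\<close>, real and imaginary parts interleaved.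
\<close>
definition coord :: "nat \<Rightarrow> (nat \<Rightarrow> complex) \<Rightarrow> real" where
  "coord j x = (if even j then Re (x (j div 2)) else Im (x (j div 2)))"

lemma continuous_coord [continuous_intros]: "continuous_on UNIV (coord j)"
  unfolding coord_def by (cases "even j") (auto intro!: continuous_intros)

lemma sum_coord:
  "(\<Sum>j<2*n. u j * coord j x) = Re (\<Sum>k<n. Complex (u (2*k)) (- u (2*k+1)) * x k)"
  by (induction n) (auto simp: coord_def algebra_simps)

text \<open>
  The algebra generated by bounded continuous functions of single coordinates. It is closed under
  products, and the convergence of the integrals of its members is exactly what
  \<open>product_test_functions_converge\<close> provides.
\<close>
inductive prod_span :: "nat \<Rightarrow> ((nat \<Rightarrow> complex) \<Rightarrow> real) \<Rightarrow> bool" for N where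
  base: "(\<And>j. continuous_on UNIV (f j)) \<Longrightarrow> (\<And>j. \<exists>D::real. \<forall>x::real. \<bar>f j x\<bar> \<le> D) \<Longrightarrow>
     prod_span N (\<lambda>x. c * (\<Prod>j<N. f j (coord j x)))"
| add: "prod_span N g \<Longrightarrow> prod_span N h \<Longrightarrow> prod_span N (\<lambda>x. g x + h x)"

lemma prod_span_const: "prod_span N (\<lambda>x. c)"
  using prod_span.base[of "\<lambda>_ _. 1" N c] by (auto intro: exI[of _ 1])

lemma prod_span_coord:
  assumes "j < N" "continuous_on UNIV g" "\<And>x. \<bar>g x\<bar> \<le> D"
  shows "prod_span N (\<lambda>x. g (coord j x))"
proof -
  define f where "f = (\<lambda>i. if i = j then g else (\<lambda>_. 1))"
  have "(\<Prod>i<N. f i (coord i x)) = g (coord j x)" for x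
  proof -
    have "(\<Prod>i<N. f i (coord i x)) = (\<Prod>i<N. if i = j then g (coord j x) else 1)"
      by (intro prod.cong) (auto simp: f_def)
    then show ?thesis using assms(1) by simp
  qed
  moreover have "prod_span N (\<lambda>x. 1 * (\<Prod>i<N. f i (coord i x)))"
    using assms by (intro prod_span.base) (auto simp: f_def intro: exI[of _ D] exI[of _ 1])
  ultimately show ?thesis by simp
qed

lemma prod_span_mult:
  assumes "prod_span N g" "prod_span N h"
  shows "prod_span N (\<lambda>x. g x * h x)"
  using assms(1)
proof induction
  case (base f c)
  show ?case using assms(2)
  proof induction
    case (base f' c')
    have "prod_span N (\<lambda>x. (c * c') * (\<Prod>j<N. f j (coord j x) * f' j (coord j x)))"
    proof (rule prod_span.base[where f="\<lambda>j y. f j y * f' j y"])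
      fix j
      show "continuous_on UNIV (\<lambda>y. f j y * f' j y)"
        using base \<open>\<And>j. continuous_on UNIV (f j)\<close> by (intro continuous_intros) auto
      obtain D D' where "\<forall>x. \<bar>f j x\<bar> \<le> D" "\<forall>x. \<bar>f' j x\<bar> \<le> D'"
        using base \<open>\<And>j. \<exists>D. \<forall>x. \<bar>f j x\<bar> \<le> D\<close> by metis
      then show "\<exists>D. \<forall>x. \<bar>f j x * f' j x\<bar> \<le> D"
        by (intro exI[of _ "D * D'"]) (auto simp: abs_mult intro!: mult_mono')
    qed
    then show ?case by (simp add: prod.distrib ac_simps)
  next
    case (add g h)
    from prod_span.add[OF add.IH] show ?case by (simp add: distrib_left)
  qed
next
  case (add g h')
  from prod_span.add[OF add.IH] show ?case by (simp add: distrib_right)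
qed

lemma prod_span_sum:
  fixes m :: nat
  assumes "\<And>j. j < m \<Longrightarrow> prod_span N (g j)"
  shows "prod_span N (\<lambda>x. \<Sum>j<m. g j x)"
  using assms by (induction m) (simp_all add: prod_span_const prod_span.add)

lemma prod_span_continuous: "prod_span N g \<Longrightarrow> continuous_on UNIV g"
proof (induction rule: prod_span.induct)
  case (base f c)
  then show ?case
    by (intro continuous_intros continuous_on_compose2[OF base(1)]) auto
qed (auto intro: continuous_intros)

lemma prod_span_bounded: "prod_span N g \<Longrightarrow> \<exists>D. \<forall>x. \<bar>g x\<bar> \<le> D"
proof (induction rule: prod_span.induct)
  case (base f c)
  then obtain D where "\<And>j x. \<bar>f j x\<bar> \<le> D j" by metis
  then show ?case
    by (intro exI[of _ "\<bar>c\<bar> * (\<Prod>j<N. D j)"]) (auto simp: abs_mult abs_prod intro!: mult_left_mono prod_mono)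
next
  case (add g h)
  then obtain D D' where "\<forall>x. \<bar>g x\<bar> \<le> D" "\<forall>x. \<bar>h x\<bar> \<le> D'" by auto
  then show ?case by (intro exI[of _ "D+D'"]) (auto intro: order_trans[OF abs_triangle_ineq] add_mono)
qed

text \<open>
  Truncation of all coordinates to \<open>[-R, R]\<close>. It retracts onto a compact cube, where the
  Stone-Weierstrass theorem is available, and it maps \<open>prod_span\<close> to itself because it acts on each
  coordinate separately.
\<close>
definition clampv :: "nat \<Rightarrow> real \<Rightarrow> (nat \<Rightarrow> complex) \<Rightarrow> nat \<Rightarrow> complex" where
  "clampv n R x = (\<lambda>k. if k < n then Complex (max (-R) (min R (Re (x k)))) (max (-R) (min R (Im (x k)))) else 0)"

lemma coord_clampv: "j < 2*n \<Longrightarrow> coord j (clampv n R x) = max (-R) (min R (coord j x))"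
  by (auto simp: coord_def clampv_def)

lemma prod_span_clampv:
  assumes "prod_span (2*n) g"
  shows "prod_span (2*n) (\<lambda>x. g (clampv n R x))"
  using assms
proof induction
  case (base f c)
  have "prod_span (2*n) (\<lambda>x. c * (\<Prod>j<2*n. f j (max (-R) (min R (coord j x)))))"
    using base by (intro prod_span.base[where f="\<lambda>j y. f j (max (-R) (min R y))"])
      (auto intro!: continuous_on_compose2[OF base(1)] continuous_intros, blast)
  then show ?case by (simp add: coord_clampv cong: prod.cong_simp)
next
  case (add g h)
  from prod_span.add[OF add.IH] show ?case .
qed

lemma coord_eqI:
  assumes "\<And>j. j < 2*n \<Longrightarrow> coord j x = coord j y" "\<And>k. k \<ge> n \<Longrightarrow> x k = y k"
  shows "x = y"
proof
  fix k
  show "x k = y k"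
  proof (cases "k < n")
    case True
    then show ?thesis
      using assms(1)[of "2*k"] assms(1)[of "2*k+1"] by (auto simp: coord_def complex_eq_iff)
  qed (use assms(2) in auto)
qed

text \<open>
  Composing a Stone-Weierstrass approximant with the truncation makes the approximation global and keeps
  the approximant bounded.
\<close>
lemma product_functions_dense_on_cube:
  fixes h :: "(nat \<Rightarrow> complex) \<Rightarrow> real"
  assumes h: "continuous_on UNIV h" and "0 < R" "0 < e"
  obtains g where "prod_span (2*n) g" "\<And>x. \<bar>h (clampv n R x) - g x\<bar> < e"
proof -
  define S where "S = (\<lambda>k. if k < n then cbox (Complex (-R) (-R)) (Complex R R) else {0})"
  define K where "K = Pi\<^sub>E UNIV S"
  have "compact K"
    unfolding K_def using compactin_PiE[of "\<lambda>_. euclidean" UNIV S]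
    by (auto simp: euclidean_product_topology S_def)
  have cont: "continuous_on K g" if "prod_span (2*n) g" for g
    using prod_span_continuous[OF that] continuous_on_subset by blast
  have inK: "clampv n R x \<in> K" for x
    using \<open>0 < R\<close> by (auto simp: K_def S_def clampv_def in_cbox_complex_iff)
  interpret function_ring_on "Collect (prod_span (2*n))" K
  proof unfold_locales
    fix x y assume xy: "x \<in> K" "y \<in> K" "x \<noteq> y"
    have "x k = y k" if "k \<ge> n" for k
      using xy that unfolding K_def S_def by (auto dest!: PiE_mem[of _ _ _ k])
    then obtain j where j: "j < 2*n" "coord j x \<noteq> coord j y"
      using coord_eqI[of n x y] xy by blast
    have bd: "\<bar>coord j z\<bar> \<le> R" if "z \<in> K" for z
    proof -
      have "j div 2 < n" using j by auto
      then have "z (j div 2) \<in> cbox (Complex (-R) (-R)) (Complex R R)"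
        using that unfolding K_def S_def by (auto dest!: PiE_mem[of _ _ _ "j div 2"])
      then show ?thesis by (auto simp: coord_def in_cbox_complex_iff)
    qed
    have "prod_span (2*n) (\<lambda>z. max (-R) (min R (coord j z)))"
      using j \<open>0 < R\<close> by (intro prod_span_coord[where D=R and g="\<lambda>y. max (-R) (min R y)"]) (auto intro!: continuous_intros)
    then show "\<exists>f\<in>Collect (prod_span (2*n)). f x \<noteq> f y"
      using bd[OF xy(1)] bd[OF xy(2)] j by (intro bexI[of _ "\<lambda>z. max (-R) (min R (coord j z))"]) auto
  qed (auto intro: \<open>compact K\<close> cont prod_span.add prod_span_mult prod_span_const)
  obtain g where "prod_span (2*n) g" "\<And>x. x \<in> K \<Longrightarrow> \<bar>h x - g x\<bar> < e"
    using Stone_Weierstrass_basic[OF continuous_on_subset[OF h] \<open>0 < e\<close>] by auto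
  then show ?thesis
    by (intro that[of "\<lambda>x. g (clampv n R x)"] prod_span_clampv) (auto intro: inK)
qed

lemma integrable_bounded_padded:
  fixes h :: "(nat \<Rightarrow> complex) \<Rightarrow> real"
  assumes "prob_space P" "\<And>k. Y k \<in> borel_measurable P" "continuous_on UNIV h" "\<And>x. \<bar>h x\<bar> \<le> D"
  shows "integrable P (\<lambda>\<omega>. h (padded n Y \<omega>))"
proof -
  interpret prob_space P by fact
  have [measurable]: "h \<in> borel_measurable borel" "\<And>k. Y k \<in> borel_measurable P"
    using assms by (auto intro: borel_measurable_continuous_onI)
  show ?thesis by (rule integrable_const_bound[where B=D]) (use assms(4) in auto)
qed

text \<open>
  A bounded continuous \<open>h\<close> is approximated by members of \<open>prod_span\<close> inside a large cube. The error
  outside is at most a multiple of a sum of one-coordinate tail functions; that sum is itself a member of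
  \<open>prod_span\<close>, so its integrals converge too, which gives the required tightness.
\<close>
theorem multivariate_levy_continuity:
  fixes P :: "'a measure" and Q :: "'b measure"
    and Y :: "nat \<Rightarrow> nat \<Rightarrow> 'a \<Rightarrow> complex" and Z :: "nat \<Rightarrow> 'b \<Rightarrow> complex"
    and h :: "(nat \<Rightarrow> complex) \<Rightarrow> real"
  assumes P: "prob_space P" and Q: "prob_space Q"
    and mY[measurable]: "\<And>i k. Y i k \<in> borel_measurable P" and mZ[measurable]: "\<And>k. Z k \<in> borel_measurable Q"
    and conv: "\<And>z :: nat \<Rightarrow> complex. (\<lambda>i. chf P (\<lambda>\<omega>. \<Sum>k<n. z k * Y i k \<omega>)) \<longlonglongrightarrow> chf Q (\<lambda>\<omega>. \<Sum>k<n. z k * Z k \<omega>)"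
    and h: "continuous_on UNIV h" "\<And>x. \<bar>h x\<bar> \<le> D"
  shows "(\<lambda>i. \<integral>\<omega>. h (padded n (Y i) \<omega>) \<partial>P) \<longlonglongrightarrow> (\<integral>\<omega>. h (padded n Z \<omega>) \<partial>Q)"
proof -
  have D: "0 \<le> D" using h(2)[of undefined] by linarith
  have span: "(\<lambda>i. \<integral>\<omega>. g (padded n (Y i) \<omega>) \<partial>P) \<longlonglongrightarrow> (\<integral>\<omega>. g (padded n Z \<omega>) \<partial>Q)" if "prod_span (2*n) g" for g
    using that
  proof (induction rule: prod_span.induct)
    case (base f c)
    then obtain D' where D': "\<And>j x. \<bar>f j x\<bar> \<le> D' j" by metis
    have vz: "(\<Sum>k<n. Complex (u (2*k)) (- u (2*k+1)) * padded n X \<omega> k) = (\<Sum>k<n. Complex (u (2*k)) (- u (2*k+1)) * X k \<omega>)"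
      for u and X :: "nat \<Rightarrow> 'c \<Rightarrow> complex" and \<omega> by (intro sum.cong) (auto simp: padded_def)
    have mc[measurable]: "coord j \<in> borel_measurable borel" for j
      by (intro borel_measurable_continuous_onI continuous_coord)
    have "(\<lambda>i. CLINT x|P. (\<Prod>j<2*n. f j (coord j (padded n (Y i) x))) *\<^sub>R cis (\<Sum>j=2*n..<2*n. 0 * coord j (padded n (Y i) x)))
      \<longlonglongrightarrow> (CLINT x|Q. (\<Prod>j<2*n. f j (coord j (padded n Z x))) *\<^sub>R cis (\<Sum>j=2*n..<2*n. 0 * coord j (padded n Z x)))"
    proof (rule product_test_functions_converge[OF P Q _ _ _ base(1) D' order_refl])
      show "(\<lambda>i. CLINT x|P. cis (\<Sum>j<2*n. u j * coord j (padded n (Y i) x))) \<longlonglongrightarrow> (CLINT x|Q. cis (\<Sum>j<2*n. u j * coord j (padded n Z x)))" for u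
        using conv[of "\<lambda>k. Complex (u (2*k)) (- u (2*k+1))"] unfolding sum_coord vz chf_def .
    qed measurable
    then have "(\<lambda>i. complex_of_real (\<integral>x. (\<Prod>j<2*n. f j (coord j (padded n (Y i) x))) \<partial>P))
      \<longlonglongrightarrow> complex_of_real (\<integral>x. (\<Prod>j<2*n. f j (coord j (padded n Z x))) \<partial>Q)"
      by (simp add: scaleR_conv_of_real del: of_real_prod)
    then have "(\<lambda>i. \<integral>x. (\<Prod>j<2*n. f j (coord j (padded n (Y i) x))) \<partial>P)
      \<longlonglongrightarrow> (\<integral>x. (\<Prod>j<2*n. f j (coord j (padded n Z x))) \<partial>Q)"
      by (simp only: tendsto_of_real_iff)
    then show ?case by (simp add: tendsto_mult_left)
  next
    case (add g k)
    have "integrable P (\<lambda>\<omega>. g (padded n (Y i) \<omega>))" "integrable P (\<lambda>\<omega>. k (padded n (Y i) \<omega>))"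
        "integrable Q (\<lambda>\<omega>. g (padded n Z \<omega>))" "integrable Q (\<lambda>\<omega>. k (padded n Z \<omega>))" for i
      using add(1,2)[THEN prod_span_continuous] add(1,2)[THEN prod_span_bounded]
      by (auto intro!: integrable_bounded_padded[OF P] integrable_bounded_padded[OF Q])
    then show ?case using tendsto_add[OF add.IH] by simp
  qed
  \<comment> \<open>A continuous version of the indicator of \<open>\<bar>y\<bar> > R\<close>.\<close>
  define tail where "tail R y = min 1 (max 0 (\<bar>y\<bar> - R + 1))" for R y :: real
  define T where "T R x = 2 * D * (\<Sum>j<2*n. tail R (coord j x))" for R x
  have T: "prod_span (2*n) (T R)" for R
    unfolding T_def by (intro prod_span_mult prod_span_const prod_span_sum prod_span_coord[where D=1])
      (auto simp: tail_def intro!: continuous_intros)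
  have hT: "\<bar>h x - h (clampv n R x)\<bar> \<le> T R x" if "\<And>k. k \<ge> n \<Longrightarrow> x k = 0" for x R
  proof (cases "\<forall>j<2*n. \<bar>coord j x\<bar> \<le> R")
    case True
    then have "clampv n R x = x"
      using that by (intro coord_eqI[of n]) (simp_all add: coord_clampv abs_le_iff, auto simp: clampv_def)
    then show ?thesis using D by (auto simp: T_def tail_def intro!: mult_nonneg_nonneg sum_nonneg)
  next
    case False
    then obtain j where j: "j < 2*n" "\<bar>coord j x\<bar> > R" by auto
    have "1 \<le> tail R (coord j x)" using j by (auto simp: tail_def)
    also have "\<dots> \<le> (\<Sum>j<2*n. tail R (coord j x))"
      using j by (intro member_le_sum) (auto simp: tail_def)
    finally have "2 * D * 1 \<le> T R x" unfolding T_def using D by (intro mult_left_mono) auto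
    moreover have "\<bar>h x - h (clampv n R x)\<bar> \<le> 2 * D"
      using h(2)[of x] h(2)[of "clampv n R x"] by linarith
    ultimately show ?thesis by linarith
  qed
  have v0: "padded n X \<omega> k = 0" if "k \<ge> n" for X :: "nat \<Rightarrow> 'c \<Rightarrow> complex" and \<omega> k using that by (simp add: padded_def)
  interpret Q: prob_space Q by fact
  interpret P: prob_space P by fact
  have "(\<lambda>m. \<integral>\<omega>. T (real m) (padded n Z \<omega>) \<partial>Q) \<longlonglongrightarrow> (\<integral>\<omega>. 0 \<partial>Q)"
  proof (rule integral_dominated_convergence[where w="\<lambda>_. 2 * D * (\<Sum>j<2*n. 1)"])
    have Tm: "T R \<in> borel_measurable borel" for R
      using prod_span_continuous[OF T] by (rule borel_measurable_continuous_onI)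
    show "(\<lambda>\<omega>. T (real m) (padded n Z \<omega>)) \<in> borel_measurable Q" for m
      using measurable_compose[OF _ Tm, of "padded n Z" Q] by simp
    show "AE \<omega> in Q. norm (T (real m) (padded n Z \<omega>)) \<le> 2 * D * (\<Sum>j<2*n. 1)" for m
    proof (rule AE_I2)
      fix \<omega>
      have "0 \<le> T (real m) (padded n Z \<omega>)" using D by (auto simp: T_def tail_def intro!: mult_nonneg_nonneg sum_nonneg)
      moreover have "T (real m) (padded n Z \<omega>) \<le> 2 * D * (\<Sum>j<2*n. 1)"
        unfolding T_def using D by (intro mult_left_mono sum_mono) (auto simp: tail_def)
      ultimately show "norm (T (real m) (padded n Z \<omega>)) \<le> 2 * D * (\<Sum>j<2*n. 1)" by simp
    qed
    have "(\<lambda>m. tail (real m) y) \<longlonglongrightarrow> 0" for y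
    proof (rule tendsto_eventually)
      obtain m0 :: nat where m0: "\<bar>y\<bar> + 1 \<le> real m0" using real_arch_simple by blast
      show "\<forall>\<^sub>F m in sequentially. tail (real m) y = 0"
        using eventually_ge_at_top[of m0] by eventually_elim (use m0 in \<open>auto simp: tail_def\<close>)
    qed
    then show "AE \<omega> in Q. (\<lambda>m. T (real m) (padded n Z \<omega>)) \<longlonglongrightarrow> 0"
      unfolding T_def by (intro AE_I2 tendsto_mult_right_zero tendsto_null_sum) auto
  qed auto
  then have T0: "(\<lambda>m. \<integral>\<omega>. T (real m) (padded n Z \<omega>) \<partial>Q) \<longlonglongrightarrow> 0" by simp
  show ?thesis
  proof (rule LIMSEQ_I)
    fix r :: real assume "0 < r"
    define e where "e = r / 6"
    have e: "0 < e" using \<open>0 < r\<close> by (simp add: e_def)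
    have "\<forall>\<^sub>F m in sequentially. (\<integral>\<omega>. T (real m) (padded n Z \<omega>) \<partial>Q) < e"
      using T0 e by (rule order_tendstoD)
    from eventually_conj[OF this eventually_gt_at_top[of 0]] obtain m where
      m: "(\<integral>\<omega>. T (real m) (padded n Z \<omega>) \<partial>Q) < e" "0 < m" by (auto simp: eventually_sequentially)
    define R where "R = real m"
    have R: "0 < R" using m by (simp add: R_def)
    obtain g where g: "prod_span (2*n) g" "\<And>x. \<bar>h (clampv n R x) - g x\<bar> < e"
      using product_functions_dense_on_cube[OF h(1) R e] by blast
    have close: "\<bar>h x - g x\<bar> \<le> e + T R x" if "\<And>k. k \<ge> n \<Longrightarrow> x k = 0" for x
      using hT[of x R] that g(2)[of x] by force
    \<comment> \<open>The error budget: \<open>e\<close> from the approximation and less than \<open>e\<close> from the tail for the limit, \<open>e\<close> and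
      \<open>2 * e\<close> for the sequence, and \<open>e\<close> from the convergence for \<open>g\<close>, which add up to \<open>r = 6 * e\<close>.\<close>
    have key: "\<bar>(\<integral>\<omega>. h (padded n X \<omega>) \<partial>M) - (\<integral>\<omega>. g (padded n X \<omega>) \<partial>M)\<bar> \<le> e + (\<integral>\<omega>. T R (padded n X \<omega>) \<partial>M)"
      if M: "prob_space M" and X: "\<And>k. X k \<in> borel_measurable M" for M :: "'c measure" and X
    proof -
      interpret M: prob_space M by fact
      have iT: "integrable M (\<lambda>\<omega>. T R (padded n X \<omega>))"
        using prod_span_bounded[OF T[of R]] by (auto intro: integrable_bounded_padded[OF M X prod_span_continuous[OF T]])
      have ig: "integrable M (\<lambda>\<omega>. g (padded n X \<omega>))"
        using prod_span_bounded[OF g(1)] by (auto intro: integrable_bounded_padded[OF M X prod_span_continuous[OF g(1)]])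
      have ih: "integrable M (\<lambda>\<omega>. h (padded n X \<omega>))" by (rule integrable_bounded_padded[OF M X h])
      have "\<bar>\<integral>\<omega>. h (padded n X \<omega>) - g (padded n X \<omega>) \<partial>M\<bar> \<le> (\<integral>\<omega>. \<bar>h (padded n X \<omega>) - g (padded n X \<omega>)\<bar> \<partial>M)"
        by (rule integral_abs_bound)
      also have "\<dots> \<le> (\<integral>\<omega>. e + T R (padded n X \<omega>) \<partial>M)"
        using iT ig ih close[OF v0] by (intro integral_mono) auto
      also have "\<dots> = e + (\<integral>\<omega>. T R (padded n X \<omega>) \<partial>M)"
        using iT M.prob_space by simp
      finally show ?thesis using ig ih by simp
    qed
    from order_tendstoD(2)[OF span[OF T[of R]], of "2*e"] m
    have "\<forall>\<^sub>F i in sequentially. (\<integral>\<omega>. T R (padded n (Y i) \<omega>) \<partial>P) < 2 * e"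
      using e by (simp add: R_def)
    moreover have "\<forall>\<^sub>F i in sequentially. dist (\<integral>\<omega>. g (padded n (Y i) \<omega>) \<partial>P) (\<integral>\<omega>. g (padded n Z \<omega>) \<partial>Q) < e"
      using span[OF g(1)] e by (rule tendstoD)
    ultimately have "\<forall>\<^sub>F i in sequentially. norm ((\<integral>\<omega>. h (padded n (Y i) \<omega>) \<partial>P) - (\<integral>\<omega>. h (padded n Z \<omega>) \<partial>Q)) < r"
    proof eventually_elim
      case (elim i)
      then show ?case
        using key[OF P, of "Y i", OF mY] key[OF Q, of Z, OF mZ] m unfolding e_def R_def dist_real_def real_norm_def
        by linarith
    qed
    then show "\<exists>no. \<forall>i\<ge>no. norm ((\<integral>\<omega>. h (padded n (Y i) \<omega>) \<partial>P) - (\<integral>\<omega>. h (padded n Z \<omega>) \<partial>Q)) < r"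
      by (simp add: eventually_sequentially)
  qed
qed

section \<open>Uniqueness, independence and tails from characteristic functions\<close>

lemma chf_distr:
  assumes "Y \<in> measurable P M" "X \<in> borel_measurable M"
  shows "chf (distr P M Y) X = chf P (\<lambda>\<omega>. X (Y \<omega>))"
  unfolding chf_def using assms by (subst integral_distr) auto

lemma chf_cong_AE:
  assumes "X \<in> borel_measurable P" "Y \<in> borel_measurable P" "AE \<omega> in P. X \<omega> = Y \<omega>"
  shows "chf P X = chf P Y"
  unfolding chf_def using assms by (intro integral_cong_AE) auto

text \<open>
  The indicator of an open set \<open>S\<close> is the increasing limit of the continuous functions
  \<open>min 1 (m * infdist x (- S))\<close>, and open sets generate the Borel sets.
\<close>
lemma finite_measure_eq_if_integrals_eq:
  fixes \<mu> \<nu> :: "'b::metric_space measure"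
  assumes "prob_space \<mu>" "prob_space \<nu>" and sets: "sets \<mu> = sets borel" "sets \<nu> = sets borel"
    and eq: "\<And>h :: 'b \<Rightarrow> real. continuous_on UNIV h \<Longrightarrow> (\<And>x. \<bar>h x\<bar> \<le> 1) \<Longrightarrow> (\<integral>x. h x \<partial>\<mu>) = (\<integral>x. h x \<partial>\<nu>)"
  shows "\<mu> = \<nu>"
proof -
  interpret \<mu>: prob_space \<mu> by fact
  interpret \<nu>: prob_space \<nu> by fact
  have meas[measurable_cong]: "sets \<mu> = sets borel" "sets \<nu> = sets borel" by fact+
  have sp: "space \<mu> = UNIV" "space \<nu> = UNIV" using sets by (auto dest: sets_eq_imp_space_eq)
  have "emeasure \<mu> S = emeasure \<nu> S" if S: "open S" for S
  proof (cases "S = UNIV")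
    case True
    then show ?thesis using \<mu>.emeasure_space_1 \<nu>.emeasure_space_1 sp by simp
  next
    case False
    define h where "h m x = min 1 (real m * infdist x (-S))" for m x
    have ch: "continuous_on UNIV (h m)" for m unfolding h_def by (intro continuous_intros)
    have bh: "\<bar>h m x\<bar> \<le> 1" for m x by (auto simp: h_def infdist_nonneg)
    have [measurable]: "h m \<in> borel_measurable borel" for m
      using ch by (rule borel_measurable_continuous_onI)
    have [measurable]: "S \<in> sets borel" using S by simp
    have lim: "(\<lambda>m. h m x) \<longlonglongrightarrow> indicator S x" for x
    proof (cases "x \<in> S")
      case True
      then have d: "0 < infdist x (-S)"
        using S False by (subst infdist_pos_not_in_closed) auto
      obtain m0 :: nat where "1 / infdist x (-S) \<le> real m0" using real_arch_simple by blast
      then have "1 \<le> real m * infdist x (-S)" if "m \<ge> m0" for m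
        using d that by (simp add: field_simps) (meson mult_right_mono le_trans less_imp_le order_trans of_nat_le_iff)
      then have "\<forall>\<^sub>F m in sequentially. h m x = 1"
        unfolding eventually_sequentially h_def by (intro exI[of _ m0]) auto
      then show ?thesis using True by (auto intro: tendsto_eventually)
    next
      case F: False
      then have "infdist x (-S) = 0" by simp
      then show ?thesis using F by (simp add: h_def)
    qed
    have conv: "(\<lambda>m. \<integral>x. h m x \<partial>\<rho>) \<longlonglongrightarrow> measure \<rho> S"
      if "prob_space \<rho>" and [measurable_cong]: "sets \<rho> = sets borel" for \<rho> :: "'b measure"
    proof -
      interpret \<rho>: prob_space \<rho> by fact
      have "(\<lambda>m. \<integral>x. h m x \<partial>\<rho>) \<longlonglongrightarrow> (\<integral>x. indicator S x \<partial>\<rho>)"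
        by (rule integral_dominated_convergence[where w="\<lambda>_. 1"]) (use bh lim in auto)
      then show ?thesis by (simp add: sets_eq_imp_space_eq[OF that(2)])
    qed
    have "measure \<mu> S = measure \<nu> S"
      using LIMSEQ_unique[OF conv[OF assms(1) sets(1)]] conv[OF assms(2) sets(2)] eq[OF ch bh] by simp
    then show ?thesis by (simp add: \<mu>.emeasure_eq_measure \<nu>.emeasure_eq_measure)
  qed
  then show ?thesis
    using sets by (intro measure_eqI_generator_eq[where E="{S. open S}" and \<Omega>=UNIV and A="\<lambda>_. UNIV"])
      (auto simp: Int_stable_def borel_def)
qed

text \<open>
  Uniqueness is continuity applied to a constant sequence.
\<close>
lemma padded_distr_eq_if_chf_eq:
  fixes Y :: "nat \<Rightarrow> 'a \<Rightarrow> complex" and Z :: "nat \<Rightarrow> 'b \<Rightarrow> complex"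
  assumes P: "prob_space P" and Q: "prob_space Q"
    and mY[measurable]: "\<And>k. Y k \<in> borel_measurable P" and mZ[measurable]: "\<And>k. Z k \<in> borel_measurable Q"
    and eq: "\<And>z :: nat \<Rightarrow> complex. chf P (\<lambda>\<omega>. \<Sum>k<n. z k * Y k \<omega>) = chf Q (\<lambda>\<omega>. \<Sum>k<n. z k * Z k \<omega>)"
  shows "distr P borel (padded n Y) = distr Q borel (padded n Z)"
proof (rule finite_measure_eq_if_integrals_eq)
  show "prob_space (distr P borel (padded n Y))" "prob_space (distr Q borel (padded n Z))"
    by (auto intro!: prob_space.prob_space_distr P Q)
  fix h :: "(nat \<Rightarrow> complex) \<Rightarrow> real" assume h: "continuous_on UNIV h" "\<And>x. \<bar>h x\<bar> \<le> 1"
  then have [measurable]: "h \<in> borel_measurable borel" by (intro borel_measurable_continuous_onI)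
  have "(\<lambda>i::nat. \<integral>\<omega>. h (padded n Y \<omega>) \<partial>P) \<longlonglongrightarrow> (\<integral>\<omega>. h (padded n Z \<omega>) \<partial>Q)"
    by (rule multivariate_levy_continuity[OF P Q mY mZ _ h]) (simp add: eq)
  then show "(\<integral>x. h x \<partial>distr P borel (padded n Y)) = (\<integral>x. h x \<partial>distr Q borel (padded n Z))"
    by (simp add: integral_distr LIMSEQ_const_iff)
qed simp_all

lemma distr_eq_if_chf_eq:
  assumes P: "prob_space P" and Q: "prob_space Q"
    and [measurable]: "Y \<in> borel_measurable P" "Z \<in> borel_measurable Q"
    and eq: "\<And>z. chf P (\<lambda>\<omega>. z * Y \<omega>) = chf Q (\<lambda>\<omega>. z * Z \<omega>)"
  shows "distr P borel Y = distr Q borel Z"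
proof -
  have "distr P borel (padded 1 (\<lambda>_. Y)) = distr Q borel (padded 1 (\<lambda>_. Z))"
    by (rule padded_distr_eq_if_chf_eq[OF P Q]) (auto simp: eq)
  then have "distr (distr P borel (padded 1 (\<lambda>_. Y))) borel (\<lambda>x. x 0) = distr (distr Q borel (padded 1 (\<lambda>_. Z))) borel (\<lambda>x. x 0)"
    by simp
  then show ?thesis
    by (subst (asm) (1 2) distr_distr) (auto simp: comp_def padded_def intro!: borel_measurable_continuous_onI)
qed

text \<open>
  The same uniqueness for vectors indexed by a finite set \<open>J\<close>, transported along an enumeration of
  \<open>J\<close>; this is the form that Kolmogorov's extension theorem and product measures call for.
\<close>
lemma PiM_measure_eqI:
  fixes \<mu> \<nu> :: "('i \<Rightarrow> complex) measure"
  assumes "finite J" and \<mu>: "prob_space \<mu>" and \<nu>: "prob_space \<nu>"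
    and sets: "sets \<mu> = sets (Pi\<^sub>M J (\<lambda>_. borel))" "sets \<nu> = sets (Pi\<^sub>M J (\<lambda>_. borel))"
    and eq: "\<And>w. chf \<mu> (\<lambda>x. \<Sum>t\<in>J. w t * x t) = chf \<nu> (\<lambda>x. \<Sum>t\<in>J. w t * x t)"
  shows "\<mu> = \<nu>"
proof -
  obtain e where e: "bij_betw e {..<card J} J"
    using ex_bij_betw_nat_finite[OF \<open>finite J\<close>] by (auto simp: atLeast0LessThan)
  define n where "n = card J"
  define Y where "Y k x = (if k < n then x (e k) else 0)" for k and x :: "'i \<Rightarrow> complex"
  define g where "g = inv_into {..<n} e"
  have eJ: "k < n \<Longrightarrow> e k \<in> J" for k using e by (auto simp: bij_betw_def n_def)
  have g: "t \<in> J \<Longrightarrow> g t < n \<and> e (g t) = t" for t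
    using e unfolding g_def n_def by (metis bij_betw_def f_inv_into_f inv_into_into lessThan_iff)
  define \<rho> where "\<rho> y = (\<lambda>t\<in>J. y (g t))" for y :: "nat \<Rightarrow> complex"
  have rm[measurable]: "\<rho> \<in> measurable borel (Pi\<^sub>M J (\<lambda>_. borel))"
    unfolding \<rho>_def by (intro measurable_restrict borel_measurable_continuous_onI) auto
  have mY: "Y k \<in> borel_measurable M" if [measurable_cong]: "sets M = sets (Pi\<^sub>M J (\<lambda>_. borel))" for k and M :: "('i \<Rightarrow> complex) measure"
    using eJ[of k] unfolding Y_def by (cases "k < n") auto
  have sum: "(\<Sum>k<n. z k * Y k x) = (\<Sum>t\<in>J. z (g t) * x t)" for z x
  proof -
    have "g (e k) = k" if "k < n" for k
      using e that unfolding g_def n_def by (simp add: bij_betw_def inv_into_f_f)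
    then have "(\<Sum>k<n. z k * Y k x) = (\<Sum>k<n. z (g (e k)) * x (e k))"
      by (intro sum.cong) (auto simp: Y_def)
    also have "\<dots> = (\<Sum>t\<in>J. z (g t) * x t)"
      using sum.reindex_bij_betw[OF e, of "\<lambda>t. z (g t) * x t"] by (simp add: n_def)
    finally show ?thesis .
  qed
  have "distr \<mu> borel (padded n Y) = distr \<nu> borel (padded n Y)"
    by (rule padded_distr_eq_if_chf_eq[OF \<mu> \<nu> mY[OF sets(1)] mY[OF sets(2)]]) (simp add: sum eq)
  then have 1: "distr (distr \<mu> borel (padded n Y)) (Pi\<^sub>M J (\<lambda>_. borel)) \<rho> = distr (distr \<nu> borel (padded n Y)) (Pi\<^sub>M J (\<lambda>_. borel)) \<rho>"
    by simp
  have recover: "distr (distr M borel (padded n Y)) (Pi\<^sub>M J (\<lambda>_. borel)) \<rho> = M"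
    if M: "sets M = sets (Pi\<^sub>M J (\<lambda>_. borel))" for M :: "('i \<Rightarrow> complex) measure"
  proof -
    note mY[OF M, measurable]
    have "distr (distr M borel (padded n Y)) (Pi\<^sub>M J (\<lambda>_. borel)) \<rho> = distr M (Pi\<^sub>M J (\<lambda>_. borel)) (\<rho> \<circ> padded n Y)"
      by (intro distr_distr) measurable
    also have "\<dots> = distr M M (\<lambda>x. x)"
    proof (rule distr_cong)
      fix x assume "x \<in> space M"
      then have "x \<in> extensional J" using sets_eq_imp_space_eq[OF M] by (auto simp: space_PiM PiE_def)
      then show "(\<rho> \<circ> padded n Y) x = x"
        using g by (auto simp: \<rho>_def padded_def Y_def fun_eq_iff extensional_def)
    qed (use M in auto)
    finally show ?thesis by (simp add: distr_id)
  qed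
  show ?thesis using 1 recover[OF sets(1)] recover[OF sets(2)] by simp
qed

lemma chf_PiM_sum:
  fixes M :: "'i \<Rightarrow> complex measure"
  assumes "finite I" and M: "\<And>i. prob_space (M i)" and [measurable_cong]: "\<And>i. sets (M i) = sets borel"
  shows "chf (Pi\<^sub>M I M) (\<lambda>x. \<Sum>i\<in>I. w i * x i) = (\<Prod>i\<in>I. chf (M i) (\<lambda>x. w i * x))"
proof -
  interpret product_prob_space M I
    by (intro product_prob_spaceI M)
  have cis_sum: "cis (Re (\<Sum>i\<in>I. w i * x i)) = (\<Prod>i\<in>I. cis (Re (w i * x i)))" for x :: "'i \<Rightarrow> complex"
    using \<open>finite I\<close> by induction (auto simp: cis_mult[symmetric])
  show ?thesis
    unfolding chf_def cis_sum using M
    by (intro product_integral_prod \<open>finite I\<close> integrable_cis_prob) auto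
qed

text \<open>
  The product of the marginal laws has the same characteristic function as the joint law.
\<close>
lemma indep_vars_if_chf_prod:
  assumes P: "prob_space P" and "finite I" and [measurable]: "\<And>i. Y i \<in> borel_measurable P"
    and eq: "\<And>w. chf P (\<lambda>\<omega>. \<Sum>i\<in>I. w i * Y i \<omega>) = (\<Prod>i\<in>I. chf P (\<lambda>\<omega>. w i * Y i \<omega>))"
  shows "prob_space.indep_vars P (\<lambda>_. borel) Y I"
proof (cases "I = {}")
  interpret prob_space P by fact
  case True
  then show ?thesis by (auto simp: indep_vars_def indep_sets_def)
next
  interpret prob_space P by fact
  case False
  have pd: "prob_space (distr P borel (Y i))" for i by (rule prob_space_distr) simp
  have "distr P (Pi\<^sub>M I (\<lambda>_. borel)) (\<lambda>x. \<lambda>i\<in>I. Y i x) = (Pi\<^sub>M I (\<lambda>i. distr P borel (Y i)))"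
  proof (rule PiM_measure_eqI[OF \<open>finite I\<close>])
    show "prob_space (distr P (Pi\<^sub>M I (\<lambda>_. borel)) (\<lambda>x. \<lambda>i\<in>I. Y i x))"
      by (rule prob_space_distr) simp
    show "prob_space (Pi\<^sub>M I (\<lambda>i. distr P borel (Y i)))"
      by (intro prob_space_PiM pd)
    show "sets (Pi\<^sub>M I (\<lambda>i. distr P borel (Y i))) = sets (Pi\<^sub>M I (\<lambda>_. borel))"
      by (intro sets_PiM_cong) auto
    fix w
    have "chf (distr P (Pi\<^sub>M I (\<lambda>_. borel)) (\<lambda>x. \<lambda>i\<in>I. Y i x)) (\<lambda>x. \<Sum>t\<in>I. w t * x t) = chf P (\<lambda>\<omega>. \<Sum>i\<in>I. w i * Y i \<omega>)"
      by (subst chf_distr) (auto intro!: arg_cong[where f="chf P"] ext sum.cong)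
    moreover have "chf (Pi\<^sub>M I (\<lambda>i. distr P borel (Y i))) (\<lambda>x. \<Sum>t\<in>I. w t * x t) = (\<Prod>i\<in>I. chf P (\<lambda>\<omega>. w i * Y i \<omega>))"
      by (subst chf_PiM_sum[OF \<open>finite I\<close> pd]) (auto intro!: prod.cong simp: chf_distr)
    ultimately show "chf (distr P (Pi\<^sub>M I (\<lambda>_. borel)) (\<lambda>x. \<lambda>i\<in>I. Y i x)) (\<lambda>x. \<Sum>t\<in>I. w t * x t) =
       chf (Pi\<^sub>M I (\<lambda>i. distr P borel (Y i))) (\<lambda>x. \<Sum>t\<in>I. w t * x t)"
      using eq by simp
  qed simp
  then show ?thesis using False by (subst indep_vars_iff_distr_eq_PiM') auto
qed

lemma chf_sum_indep:
  assumes P: "prob_space P" and "finite I" and [measurable]: "\<And>i. Y i \<in> borel_measurable P"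
    and indep: "prob_space.indep_vars P (\<lambda>_. borel) Y I"
  shows "chf P (\<lambda>\<omega>. \<Sum>i\<in>I. w i * Y i \<omega>) = (\<Prod>i\<in>I. chf P (\<lambda>\<omega>. w i * Y i \<omega>))"
proof -
  interpret prob_space P by fact
  have cis_sum: "cis (Re (\<Sum>i\<in>I. w i * Y i x)) = (\<Prod>i\<in>I. cis (Re (w i * Y i x)))" for x
    using \<open>finite I\<close> by induction (auto simp: cis_mult[symmetric])
  show ?thesis
    unfolding chf_def cis_sum
    by (intro indep_vars_lebesgue_integral \<open>finite I\<close> integrable_cis_prob P indep_vars_compose2[OF indep]) auto
qed

text \<open>
  The map \<open>y \<mapsto> cis (Re (z * y))\<close> is bounded and Lipschitz: split the expectation according to
  whether the distance exceeds \<open>d\<close>.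
\<close>
lemma tendsto_in_prob_chf:
  assumes P: "prob_space P" and [measurable]: "\<And>i. Y i \<in> borel_measurable P" "Z \<in> borel_measurable P"
    and conv: "tendsto_in_prob P Y Z F"
  shows "((\<lambda>i. chf P (\<lambda>\<omega>. z * Y i \<omega>)) \<longlongrightarrow> chf P (\<lambda>\<omega>. z * Z \<omega>)) F"
proof (rule tendstoI)
  interpret prob_space P by fact
  fix e :: real assume e: "0 < e"
  define d where "d = e / (2 * (norm z + 1))"
  have d: "0 < d" unfolding d_def using e by (intro divide_pos_pos mult_pos_pos) (auto intro: add_nonneg_pos)
  have zd: "norm z * d \<le> e / 2" unfolding d_def using e
    by (simp add: field_simps add_pos_nonneg)
  have key: "dist (chf P (\<lambda>\<omega>. z * Y i \<omega>)) (chf P (\<lambda>\<omega>. z * Z \<omega>)) \<le> e / 2 + 2 * \<P>(\<omega> in P. dist (Y i \<omega>) (Z \<omega>) > d)" for i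
  proof -
    have int: "integrable P (\<lambda>\<omega>. cis (Re (z * X \<omega>)))" if [measurable]: "X \<in> borel_measurable P" for X
      by (rule integrable_cis_prob[OF P]) simp
    have iind: "integrable P (\<lambda>\<omega>. 2 * indicator {\<omega> \<in> space P. dist (Y i \<omega>) (Z \<omega>) > d} \<omega> :: real)"
      by (rule integrable_const_bound[where B=2]) (auto intro!: AE_I2 simp: indicator_def)
    have pw: "norm (cis (Re (z * Y i \<omega>)) - cis (Re (z * Z \<omega>))) \<le> e/2 + 2 * indicator {\<omega> \<in> space P. dist (Y i \<omega>) (Z \<omega>) > d} \<omega>" if "\<omega> \<in> space P" for \<omega>
    proof (cases "dist (Y i \<omega>) (Z \<omega>) > d")
      case True
      have "norm (cis (Re (z * Y i \<omega>)) - cis (Re (z * Z \<omega>))) \<le> 1 + 1"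
        by (rule order_trans[OF norm_triangle_ineq4]) simp
      then show ?thesis using True that e by simp
    next
      case False
      have "norm (cis (Re (z * Y i \<omega>)) - cis (Re (z * Z \<omega>))) = norm (cis (Re (z * Z \<omega>)) * (cis (Re (z * Y i \<omega>) - Re (z * Z \<omega>)) - 1))"
        by (simp add: algebra_simps cis_mult)
      also have "\<dots> = norm (cis (Re (z * Y i \<omega>) - Re (z * Z \<omega>)) - 1)" by (simp add: norm_mult)
      also have "\<dots> \<le> \<bar>Re (z * Y i \<omega>) - Re (z * Z \<omega>)\<bar>"
        using iexp_approx1[of "Re (z * Y i \<omega>) - Re (z * Z \<omega>)" 0] by (simp add: cis_conv_exp)
      also have "\<dots> \<le> norm (z * (Y i \<omega> - Z \<omega>))"
        using abs_Re_le_cmod[of "z * (Y i \<omega> - Z \<omega>)"] by (simp add: algebra_simps)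
      also have "\<dots> \<le> norm z * d" using False by (simp add: norm_mult dist_norm mult_left_mono)
      finally show ?thesis using zd False by simp
    qed
    have "dist (chf P (\<lambda>\<omega>. z * Y i \<omega>)) (chf P (\<lambda>\<omega>. z * Z \<omega>)) = norm (\<integral>\<omega>. cis (Re (z * Y i \<omega>)) - cis (Re (z * Z \<omega>)) \<partial>P)"
      unfolding chf_def dist_norm by (subst Bochner_Integration.integral_diff[OF int int]) simp_all
    also have "\<dots> \<le> (\<integral>\<omega>. norm (cis (Re (z * Y i \<omega>)) - cis (Re (z * Z \<omega>))) \<partial>P)"
      by (rule integral_norm_bound)
    also have "\<dots> \<le> (\<integral>\<omega>. e/2 + 2 * indicator {\<omega> \<in> space P. dist (Y i \<omega>) (Z \<omega>) > d} \<omega> \<partial>P)"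
      using pw iind by (intro integral_mono integrable_norm Bochner_Integration.integrable_diff int Bochner_Integration.integrable_add) auto
    also have "\<dots> = e / 2 + 2 * \<P>(\<omega> in P. dist (Y i \<omega>) (Z \<omega>) > d)"
      using prob_space iind by (subst Bochner_Integration.integral_add) auto
    finally show ?thesis .
  qed
  have "((\<lambda>i. \<P>(\<omega> in P. dist (Y i \<omega>) (Z \<omega>) > d)) \<longlongrightarrow> 0) F"
    using conv d unfolding tendsto_in_prob_def by auto
  then have "\<forall>\<^sub>F i in F. \<P>(\<omega> in P. dist (Y i \<omega>) (Z \<omega>) > d) < e / 4"
    using e by (intro order_tendstoD) auto
  then show "\<forall>\<^sub>F i in F. dist (chf P (\<lambda>\<omega>. z * Y i \<omega>)) (chf P (\<lambda>\<omega>. z * Z \<omega>)) < e"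
  proof eventually_elim
    case (elim i)
    then show ?case using key[of i] by linarith
  qed
qed

text \<open>
  Randomise the frequency by an independent standard normal variable \<open>N\<close>: the mean of
  \<open>1 - cos (N s U)\<close> over \<open>N\<close> is \<open>1 - exp (- s\<^sup>2 U\<^sup>2 / 2)\<close>, which is at least \<open>1/3\<close> on the event
  \<open>\<bar>U\<bar> > 1/s\<close>, whereas its mean over \<open>U\<close> is at most \<open>\<kappa> \<bar>s N\<bar>^\<alpha>\<close>. Fubini's theorem compares
  the two.
\<close>
lemma real_chf_tail_bound:
  fixes U :: "'a \<Rightarrow> real"
  assumes P: "prob_space P" and [measurable]: "U \<in> borel_measurable P"
    and \<alpha>: "0 < \<alpha>" "\<alpha> < 2" and \<kappa>: "0 \<le> \<kappa>"
    and bound: "\<And>s. 1 - Re (CLINT \<omega>|P. cis (s * U \<omega>)) \<le> \<kappa> * \<bar>s\<bar> powr \<alpha>"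
    and e: "0 < e"
  shows "\<P>(\<omega> in P. \<bar>U \<omega>\<bar> > e) \<le> 6 * \<kappa> * e powr (-\<alpha>)"
proof -
  interpret P: prob_space P by fact
  interpret N: real_distribution std_normal_distribution by (rule real_dist_normal_dist)
  interpret pair_sigma_finite P std_normal_distribution ..
  \<comment> \<open>The scale at which \<open>\<bar>U\<bar> > e\<close> means \<open>\<bar>s * U\<bar> > 1\<close>.\<close>
  define s where "s = 1 / e"
  have s: "0 < s" using e by (simp add: s_def)
  have ci: "integrable M (\<lambda>x. cis (v x))" if "prob_space M" "v \<in> borel_measurable M" for M :: "'c measure" and v
    by (rule integrable_cis_prob[OF that])
  have cos_int: "integrable M (\<lambda>x. cos (v x)) \<and> (\<integral>x. cos (v x) \<partial>M) = Re (CLINT x|M. cis (v x))"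
    if "prob_space M" "v \<in> borel_measurable M" for M :: "'c measure" and v
    using ci[OF that] by (auto dest: integrable_Re integral_Re simp: cis.simps)
  have N1: "(\<integral>x. 1 - cos (x * (s * U \<omega>)) \<partial>std_normal_distribution) = 1 - exp (- ((s * U \<omega>)\<^sup>2) / 2)" for \<omega>
  proof -
    have "(CLINT x|std_normal_distribution. cis (x * (s * U \<omega>))) = exp (- ((s * U \<omega>)\<^sup>2) / 2)"
      using fun_cong[OF char_std_normal_distribution, of "s * U \<omega>"]
      unfolding char_def by (simp add: cis_conv_exp mult.commute)
    then show ?thesis using cos_int[OF N.prob_space_axioms, of "\<lambda>x. x * (s * U \<omega>)"] N.prob_space
      by (subst Bochner_Integration.integral_diff) auto
  qed
  have P1: "(\<integral>\<omega>. 1 - cos (x * (s * U \<omega>)) \<partial>P) = 1 - Re (CLINT \<omega>|P. cis ((x * s) * U \<omega>))" for x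
    using cos_int[OF P, of "\<lambda>\<omega>. x * (s * U \<omega>)"] P.prob_space
    by (subst Bochner_Integration.integral_diff) (auto simp: mult.assoc)
  interpret pp: prob_space "P \<Otimes>\<^sub>M std_normal_distribution"
    by (intro prob_space_pair P N.prob_space_axioms)
  have c2: "\<bar>1 - cos y\<bar> \<le> 2" for y :: real
    using cos_le_one[of y] cos_ge_minus_one[of y] by linarith
  have ip: "integrable (P \<Otimes>\<^sub>M std_normal_distribution) (\<lambda>(\<omega>, x). 1 - cos (x * (s * U \<omega>)))"
    by (rule pp.integrable_const_bound[where B=2]) (auto intro!: AE_I2 c2)
  have iP: "integrable P (\<lambda>\<omega>. 1 - exp (- ((s * U \<omega>)\<^sup>2) / 2))"
    by (rule P.integrable_const_bound[where B=1]) (auto intro!: AE_I2)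
  have m2: "(\<integral>x. x^2 \<partial>std_normal_distribution) = 1" "integrable std_normal_distribution (\<lambda>x. x^2)"
    using std_normal_distribution_even_moments[of 1] by (simp_all add: fact_numeral)
  have pwr: "\<bar>x * s\<bar> powr \<alpha> \<le> s powr \<alpha> * (1 + x^2)" for x :: real
  proof -
    have "\<bar>x\<bar> powr \<alpha> \<le> 1 + x^2"
    proof (cases "\<bar>x\<bar> \<le> 1")
      case True
      then have "\<bar>x\<bar> powr \<alpha> \<le> 1" using \<alpha> by (intro powr_le1) auto
      then show ?thesis by (simp add: add_increasing2)
    next
      case False
      then have "\<bar>x\<bar> powr \<alpha> \<le> \<bar>x\<bar> powr 2" using \<alpha> by (intro powr_mono) auto
      then show ?thesis using False by (simp add: powr_numeral)
    qed
    then show ?thesis using s by (simp add: abs_mult powr_mult mult.commute mult_left_mono)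
  qed
  have "(1 - exp (-1/2)) * \<P>(\<omega> in P. \<bar>U \<omega>\<bar> > e) = (\<integral>\<omega>. (1 - exp (-1/2)) * indicator {\<omega> \<in> space P. \<bar>U \<omega>\<bar> > e} \<omega> \<partial>P)"
    by simp
  also have "\<dots> \<le> (\<integral>\<omega>. 1 - exp (- ((s * U \<omega>)\<^sup>2) / 2) \<partial>P)"
  proof (rule integral_mono[OF _ iP])
    show "integrable P (\<lambda>\<omega>. (1 - exp (-1/2)) * indicator {\<omega> \<in> space P. \<bar>U \<omega>\<bar> > e} \<omega> :: real)"
      by (rule P.integrable_const_bound[where B=1]) (auto intro!: AE_I2 simp: indicator_def)
    fix \<omega> assume "\<omega> \<in> space P"
    have "1 \<le> (s * U \<omega>)\<^sup>2" if "\<bar>U \<omega>\<bar> > e"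
    proof -
      have "1 \<le> \<bar>s * U \<omega>\<bar>" using that e by (simp add: s_def abs_mult field_simps)
      then show ?thesis using one_le_power[of "\<bar>s * U \<omega>\<bar>" 2] by simp
    qed
    then show "(1 - exp (-1/2)) * indicator {\<omega> \<in> space P. \<bar>U \<omega>\<bar> > e} \<omega> \<le> 1 - exp (- ((s * U \<omega>)\<^sup>2) / 2)"
      by (auto simp: indicator_def)
  qed
  also have "\<dots> = (\<integral>\<omega>. (\<integral>x. 1 - cos (x * (s * U \<omega>)) \<partial>std_normal_distribution) \<partial>P)"
    using N1 by simp
  also have "\<dots> = (\<integral>x. (\<integral>\<omega>. 1 - cos (x * (s * U \<omega>)) \<partial>P) \<partial>std_normal_distribution)"
    using ip by (rule Fubini_integral[symmetric])
  also have "\<dots> \<le> (\<integral>x. \<kappa> * (s powr \<alpha> * (1 + x^2)) \<partial>std_normal_distribution)"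
  proof (rule integral_mono)
    show "integrable std_normal_distribution (\<lambda>x. \<integral>\<omega>. 1 - cos (x * (s * U \<omega>)) \<partial>P)"
      using integrable_snd[OF ip] by simp
    show "integrable std_normal_distribution (\<lambda>x. \<kappa> * (s powr \<alpha> * (1 + x\<^sup>2)))"
      using m2 by (intro integrable_mult_right Bochner_Integration.integrable_add) auto
    show "(\<integral>\<omega>. 1 - cos (x * (s * U \<omega>)) \<partial>P) \<le> \<kappa> * (s powr \<alpha> * (1 + x\<^sup>2))" for x
      unfolding P1 using order_trans[OF bound[of "x * s"] mult_left_mono[OF pwr \<kappa>]] .
  qed
  also have "\<dots> = 2 * \<kappa> * s powr \<alpha>"
    using m2 N.prob_space by (simp add: Bochner_Integration.integral_add)
  finally have *: "(1 - exp (-1/2)) * \<P>(\<omega> in P. \<bar>U \<omega>\<bar> > e) \<le> 2 * \<kappa> * s powr \<alpha>" .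
  have "exp (-1/2 :: real) \<le> 2/3"
  proof -
    have "3/2 \<le> exp (1/2 :: real)" using exp_ge_add_one_self[of "1/2"] by simp
    then show ?thesis by (simp add: exp_minus field_simps)
  qed
  then have "1/3 * \<P>(\<omega> in P. \<bar>U \<omega>\<bar> > e) \<le> (1 - exp (-1/2)) * \<P>(\<omega> in P. \<bar>U \<omega>\<bar> > e)"
    by (intro mult_right_mono) auto
  with * have "\<P>(\<omega> in P. \<bar>U \<omega>\<bar> > e) \<le> 6 * \<kappa> * s powr \<alpha>" by simp
  also have "s powr \<alpha> = e powr (-\<alpha>)"
    using e by (simp add: s_def powr_divide powr_minus_divide)
  finally show ?thesis .
qed

text \<open>
  If \<open>norm (Y \<omega>) > e\<close> then one of the two coordinates exceeds \<open>e/2\<close>, and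
  \<open>2 * 6 * 2 powr \<alpha> \<le> 48\<close>.
\<close>
lemma chf_tail_bound:
  fixes Y :: "'a \<Rightarrow> complex"
  assumes P: "prob_space P" and [measurable]: "Y \<in> borel_measurable P"
    and \<alpha>: "0 < \<alpha>" "\<alpha> < 2" and \<kappa>: "0 \<le> \<kappa>"
    and bound: "\<And>z. 1 - Re (chf P (\<lambda>\<omega>. z * Y \<omega>)) \<le> \<kappa> * norm z powr \<alpha>"
    and e: "0 < e"
  shows "\<P>(\<omega> in P. norm (Y \<omega>) > e) \<le> 48 * \<kappa> * e powr (-\<alpha>)"
proof -
  interpret P: prob_space P by fact
  have 1: "\<P>(\<omega> in P. \<bar>Re (Y \<omega>)\<bar> > e/2) \<le> 6 * \<kappa> * (e/2) powr (-\<alpha>)"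
    using bound[of "of_real _"] e by (intro real_chf_tail_bound[OF P _ \<alpha> \<kappa>]) (auto simp: chf_def)
  have 2: "\<P>(\<omega> in P. \<bar>Im (Y \<omega>)\<bar> > e/2) \<le> 6 * \<kappa> * (e/2) powr (-\<alpha>)"
  proof (rule real_chf_tail_bound[OF P _ \<alpha> \<kappa>])
    show "1 - Re (CLINT \<omega>|P. cis (s * Im (Y \<omega>))) \<le> \<kappa> * \<bar>s\<bar> powr \<alpha>" for s
      using bound[of "- \<i> * of_real s"] by (simp add: chf_def norm_mult)
  qed (use e in auto)
  have "\<P>(\<omega> in P. norm (Y \<omega>) > e) \<le> measure P ({\<omega> \<in> space P. \<bar>Re (Y \<omega>)\<bar> > e/2} \<union> {\<omega> \<in> space P. \<bar>Im (Y \<omega>)\<bar> > e/2})"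
  proof (intro P.finite_measure_mono subsetI)
    fix \<omega> assume "\<omega> \<in> {\<omega> \<in> space P. norm (Y \<omega>) > e}"
    then show "\<omega> \<in> {\<omega> \<in> space P. \<bar>Re (Y \<omega>)\<bar> > e/2} \<union> {\<omega> \<in> space P. \<bar>Im (Y \<omega>)\<bar> > e/2}"
      using cmod_le[of "Y \<omega>"] by auto
  qed auto
  also have "\<dots> \<le> \<P>(\<omega> in P. \<bar>Re (Y \<omega>)\<bar> > e/2) + \<P>(\<omega> in P. \<bar>Im (Y \<omega>)\<bar> > e/2)"
    by (intro measure_Un_le) auto
  also have "\<dots> \<le> 12 * \<kappa> * (e/2) powr (-\<alpha>)" using 1 2 by simp
  also have "(e/2) powr (-\<alpha>) = 2 powr \<alpha> * e powr (-\<alpha>)"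
    using e by (simp add: powr_divide powr_minus field_simps)
  also have "12 * \<kappa> * (2 powr \<alpha> * e powr (-\<alpha>)) \<le> 12 * \<kappa> * (2 powr 2 * e powr (-\<alpha>))"
    using \<alpha> \<kappa> by (intro mult_left_mono mult_right_mono powr_mono) auto
  finally show ?thesis by (simp add: powr_numeral)
qed

section \<open>Step functions and functions with integrable powers\<close>

text \<open>
  The signed indicator of the interval between \<open>0\<close> and \<open>t\<close>, so that \<open>L t - L 0\<close> is the integral of
  \<open>hstep t\<close> for times of either sign. Combinations of the \<open>hstep t\<close> are all left-continuous step
  functions with bounded support.
\<close>
definition hstep :: "real \<Rightarrow> real \<Rightarrow> real" where
  "hstep t s = (if 0 < s \<and> s \<le> t then 1 else if t < s \<and> s \<le> 0 then -1 else 0)"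

definition stepf :: "real set \<Rightarrow> (real \<Rightarrow> complex) \<Rightarrow> real \<Rightarrow> complex" where
  "stepf J w s = (\<Sum>t\<in>J. w t * of_real (hstep t s))"

lemma hstep_measurable [measurable]: "hstep t \<in> borel_measurable borel"
  unfolding hstep_def by measurable

lemma stepf_measurable [measurable]: "stepf J w \<in> borel_measurable borel"
  unfolding stepf_def by measurable

lemma enumerate_finite_reals:
  assumes "finite (J :: real set)"
  shows "\<exists>\<tau> n. strict_mono \<tau> \<and> J = \<tau> ` {..<n::nat}"
  using assms
proof (induction rule: finite_linorder_max_induct)
  case empty
  show ?case by (rule exI[of _ real]) (auto intro!: exI[of _ 0] simp: strict_mono_def)
next
  case (insert b A)
  then obtain \<tau> n where \<tau>: "strict_mono \<tau>" "A = \<tau> ` {..<n::nat}" by auto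
  \<comment> \<open>Beyond the points of the set the enumeration continues arbitrarily, as an increasing sequence on all of
    the naturals is wanted.\<close>
  define \<tau>' where "\<tau>' k = (if k < n then \<tau> k else b + real (k - n))" for k
  have "strict_mono \<tau>'"
  proof (rule strict_monoI)
    fix i j :: nat assume "i < j"
    show "\<tau>' i < \<tau>' j"
    proof (cases "j < n")
      case True
      then show ?thesis using \<open>i < j\<close> \<tau>(1) by (auto simp: \<tau>'_def strict_mono_def)
    next
      case False
      show ?thesis
      proof (cases "i < n")
        case True
        then have "\<tau> i < b" using insert \<tau> by auto
        then show ?thesis using True False by (simp add: \<tau>'_def add_strict_increasing2)
      next
        case F: False
        then show ?thesis using False \<open>i < j\<close> by (auto simp: \<tau>'_def)
      qed
    qed
  qed
  moreover have "Set.insert b A = \<tau>' ` {..<Suc n}"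
    unfolding lessThan_Suc image_insert \<tau>(2) by (auto simp: \<tau>'_def)
  ultimately show ?case by blast
qed

text \<open>
  The points of \<open>J\<close> and the origin are listed in increasing order. The origin must be a grid point
  because every \<open>hstep\<close> jumps there.
\<close>
lemma grid_exists:
  assumes "finite (J :: real set)"
  shows "\<exists>\<tau> N m. strict_mono \<tau> \<and> J \<subseteq> \<tau> ` {..N::nat} \<and> m \<le> N \<and> \<tau> m = 0"
proof -
  obtain \<tau> n where \<tau>: "strict_mono \<tau>" "insert 0 J = \<tau> ` {..<n::nat}"
    using enumerate_finite_reals[of "insert 0 J"] assms by auto
  have "n \<noteq> 0" using \<tau>(2) by auto
  then have "{..<n} = {..n-1}" by auto
  moreover have "0 \<in> \<tau> ` {..<n}" using \<tau>(2) by (metis insertI1)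
  then obtain m where "m < n" "\<tau> m = 0" by auto
  ultimately show ?thesis using \<tau> by (intro exI[of _ \<tau>] exI[of _ "n-1"] exI[of _ m]) auto
qed

text \<open>
  Increments of \<open>f\<close> over the grid cells between the origin \<open>\<tau> m\<close> and \<open>\<tau> j\<close>, counted with the
  sign of the orientation.
\<close>
lemma hstep_telescope:
  fixes f :: "nat \<Rightarrow> complex"
  assumes \<tau>: "strict_mono \<tau>" and "j \<le> N" "m \<le> N" "\<tau> m = 0"
  shows "(\<Sum>k<N. of_real (hstep (\<tau> j) (\<tau> (Suc k))) * (f (Suc k) - f k)) = f j - f m"
proof -
  have h: "hstep (\<tau> j) (\<tau> (Suc k)) = (if m \<le> k \<and> k < j then 1 else if j \<le> k \<and> k < m then -1 else 0)" for k
    unfolding hstep_def assms(4)[symmetric] strict_mono_less[OF \<tau>] strict_mono_less_eq[OF \<tau>]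
    by auto
  show ?thesis
  proof (cases "m \<le> j")
    case True
    have "(\<Sum>k<N. of_real (hstep (\<tau> j) (\<tau> (Suc k))) * (f (Suc k) - f k)) = (\<Sum>k\<in>{m..<j}. f (Suc k) - f k)"
      using True assms by (intro sum.mono_neutral_cong_right) (auto simp: h)
    then show ?thesis using True by (simp add: sum_Suc_diff')
  next
    case False
    have "(\<Sum>k<N. of_real (hstep (\<tau> j) (\<tau> (Suc k))) * (f (Suc k) - f k)) = (\<Sum>k\<in>{j..<m}. - (f (Suc k) - f k))"
      using False assms by (intro sum.mono_neutral_cong_right) (auto simp: h)
    then show ?thesis using False sum_Suc_diff'[of j m f] by (simp only: sum_negf) simp
  qed
qed

lemma hstep_grid_const:
  assumes \<tau>: "strict_mono \<tau>" and "t = \<tau> j" "\<tau> m = 0" "\<tau> k < s" "s \<le> \<tau> (Suc k)"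
  shows "hstep t s = hstep t (\<tau> (Suc k))"
proof -
  have "s \<le> \<tau> i \<longleftrightarrow> \<tau> (Suc k) \<le> \<tau> i" for i
  proof
    assume "s \<le> \<tau> i"
    then have "\<tau> k < \<tau> i" using assms by linarith
    then show "\<tau> (Suc k) \<le> \<tau> i" by (simp add: strict_mono_less[OF \<tau>] strict_mono_less_eq[OF \<tau>])
  qed (use assms in linarith)
  from this[of j] this[of m] have "s \<le> t \<longleftrightarrow> \<tau> (Suc k) \<le> t" "s \<le> 0 \<longleftrightarrow> \<tau> (Suc k) \<le> 0"
    using assms by simp_all
  then show ?thesis unfolding hstep_def by (simp add: not_le[symmetric])
qed

lemma hstep_outside:
  fixes \<tau> :: "nat \<Rightarrow> real"
  assumes \<tau>: "strict_mono \<tau>" and "t = \<tau> j" "j \<le> N" "m \<le> N" "\<tau> m = 0" "\<not> (\<tau> 0 < s \<and> s \<le> \<tau> N)"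
  shows "hstep t s = 0"
proof -
  have "\<tau> 0 \<le> t" "t \<le> \<tau> N" "\<tau> 0 \<le> 0" "0 \<le> \<tau> N"
    using assms by (auto simp: strict_mono_less_eq[OF \<tau>] simp flip: assms(5))
  then show ?thesis using assms(6) unfolding hstep_def by auto
qed

text \<open>
  A step function is constant on each grid cell, hence so is its image under \<open>F\<close>; outside of the grid
  both sides vanish because \<open>F 0 = 0\<close>.
\<close>
lemma stepf_grid_sum:
  fixes F :: "complex \<Rightarrow> real"
  assumes \<tau>: "strict_mono \<tau>" and J: "J \<subseteq> \<tau> ` {..N::nat}" and m: "m \<le> N" "\<tau> m = 0" and "F 0 = 0"
  shows "F (stepf J w s) = (\<Sum>k<N. F (stepf J w (\<tau> (Suc k))) * indicator {\<tau> k<..\<tau> (Suc k)} s)"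
proof (cases "\<tau> 0 < s \<and> s \<le> \<tau> N")
  case False
  have "stepf J w s = 0"
    unfolding stepf_def using J False m by (intro sum.neutral) (auto dest!: subsetD simp: hstep_outside[OF \<tau> _ _ m])
  moreover have "indicator {\<tau> k<..\<tau> (Suc k)} s = (0::real)" if "k < N" for k
  proof -
    have "\<tau> 0 \<le> \<tau> k" "\<tau> (Suc k) \<le> \<tau> N" using that by (auto simp: strict_mono_less_eq[OF \<tau>])
    then show ?thesis using False by (auto simp: indicator_def)
  qed
  ultimately show ?thesis using \<open>F 0 = 0\<close> by simp
next
  case True
  define k where "k = (LEAST k. s \<le> \<tau> (Suc k))"
  have N: "N \<noteq> 0" using True by (cases N) auto
  then have ex: "s \<le> \<tau> (Suc (N-1))" using True by simp
  have k: "s \<le> \<tau> (Suc k)" unfolding k_def using ex by (rule LeastI)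
  have kN: "k < N" using Least_le[of "\<lambda>k. s \<le> \<tau> (Suc k)", OF ex] N unfolding k_def by linarith
  have ks: "\<tau> k < s"
  proof (cases k)
    case 0 then show ?thesis using True by simp
  next
    case (Suc i)
    then have "\<not> s \<le> \<tau> (Suc i)" unfolding k_def using not_less_Least[of i "\<lambda>k. s \<le> \<tau> (Suc k)"] k_def by auto
    then show ?thesis using Suc by simp
  qed
  have ind: "indicator {\<tau> i<..\<tau> (Suc i)} s = (if i = k then 1 else 0 :: real)" for i
  proof -
    have "i < k \<Longrightarrow> \<tau> (Suc i) \<le> \<tau> k" "k < i \<Longrightarrow> \<tau> (Suc k) \<le> \<tau> i"
      by (auto simp: strict_mono_less_eq[OF \<tau>])
    then show ?thesis using k ks by (cases i k rule: linorder_cases) (auto simp: indicator_def)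
  qed
  have "stepf J w s = stepf J w (\<tau> (Suc k))"
    unfolding stepf_def
  proof (rule sum.cong[OF refl])
    fix t assume "t \<in> J"
    then obtain j where "t = \<tau> j" using J by auto
    then show "w t * complex_of_real (hstep t s) = w t * complex_of_real (hstep t (\<tau> (Suc k)))"
      using hstep_grid_const[OF \<tau> _ m(2) ks k, of t j] by simp
  qed
  then show ?thesis using kN by (simp add: ind if_distrib[of "\<lambda>a. _ * a"] cong: if_cong)
qed

lemma stepf_integral:
  fixes F :: "complex \<Rightarrow> real"
  assumes \<tau>: "strict_mono \<tau>" and J: "J \<subseteq> \<tau> ` {..N::nat}" and m: "m \<le> N" "\<tau> m = 0" and "F 0 = 0"
  shows "integrable lborel (\<lambda>s. F (stepf J w s))"
    and "(\<integral>s. F (stepf J w s) \<partial>lborel) = (\<Sum>k<N. (\<tau> (Suc k) - \<tau> k) * F (stepf J w (\<tau> (Suc k))))"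
proof -
  have le: "\<tau> k \<le> \<tau> (Suc k)" for k by (simp add: strict_mono_less_eq[OF \<tau>])
  have eq: "(\<lambda>s. F (stepf J w s)) = (\<lambda>s. \<Sum>k<N. F (stepf J w (\<tau> (Suc k))) * indicator {\<tau> k<..\<tau> (Suc k)} s)"
    by (rule ext, rule stepf_grid_sum[of \<tau> J N m F w, OF assms])
  have int: "integrable lborel (\<lambda>s. F (stepf J w (\<tau> (Suc k))) * indicator {\<tau> k<..\<tau> (Suc k)} s)" for k
    using le[of k] by (intro integrable_mult_right) (auto simp: emeasure_lborel_Ioc)
  show "integrable lborel (\<lambda>s. F (stepf J w s))"
    by (subst eq) (intro Bochner_Integration.integrable_sum int)
  show "(\<integral>s. F (stepf J w s) \<partial>lborel) = (\<Sum>k<N. (\<tau> (Suc k) - \<tau> k) * F (stepf J w (\<tau> (Suc k))))"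
    by (subst eq, subst Bochner_Integration.integral_sum[OF int]) (auto intro!: sum.cong simp: measure_def emeasure_lborel_Ioc[OF le] le)
qed

text \<open>
  At most one of the summands is nonzero at \<open>s\<close>, so \<open>F\<close> can be applied to each of them.
\<close>
lemma disjoint_indicator_sum:
  fixes F :: "complex \<Rightarrow> real" and w :: "'i \<Rightarrow> complex"
  assumes "finite I" "disjoint_family_on A I" "F 0 = 0"
  shows "F (\<Sum>i\<in>I. w i * indicator (A i) s) = (\<Sum>i\<in>I. F (w i) * indicator (A i) s)"
proof (cases "\<exists>j\<in>I. s \<in> A j")
  case True
  then obtain j where j: "j \<in> I" "s \<in> A j" by auto
  have "s \<in> A i \<longleftrightarrow> i = j" if "i \<in> I" for i
    using disjoint_family_onD[OF assms(2) that j(1)] j(2) by auto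
  then have "(\<Sum>i\<in>I. w i * indicator (A i) s) = (\<Sum>i\<in>I. if i = j then w i else 0)"
    "(\<Sum>i\<in>I. F (w i) * indicator (A i) s) = (\<Sum>i\<in>I. if i = j then F (w i) else 0)"
    by (auto intro!: sum.cong simp: indicator_def)
  then show ?thesis using j \<open>finite I\<close> by simp
next
  case False
  then have "(\<Sum>i\<in>I. w i * indicator (A i) s) = 0" "(\<Sum>i\<in>I. F (w i) * indicator (A i) s) = 0"
    by (auto intro!: sum.neutral)
  then show ?thesis using \<open>F 0 = 0\<close> by simp
qed

lemma disjoint_indicator_sum_integral:
  fixes F :: "complex \<Rightarrow> real" and w :: "'i \<Rightarrow> complex" and A :: "'i \<Rightarrow> real set"
  assumes "finite I" "disjoint_family_on A I" "F 0 = 0"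
    and A: "\<And>i. i \<in> I \<Longrightarrow> A i \<in> sets borel" "\<And>i. i \<in> I \<Longrightarrow> bounded (A i)"
  shows "(\<integral>s. F (\<Sum>i\<in>I. w i * indicator (A i) s) \<partial>lborel) = (\<Sum>i\<in>I. measure lborel (A i) * F (w i))"
  unfolding disjoint_indicator_sum[OF assms(1,2), of F, OF assms(3)]
proof (subst Bochner_Integration.integral_sum)
  show "integrable lborel (\<lambda>s. F (w i) * indicator (A i) s)" if "i \<in> I" for i
    using A that emeasure_bounded_finite[OF A(2)[OF that]] by (intro integrable_mult_right) auto
qed (use A in \<open>auto intro!: sum.cong\<close>)

lemma stepf_combine:
  fixes w w' f :: "real \<Rightarrow> complex" and c :: complex
  assumes "finite J" "finite J'"
  defines "u \<equiv> (\<lambda>t. (if t \<in> J then w t else 0) + c * (if t \<in> J' then w' t else 0))"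
  shows "(\<Sum>t\<in>J \<union> J'. u t * f t) = (\<Sum>t\<in>J. w t * f t) + c * (\<Sum>t\<in>J'. w' t * f t)"
proof -
  have "(\<Sum>t\<in>J. w t * f t) = (\<Sum>t\<in>J \<union> J'. (if t \<in> J then w t else 0) * f t)"
    using assms(1,2) by (intro sum.mono_neutral_cong_left) auto
  moreover have "(\<Sum>t\<in>J'. w' t * f t) = (\<Sum>t\<in>J \<union> J'. (if t \<in> J' then w' t else 0) * f t)"
    using assms(1,2) by (intro sum.mono_neutral_cong_left) auto
  ultimately show ?thesis
    by (simp add: u_def sum.distrib[symmetric] sum_distrib_left algebra_simps)
qed

text \<open>
  The \<open>\<alpha>\<close>-th power of the \<open>L\<^sup>\<alpha>\<close> norm, as an extended nonnegative number. For \<open>\<alpha> < 1\<close> the root would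
  not be a norm; the power satisfies a triangle inequality up to the constant \<open>4\<close> for all
  \<open>0 < \<alpha> < 2\<close>, which is enough.
\<close>
definition apow :: "real \<Rightarrow> (real \<Rightarrow> complex) \<Rightarrow> ennreal" where
  "apow \<alpha> g = (\<integral>\<^sup>+ s. ennreal (norm (g s) powr \<alpha>) \<partial>lborel)"

lemma norm_add_powr_le:
  fixes a b :: "'v::real_normed_vector"
  assumes \<alpha>: "0 < \<alpha>" "\<alpha> < 2"
  shows "norm (a + b) powr \<alpha> \<le> 4 * (norm a powr \<alpha> + norm b powr \<alpha>)"
proof -
  define M where "M = max (norm a) (norm b)"
  have "norm (a + b) \<le> 2 * M" unfolding M_def using norm_triangle_ineq[of a b] by auto
  then have "norm (a + b) powr \<alpha> \<le> (2 * M) powr \<alpha>" using \<alpha> by (intro powr_mono2) auto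
  also have "\<dots> = 2 powr \<alpha> * M powr \<alpha>" by (simp add: powr_mult M_def)
  also have "\<dots> \<le> 2 powr 2 * (norm a powr \<alpha> + norm b powr \<alpha>)"
  proof (rule mult_mono)
    show "2 powr \<alpha> \<le> (2 powr 2 :: real)" using \<alpha> by (intro powr_mono) auto
    show "M powr \<alpha> \<le> norm a powr \<alpha> + norm b powr \<alpha>" by (auto simp: M_def max_def)
  qed auto
  finally show ?thesis by (simp add: powr_numeral)
qed

lemma apow_add_le:
  assumes \<alpha>: "0 < \<alpha>" "\<alpha> < 2" and [measurable]: "f \<in> borel_measurable borel" "g \<in> borel_measurable borel"
  shows "apow \<alpha> (\<lambda>s. f s + g s) \<le> 4 * (apow \<alpha> f + apow \<alpha> g)"
proof -
  have "apow \<alpha> (\<lambda>s. f s + g s) \<le> (\<integral>\<^sup>+ s. 4 * (ennreal (norm (f s) powr \<alpha>) + ennreal (norm (g s) powr \<alpha>)) \<partial>lborel)"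
    unfolding apow_def
  proof (rule nn_integral_mono)
    fix s
    have "ennreal (norm (f s + g s) powr \<alpha>) \<le> ennreal (4 * (norm (f s) powr \<alpha> + norm (g s) powr \<alpha>))"
      by (intro ennreal_leI norm_add_powr_le \<alpha>)
    then show "ennreal (norm (f s + g s) powr \<alpha>) \<le> 4 * (ennreal (norm (f s) powr \<alpha>) + ennreal (norm (g s) powr \<alpha>))"
      by (subst (asm) ennreal_mult) (auto simp: ennreal_plus)
  qed
  then show ?thesis unfolding apow_def by (simp add: nn_integral_cmult nn_integral_add)
qed

lemma apow_scale:
  assumes [measurable]: "f \<in> borel_measurable borel"
  shows "apow \<alpha> (\<lambda>s. c * f s) = ennreal (norm c powr \<alpha>) * apow \<alpha> f"
  unfolding apow_def by (subst nn_integral_cmult[symmetric]) (auto simp: norm_mult powr_mult ennreal_mult)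

lemma apow_mono:
  assumes \<alpha>: "0 < \<alpha>" "\<And>s. norm (f s) \<le> norm (g s)"
  shows "apow \<alpha> f \<le> apow \<alpha> g"
  unfolding apow_def using assms by (intro nn_integral_mono ennreal_leI powr_mono2) auto

lemma apow_minus: "apow \<alpha> (\<lambda>s. f s - g s) = apow \<alpha> (\<lambda>s. g s - f s)"
  unfolding apow_def by (simp add: norm_minus_commute)

lemma apow_dominated_convergence:
  assumes \<alpha>: "0 < \<alpha>" "\<alpha> < 2" and [measurable]: "\<And>n. F n \<in> borel_measurable borel" "g \<in> borel_measurable borel"
    and lim: "\<And>s. (\<lambda>n. F n s) \<longlonglongrightarrow> g s" and dom: "\<And>n s. norm (F n s) \<le> 2 * norm (g s)" and fin: "apow \<alpha> g < \<infinity>"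
  shows "(\<lambda>n. apow \<alpha> (\<lambda>s. F n s - g s)) \<longlonglongrightarrow> 0"
proof -
  have "(\<lambda>n. \<integral>\<^sup>+ s. ennreal (norm (F n s - g s) powr \<alpha>) \<partial>lborel) \<longlonglongrightarrow> (\<integral>\<^sup>+ s. 0 \<partial>(lborel::real measure))"
  proof (rule nn_integral_dominated_convergence[where w="\<lambda>s. ennreal (3 powr \<alpha> * norm (g s) powr \<alpha>)"])
    show "AE s in lborel. ennreal (norm (F n s - g s) powr \<alpha>) \<le> ennreal (3 powr \<alpha> * norm (g s) powr \<alpha>)" for n
    proof (intro AE_I2 ennreal_leI)
      fix s
      have "norm (F n s - g s) \<le> 3 * norm (g s)" using norm_triangle_ineq4[of "F n s" "g s"] dom[of n s] by linarith
      then have "norm (F n s - g s) powr \<alpha> \<le> (3 * norm (g s)) powr \<alpha>" using \<alpha> by (intro powr_mono2) auto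
      then show "norm (F n s - g s) powr \<alpha> \<le> 3 powr \<alpha> * norm (g s) powr \<alpha>" by (simp add: powr_mult)
    qed
    show "(\<integral>\<^sup>+ s. ennreal (3 powr \<alpha> * norm (g s) powr \<alpha>) \<partial>lborel) < \<infinity>"
      using fin unfolding apow_def by (simp add: ennreal_mult' nn_integral_cmult ennreal_mult_less_top)
    show "AE s in lborel. (\<lambda>n. ennreal (norm (F n s - g s) powr \<alpha>)) \<longlonglongrightarrow> 0"
    proof (rule AE_I2)
      fix s
      have "(\<lambda>n. norm (F n s - g s)) \<longlonglongrightarrow> 0"
        using lim[of s] by (simp add: LIM_zero tendsto_norm_zero)
      then have "(\<lambda>n. norm (F n s - g s) powr \<alpha>) \<longlonglongrightarrow> 0 powr \<alpha>"
        using \<alpha> by (intro tendsto_powr') auto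
      then show "(\<lambda>n. ennreal (norm (F n s - g s) powr \<alpha>)) \<longlonglongrightarrow> 0"
        by (metis ennreal_0 powr_zero_eq_one powr_0 tendsto_ennrealI)
    qed
  qed auto
  then show ?thesis unfolding apow_def by simp
qed

lemma apow_indicator: "A \<in> sets borel \<Longrightarrow> apow \<alpha> (indicator A) = emeasure lborel A"
  by (auto simp: apow_def simp flip: nn_integral_indicator intro!: nn_integral_cong split: split_indicator)

lemma indicator_UN_tendsto:
  fixes A :: "nat \<Rightarrow> real set"
  assumes \<alpha>: "0 < \<alpha>" "\<alpha> < 2" and A: "\<And>n. A n \<in> sets borel" and bU: "bounded (\<Union>n. A n)"
  shows "(\<lambda>n. apow \<alpha> (\<lambda>s. indicator (\<Union>i<n. A i) s - indicator (\<Union>i. A i) s)) \<longlonglongrightarrow> 0"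
proof (rule apow_dominated_convergence[OF \<alpha>])
  show "(\<lambda>n. indicator (\<Union>i<n. A i) s :: complex) \<longlonglongrightarrow> indicator (\<Union>i. A i) s" for s
  proof (rule tendsto_eventually)
    show "\<forall>\<^sub>F n in sequentially. (indicator (\<Union>i<n. A i) s :: complex) = indicator (\<Union>i. A i) s"
    proof (cases "\<exists>i. s \<in> A i")
      case True
      then obtain i where "s \<in> A i" by auto
      then show ?thesis unfolding eventually_sequentially
        by (intro exI[of _ "Suc i"]) (auto simp: indicator_def)
    qed (auto simp: indicator_def)
  qed
  show "norm (indicator (\<Union>i<n. A i) s :: complex) \<le> 2 * norm (indicator (\<Union>i. A i) s :: complex)" for n s
    by (auto simp: indicator_def)
  show "apow \<alpha> (indicator (\<Union>i. A i)) < \<infinity>"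
    using A emeasure_bounded_finite[OF bU] by (subst apow_indicator) auto
qed (use A in auto)

text \<open>
  Membership in the closure of the step functions.
\<close>
definition step_approx :: "real \<Rightarrow> (real \<Rightarrow> complex) \<Rightarrow> bool" where
  "step_approx \<alpha> g \<longleftrightarrow> (\<forall>e::ennreal. 0 < e \<longrightarrow> (\<exists>J w. finite J \<and> apow \<alpha> (\<lambda>s. stepf J w s - g s) < e))"

lemma step_approx_limit:
  assumes \<alpha>: "0 < \<alpha>" "\<alpha> < 2" and [measurable]: "\<And>n. F n \<in> borel_measurable borel" "g \<in> borel_measurable borel"
    and ap: "\<And>n::nat. step_approx \<alpha> (F n)" and lim: "(\<lambda>n. apow \<alpha> (\<lambda>s. F n s - g s)) \<longlonglongrightarrow> 0"
  shows "step_approx \<alpha> g"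
  unfolding step_approx_def
proof (intro allI impI)
  fix e :: ennreal assume e: "0 < e"
  \<comment> \<open>The quasi-triangle inequality with constant \<open>4\<close> costs a factor \<open>8\<close>; the minimum keeps \<open>e'\<close> finite.\<close>
  define e' where "e' = min e 1 / 16"
  have e': "0 < e'" "e' < \<infinity>" "8 * e' < e"
  proof -
    have m: "0 < min e 1" "min e 1 \<le> 1" "min e 1 \<le> e" using e by auto
    then obtain r where r: "min e 1 = ennreal r" "0 < r" "r \<le> 1"
      by (metis ennreal_cases ennreal_le_1 ennreal_less_zero_iff min.cobounded2 neq_top_trans ennreal_one_neq_top)
    have e'r: "e' = ennreal (r/16)" unfolding e'_def r(1) using r by (simp add: divide_ennreal[symmetric])
    show "0 < e'" "e' < \<infinity>" using r e'r by auto
    have "8 * e' = ennreal (r/2)" unfolding e'r using r by (simp add: ennreal_mult'[symmetric] flip: ennreal_numeral)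
    also have "\<dots> < ennreal r" using r by (intro ennreal_lessI) auto
    also have "\<dots> \<le> e" using r(1) m(3) by simp
    finally show "8 * e' < e" .
  qed
  have "\<forall>\<^sub>F n in sequentially. apow \<alpha> (\<lambda>s. F n s - g s) < e'"
    using lim e'(1) by (rule order_tendstoD)
  then obtain n where n: "apow \<alpha> (\<lambda>s. F n s - g s) < e'" by (auto simp: eventually_sequentially)
  obtain J w where J: "finite J" "apow \<alpha> (\<lambda>s. stepf J w s - F n s) < e'"
    using ap[of n] e'(1) unfolding step_approx_def by blast
  have "apow \<alpha> (\<lambda>s. stepf J w s - g s) = apow \<alpha> (\<lambda>s. (stepf J w s - F n s) + (F n s - g s))" by simp
  also have "\<dots> \<le> 4 * (apow \<alpha> (\<lambda>s. stepf J w s - F n s) + apow \<alpha> (\<lambda>s. F n s - g s))"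
    by (rule apow_add_le[OF \<alpha>]) auto
  also have "\<dots> \<le> 4 * (e' + e')" using n J by (intro mult_left_mono add_mono) auto
  also have "\<dots> = 8 * e'" by (simp add: distrib_left[symmetric] mult_2[symmetric] mult.assoc[symmetric])
  also have "\<dots> < e" by fact
  finally show "\<exists>J w. finite J \<and> apow \<alpha> (\<lambda>s. stepf J w s - g s) < e" using J by blast
qed

lemma step_approx_seq:
  assumes "step_approx \<alpha> g" and that: "0 < r"
  shows "\<exists>J w. (\<forall>n. finite (J n)) \<and> (\<forall>n. apow \<alpha> (\<lambda>s. stepf (J n) (w n) s - g s) < ennreal (r ^ n))"
proof -
  have "\<forall>n. \<exists>J w. finite J \<and> apow \<alpha> (\<lambda>s. stepf J w s - g s) < ennreal (r ^ n)"
    using assms that unfolding step_approx_def by auto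
  then show ?thesis by metis
qed

lemma apow_lincomb_tendsto:
  assumes \<alpha>: "0 < \<alpha>" "\<alpha> < 2" and [measurable]: "\<And>n. F n \<in> borel_measurable borel" "\<And>n. G n \<in> borel_measurable borel"
    and "(\<lambda>n. apow \<alpha> (F n)) \<longlonglongrightarrow> 0" "(\<lambda>n. apow \<alpha> (G n)) \<longlonglongrightarrow> 0"
  shows "(\<lambda>n. apow \<alpha> (\<lambda>s. F n s + c * G n s)) \<longlonglongrightarrow> 0"
proof (rule tendsto_sandwich[OF _ _ tendsto_const])
  have "(\<lambda>n. 4 * (apow \<alpha> (F n) + ennreal (norm c powr \<alpha>) * apow \<alpha> (G n))) \<longlonglongrightarrow> 4 * (0 + ennreal (norm c powr \<alpha>) * 0)"
    by (intro ennreal_tendsto_cmult tendsto_add assms) auto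
  then show "(\<lambda>n. 4 * (apow \<alpha> (F n) + ennreal (norm c powr \<alpha>) * apow \<alpha> (G n))) \<longlonglongrightarrow> 0" by simp
  show "\<forall>\<^sub>F n in sequentially. apow \<alpha> (\<lambda>s. F n s + c * G n s) \<le> 4 * (apow \<alpha> (F n) + ennreal (norm c powr \<alpha>) * apow \<alpha> (G n))"
    using apow_add_le[OF \<alpha>, of "F _" "\<lambda>s. c * G _ s"] by (auto simp: apow_scale intro!: always_eventually)
qed auto

lemma step_approx_stepf: "finite J \<Longrightarrow> step_approx \<alpha> (stepf J w)"
  unfolding step_approx_def by (auto simp: apow_def intro!: exI[of _ J] exI[of _ w])

lemma step_approx_lincomb:
  assumes \<alpha>: "0 < \<alpha>" "\<alpha> < 2" and [measurable]: "f \<in> borel_measurable borel" "g \<in> borel_measurable borel"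
    and "step_approx \<alpha> f" "step_approx \<alpha> g"
  shows "step_approx \<alpha> (\<lambda>s. f s + c * g s)"
proof -
  have half: "0 < (1/2::real)" by simp
  obtain J w where J: "\<And>n. finite (J n)" "\<And>n. apow \<alpha> (\<lambda>s. stepf (J n) (w n) s - f s) < ennreal ((1/2) ^ n)"
    using step_approx_seq[OF assms(5) half] by blast
  obtain J' w' where J': "\<And>n. finite (J' n)" "\<And>n. apow \<alpha> (\<lambda>s. stepf (J' n) (w' n) s - g s) < ennreal ((1/2) ^ n)"
    using step_approx_seq[OF assms(6) half] by blast
  have e0: "(\<lambda>n. ennreal ((1/2) ^ n)) \<longlonglongrightarrow> 0"
    by (metis (no_types) ennreal_0 LIMSEQ_power_zero abs_of_pos half_gt_zero_iff less_numeral_extra(1) norm_divide norm_numeral norm_one one_less_numeral_iff real_norm_def semiring_norm(76) tendsto_ennrealI divide_less_eq_1_pos zero_less_numeral)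
  have a: "(\<lambda>n. apow \<alpha> (\<lambda>s. stepf (J n) (w n) s - f s)) \<longlonglongrightarrow> 0"
    by (rule tendsto_sandwich[OF _ _ tendsto_const e0]) (auto intro!: always_eventually less_imp_le J)
  have b: "(\<lambda>n. apow \<alpha> (\<lambda>s. stepf (J' n) (w' n) s - g s)) \<longlonglongrightarrow> 0"
    by (rule tendsto_sandwich[OF _ _ tendsto_const e0]) (auto intro!: always_eventually less_imp_le J')
  define u where "u n t = (if t \<in> J n then w n t else 0) + c * (if t \<in> J' n then w' n t else 0)" for n t
  have st: "stepf (J n \<union> J' n) (u n) s = stepf (J n) (w n) s + c * stepf (J' n) (w' n) s" for n s
    unfolding stepf_def u_def by (rule stepf_combine[OF J(1) J'(1)])
  have "(\<lambda>n. apow \<alpha> (\<lambda>s. (stepf (J n) (w n) s - f s) + c * (stepf (J' n) (w' n) s - g s))) \<longlonglongrightarrow> 0"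
    by (rule apow_lincomb_tendsto[OF \<alpha> _ _ a b]) auto
  then have "(\<lambda>n. apow \<alpha> (\<lambda>s. stepf (J n \<union> J' n) (u n) s - (f s + c * g s))) \<longlonglongrightarrow> 0"
    by (simp add: st algebra_simps)
  then show ?thesis
    by (rule step_approx_limit[OF \<alpha>, rotated 3]) (auto intro!: step_approx_stepf J J')
qed

lemma indicator_Ioc_stepf:
  assumes "s < t"
  shows "(indicator {s<..t} x :: complex) = stepf {s, t} (\<lambda>u. if u = t then 1 else -1) x"
  using assms unfolding stepf_def by (auto simp: hstep_def indicator_def)

lemma step_approx_zero: "step_approx \<alpha> (\<lambda>s. 0)"
  using step_approx_stepf[of "{}"] by (simp add: stepf_def[abs_def])

text \<open>
  The intervals \<open>{s<..t}\<close> generate the bounded Borel sets by proper differences and bounded countable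
  disjoint unions. The half-lines \<open>{..a}\<close> form an intersection-stable generator of the Borel sets, and
  cutting down to a window \<open>{-R<..R}\<close> turns half-lines into such intervals and complements into
  differences of bounded sets.
\<close>
lemma bounded_borel_induct [consumes 2, case_names empty interval diff union]:
  fixes A :: "real set"
  assumes "A \<in> sets borel" "bounded A" and empty: "Q {}" and Ioc: "\<And>s t. s < t \<Longrightarrow> Q {s<..t}"
    and diff: "\<And>A B. A \<in> sets borel \<Longrightarrow> B \<in> sets borel \<Longrightarrow> bounded B \<Longrightarrow> A \<subseteq> B \<Longrightarrow> Q A \<Longrightarrow> Q B \<Longrightarrow> Q (B - A)"
    and union: "\<And>A :: nat \<Rightarrow> real set. (\<And>n. A n \<in> sets borel) \<Longrightarrow> bounded (\<Union>n. A n) \<Longrightarrow> disjoint_family A \<Longrightarrow>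
      (\<And>n. Q (A n)) \<Longrightarrow> Q (\<Union>n. A n)"
  shows "Q A"
proof -
  have bsets: "sets borel = sigma_sets UNIV (range (\<lambda>a::real. {..a}))"
    unfolding borel_eq_atMost by (simp add: sets_measure_of)
  have stable: "Int_stable (range (\<lambda>a::real. {..a}))" by (auto simp: Int_stable_def)
  obtain r where r: "\<And>x. x \<in> A \<Longrightarrow> \<bar>x\<bar> \<le> r" using assms(2) unfolding bounded_iff by auto
  define R where "R = \<bar>r\<bar> + 1"
  have R: "0 < R" "A \<inter> {-R<..R} = A" using r by (force simp: R_def abs_le_iff)+
  have A: "A \<in> sigma_sets UNIV (range (\<lambda>a::real. {..a}))" using assms(1) bsets by simp
  have "Q (A \<inter> {-R<..R})"
    using stable subset_Pow_Union[of "range (\<lambda>a::real. {..a})", THEN order_trans, OF Pow_mono, OF subset_UNIV] A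
  proof (induction rule: sigma_sets_induct_disjoint)
    case (basic A)
    then obtain a where "A = {..a}" by auto
    then have "A \<inter> {-R<..R} = {-R<..min a R}" by auto
    then show ?case using Ioc[of "-R" "min a R"] empty by (cases "-R < min a R") auto
  next
    case empty
    show ?case using \<open>Q {}\<close> by simp
  next
    case (compl A)
    then have "A \<in> sets borel" using bsets by simp
    then have "Q ({-R<..R} - (A \<inter> {-R<..R}))"
      using compl(2) R(1) by (intro diff Ioc) (auto intro: bounded_subset[of "{-R..R}"])
    moreover have "{-R<..R} - (A \<inter> {-R<..R}) = (UNIV - A) \<inter> {-R<..R}" by auto
    ultimately show ?case by simp
  next
    case (union A)
    have mA: "A i \<in> sets borel" for i using union(2) bsets by auto
    have "Q (\<Union>i. A i \<inter> {-R<..R})"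
    proof (rule assms(6))
      show "disjoint_family (\<lambda>i. A i \<inter> {-R<..R})" using union(1) by (auto simp: disjoint_family_on_def)
      show "bounded (\<Union>i. A i \<inter> {-R<..R})" by (rule bounded_subset[of "{-R..R}"]) auto
    qed (use mA union(3) in auto)
    then show ?case by simp
  qed
  then show ?thesis by (simp only: R)
qed

lemma step_approx_indicator:
  assumes \<alpha>: "0 < \<alpha>" "\<alpha> < 2" and "A \<in> sets borel" "bounded A"
  shows "step_approx \<alpha> (indicator A)"
  using assms(3,4)
proof (induction rule: bounded_borel_induct)
  case empty
  show ?case by (simp add: step_approx_zero)
next
  case (interval s t)
  have "(indicator {s<..t} :: real \<Rightarrow> complex) = stepf {s, t} (\<lambda>u. if u = t then 1 else -1)"
    using indicator_Ioc_stepf[OF interval] by auto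
  then show ?case using step_approx_stepf[of "{s, t}"] by simp
next
  case (diff A B)
  have "(indicator (B - A) :: real \<Rightarrow> complex) = (\<lambda>s. indicator B s + (-1) * indicator A s)"
    using diff(4) by (intro ext) (auto simp: indicator_def)
  then show ?case using step_approx_lincomb[OF \<alpha> _ _ diff(6,5), of "-1"] diff(1,2) by simp
next
  case (union A)
  note [measurable] = union(1)
  have F: "step_approx \<alpha> (indicator (\<Union>i<n. A i))" for n
  proof (induction n)
    case 0
    show ?case by (simp add: step_approx_zero)
  next
    case (Suc n)
    have "A i \<inter> A n = {}" if "i < n" for i
      using disjoint_family_onD[OF union(3), of i n] that by simp
    then have "(\<Union>i<n. A i) \<inter> A n = {}" by blast
    then have "(indicator (\<Union>i<Suc n. A i) :: real \<Rightarrow> complex) = (\<lambda>s. indicator (\<Union>i<n. A i) s + 1 * indicator (A n) s)"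
      by (intro ext) (auto simp: lessThan_Suc indicator_def)
    then show ?case using step_approx_lincomb[OF \<alpha> _ _ Suc union(4)[of n], of 1] by simp
  qed
  show ?case
    by (rule step_approx_limit[OF \<alpha> _ _ F indicator_UN_tendsto[OF \<alpha> union(1,2)]]) auto
qed

lemma bounded_simple_sum:
  assumes "bounded_simple G"
  shows "G s = (\<Sum>z\<in>range G - {0}. z * indicator (G -` {z}) s)" and "finite (range G - {0})"
    and "\<And>z. z \<noteq> 0 \<Longrightarrow> G -` {z} \<in> sets borel \<and> bounded (G -` {z})" and "G \<in> borel_measurable borel"
proof -
  have sf: "simple_function borel G" using assms by (simp add: bounded_simple_def)
  show fin: "finite (range G - {0})" using sf by (auto simp: simple_function_def)
  show "G s = (\<Sum>z\<in>range G - {0}. z * indicator (G -` {z}) s)"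
  proof (cases "G s = 0")
    case True
    then show ?thesis by (auto intro!: sum.neutral[symmetric] simp: indicator_def)
  next
    case False
    have "(\<Sum>z\<in>range G - {0}. z * indicator (G -` {z}) s) = (\<Sum>z\<in>range G - {0}. if z = G s then G s else 0)"
      by (intro sum.cong) (auto simp: indicator_def)
    then show ?thesis using False fin by simp
  qed
  show m: "G \<in> borel_measurable borel" using sf by (rule borel_measurable_simple_function)
  show "G -` {z} \<in> sets borel \<and> bounded (G -` {z})" if "z \<noteq> 0" for z
  proof
    show "G -` {z} \<in> sets borel" using measurable_sets[OF m, of "{z}"] by simp
    show "bounded (G -` {z})"
      using assms that unfolding bounded_simple_def by (auto elim!: bounded_subset)
  qed
qed

text \<open>
  The values of the simple functions are cut off outside \<open>{-n..n}\<close> to make their support bounded, and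
  they stay below \<open>2 * norm (g s)\<close>, so that dominated convergence applies.
\<close>
lemma bounded_simple_approximation:
  assumes \<alpha>: "0 < \<alpha>" "\<alpha> < 2" and [measurable]: "g \<in> borel_measurable borel" and fin: "apow \<alpha> g < \<infinity>"
  shows "\<exists>G. (\<forall>n. bounded_simple (G n)) \<and> (\<forall>s. (\<lambda>n. G n s) \<longlonglongrightarrow> g s) \<and> (\<forall>n s. norm (G n s) \<le> 2 * norm (g s))"
proof -
  obtain F where F: "\<And>n. simple_function borel (F n)" "\<And>s. (\<lambda>n. F n s) \<longlonglongrightarrow> g s" "\<And>n s. norm (F n s) \<le> 2 * norm (g s)"
    using borel_measurable_implies_sequence_metric[OF assms(3), of 0] by (auto simp: dist_norm)
  define G where "G n s = (if s \<in> {-real n..real n} then F n s else 0)" for n s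
  have "simple_function borel (G n)" for n
    unfolding G_def using F(1)[of n]
    by (intro simple_function_If_set) auto
  moreover have "bounded {s. G n s \<noteq> 0}" for n
    by (rule bounded_subset[of "{-real n..real n}"]) (auto simp: G_def)
  moreover have "(\<lambda>n. G n s) \<longlonglongrightarrow> g s" for s
  proof (rule Lim_transform_eventually[OF F(2)[of s]])
    obtain m :: nat where "\<bar>s\<bar> \<le> real m" using real_arch_simple by blast
    then show "\<forall>\<^sub>F n in sequentially. F n s = G n s"
      unfolding eventually_sequentially G_def by (intro exI[of _ m]) auto
  qed
  moreover have "norm (G n s) \<le> 2 * norm (g s)" for n s using F(3)[of n s] by (auto simp: G_def)
  ultimately show ?thesis unfolding bounded_simple_def by blast
qed

text \<open>
  Step functions are dense: indicators of bounded Borel sets first, then simple functions by linearity,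
  then everything by domination.
\<close>
lemma step_approx_La:
  assumes \<alpha>: "0 < \<alpha>" "\<alpha> < 2" and [measurable]: "g \<in> borel_measurable borel" and fin: "apow \<alpha> g < \<infinity>"
  shows "step_approx \<alpha> g"
proof -
  obtain G where G: "\<And>n. bounded_simple (G n)" "\<And>s. (\<lambda>n. G n s) \<longlonglongrightarrow> g s" "\<And>n s. norm (G n s) \<le> 2 * norm (g s)"
    using bounded_simple_approximation[OF assms] by blast
  note Gm[measurable] = bounded_simple_sum(4)[OF G(1)]
  have ap: "step_approx \<alpha> (G n)" for n
  proof -
    have "step_approx \<alpha> (\<lambda>s. \<Sum>z\<in>S. z * indicator (G n -` {z}) s)" if "finite S" "0 \<notin> S" for S
      using that
    proof induction
      case (insert z S)
      note bs = bounded_simple_sum(3)[OF G(1)[of n]]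
      have "(\<lambda>s. \<Sum>z\<in>S. z * indicator (G n -` {z}) s) \<in> borel_measurable borel"
        using bs insert by (intro borel_measurable_sum borel_measurable_times borel_measurable_indicator) (auto, metis)
      then have "step_approx \<alpha> (\<lambda>s. (\<Sum>z\<in>S. z * indicator (G n -` {z}) s) + z * indicator (G n -` {z}) s)"
        using bs[of z] insert by (intro step_approx_lincomb[OF \<alpha>] step_approx_indicator[OF \<alpha>]) auto
      then show ?case by (simp only: sum.insert[OF insert(1,2)] add.commute)
    qed (simp add: step_approx_zero)
    from this[of "range (G n) - {0}"] show ?thesis
      using bounded_simple_sum(2)[OF G(1)[of n]] bounded_simple_sum(1)[OF G(1)[of n], abs_def]
      by (simp flip: bounded_simple_sum(1)[OF G(1)[of n]])
  qed
  show ?thesis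
    by (rule step_approx_limit[OF \<alpha> _ _ ap apow_dominated_convergence[OF \<alpha> _ _ G(2,3) fin]]) auto
qed

section \<open>Convergence in probability\<close>

lemma tendsto_in_prob_lincomb:
  assumes P: "prob_space P" and [measurable]: "\<And>i. Y i \<in> borel_measurable P" "Z \<in> borel_measurable P"
      "\<And>i. Y' i \<in> borel_measurable P" "Z' \<in> borel_measurable P"
    and Y: "tendsto_in_prob P Y Z F" and Y': "tendsto_in_prob P Y' Z' F"
  shows "tendsto_in_prob P (\<lambda>i \<omega>. Y i \<omega> + c * Y' i \<omega>) (\<lambda>\<omega>. Z \<omega> + c * Z' \<omega> :: complex) F"
  unfolding tendsto_in_prob_def
proof (intro allI impI)
  interpret prob_space P by fact
  fix e :: real assume e: "0 < e"
  define d where "d = e / (2 * (norm c + 1))"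
  have c1: "0 < norm c + 1" by (simp add: add_nonneg_pos)
  have d: "0 < d" unfolding d_def using e c1 by simp
  have cd: "norm c * d \<le> e / 2"
  proof -
    have "norm c * d \<le> (norm c + 1) * d" using d by simp
    also have "\<dots> = e / 2" using c1 unfolding d_def by (simp only: times_divide_eq_right mult.commute[of 2] mult_divide_mult_cancel_left)
    finally show ?thesis .
  qed
  define h where "h = e / 2"
  have h: "0 < h" using e by (simp add: h_def)
  have sub: "{\<omega> \<in> space P. dist (Y i \<omega> + c * Y' i \<omega>) (Z \<omega> + c * Z' \<omega>) > e} \<subseteq>
      {\<omega> \<in> space P. dist (Y i \<omega>) (Z \<omega>) > h} \<union> {\<omega> \<in> space P. dist (Y' i \<omega>) (Z' \<omega>) > d}" for i
  proof (intro subsetI, rule ccontr)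
    fix \<omega> assume *: "\<omega> \<in> {\<omega> \<in> space P. dist (Y i \<omega> + c * Y' i \<omega>) (Z \<omega> + c * Z' \<omega>) > e}"
      "\<omega> \<notin> {\<omega> \<in> space P. dist (Y i \<omega>) (Z \<omega>) > h} \<union> {\<omega> \<in> space P. dist (Y' i \<omega>) (Z' \<omega>) > d}"
    have "dist (Y i \<omega> + c * Y' i \<omega>) (Z \<omega> + c * Z' \<omega>) = norm ((Y i \<omega> - Z \<omega>) + c * (Y' i \<omega> - Z' \<omega>))"
      by (simp add: dist_norm algebra_simps)
    also have "\<dots> \<le> dist (Y i \<omega>) (Z \<omega>) + norm c * dist (Y' i \<omega>) (Z' \<omega>)"
      unfolding dist_norm norm_mult[symmetric] by (rule norm_triangle_ineq)
    also have "\<dots> \<le> h + norm c * d"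
      using * by (intro add_mono mult_left_mono) auto
    finally show False using * cd by (auto simp: h_def)
  qed
  have le: "\<P>(\<omega> in P. dist (Y i \<omega> + c * Y' i \<omega>) (Z \<omega> + c * Z' \<omega>) > e) \<le>
     \<P>(\<omega> in P. dist (Y i \<omega>) (Z \<omega>) > h) + \<P>(\<omega> in P. dist (Y' i \<omega>) (Z' \<omega>) > d)" for i
    by (rule order_trans[OF finite_measure_mono[OF sub] measure_Un_le]) measurable
  show "((\<lambda>i. \<P>(\<omega> in P. dist (Y i \<omega> + c * Y' i \<omega>) (Z \<omega> + c * Z' \<omega>) > e)) \<longlongrightarrow> 0) F"
  proof (rule tendsto_sandwich[OF _ _ tendsto_const])
    show "((\<lambda>i. \<P>(\<omega> in P. dist (Y i \<omega>) (Z \<omega>) > h) + \<P>(\<omega> in P. dist (Y' i \<omega>) (Z' \<omega>) > d)) \<longlongrightarrow> 0) F"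
      using Y Y' e d h unfolding tendsto_in_prob_def by (intro tendsto_add_zero) auto
  qed (auto intro!: always_eventually le)
qed

lemma tendsto_in_prob_cong_AE:
  assumes [measurable]: "\<And>i. Y i \<in> borel_measurable P" "Z \<in> borel_measurable P"
      "\<And>i. Y' i \<in> borel_measurable P" "Z' \<in> borel_measurable P"
    and "\<And>i. AE \<omega> in P. Y i \<omega> = Y' i \<omega>" "AE \<omega> in P. Z \<omega> = (Z' \<omega> :: complex)"
    and "tendsto_in_prob P Y Z F"
  shows "tendsto_in_prob P Y' Z' F"
proof -
  have "\<P>(\<omega> in P. dist (Y i \<omega>) (Z \<omega>) > e) = \<P>(\<omega> in P. dist (Y' i \<omega>) (Z' \<omega>) > e)" for i e
    using assms(5)[of i] assms(6) by (intro measure_eq_AE) (elim AE_mp, auto intro!: AE_I2)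
  then show ?thesis using assms(7) unfolding tendsto_in_prob_def by simp
qed

lemma tendsto_in_prob_if_AE:
  assumes P: "prob_space P" and [measurable]: "\<And>i::nat. Y i \<in> borel_measurable P" "Z \<in> borel_measurable P"
    and lim: "AE \<omega> in P. (\<lambda>i. Y i \<omega>) \<longlonglongrightarrow> (Z \<omega> :: complex)"
  shows "tendsto_in_prob P Y Z sequentially"
  unfolding tendsto_in_prob_def
proof (intro allI impI)
  interpret prob_space P by fact
  fix e :: real assume e: "0 < e"
  have "(\<lambda>i. \<integral>\<omega>. indicator {\<omega> \<in> space P. dist (Y i \<omega>) (Z \<omega>) > e} \<omega> \<partial>P) \<longlonglongrightarrow> (\<integral>\<omega>. (0::real) \<partial>P)"
  proof (rule integral_dominated_convergence[where w="\<lambda>_. 1"])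
    show "AE \<omega> in P. (\<lambda>i. indicator {\<omega> \<in> space P. dist (Y i \<omega>) (Z \<omega>) > e} \<omega>) \<longlonglongrightarrow> (0::real)"
      using lim
    proof eventually_elim
      case (elim \<omega>)
      then have "\<forall>\<^sub>F i in sequentially. dist (Y i \<omega>) (Z \<omega>) < e" using e by (rule tendstoD)
      then show ?case by (intro tendsto_eventually) (auto elim!: eventually_mono simp: indicator_def)
    qed
  qed (auto simp: indicator_def)
  then show "(\<lambda>i. \<P>(\<omega> in P. dist (Y i \<omega>) (Z \<omega>) > e)) \<longlonglongrightarrow> 0" by simp
qed

lemma tendsto_in_prob_if_bounded:
  assumes "\<And>i e. 0 < e \<Longrightarrow> \<P>(\<omega> in P. dist (Y i \<omega>) (Z \<omega>) > e) \<le> c e * b i" "(b \<longlongrightarrow> 0) F"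
  shows "tendsto_in_prob P Y Z F"
  unfolding tendsto_in_prob_def
proof (intro allI impI)
  fix e :: real assume e: "0 < e"
  show "((\<lambda>i. \<P>(\<omega> in P. dist (Y i \<omega>) (Z \<omega>) > e)) \<longlongrightarrow> 0) F"
    by (rule tendsto_sandwich[OF _ _ tendsto_const tendsto_mult_right_zero[OF assms(2), of "c e"]])
      (use assms(1)[OF e] in \<open>auto intro!: always_eventually\<close>)
qed

lemma tendsto_in_prob_subseq:
  assumes "tendsto_in_prob P Y Z sequentially" "strict_mono r"
  shows "tendsto_in_prob P (\<lambda>n. Y (r n)) Z sequentially"
  using assms unfolding tendsto_in_prob_def
  by (auto intro: LIMSEQ_subseq_LIMSEQ[unfolded comp_def])

lemma AE_zero_if_tails_zero:
  fixes Y :: "'a \<Rightarrow> complex"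
  assumes "prob_space P" and [measurable]: "Y \<in> borel_measurable P"
    and tail: "\<And>e. 0 < e \<Longrightarrow> \<P>(\<omega> in P. norm (Y \<omega>) > e) = 0"
  shows "AE \<omega> in P. Y \<omega> = 0"
proof -
  interpret prob_space P by fact
  have "AE \<omega> in P. \<not> norm (Y \<omega>) > 1 / real (Suc n)" for n
    using tail[of "1 / real (Suc n)"] by (subst AE_iff_measurable[OF _ refl]) (auto simp: emeasure_eq_measure)
  then have "AE \<omega> in P. \<forall>n. \<not> norm (Y \<omega>) > 1 / real (Suc n)" by (subst AE_all_countable) auto
  then show ?thesis
  proof eventually_elim
    case (elim \<omega>)
    then show ?case using reals_Archimedean[of "norm (Y \<omega>)"] by (auto simp: inverse_eq_divide)
  qed
qed

lemma tendsto_in_prob_unique: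
  fixes Y Z :: "'a \<Rightarrow> complex"
  assumes P: "prob_space P" and [measurable]: "\<And>n::nat. X n \<in> borel_measurable P" "Y \<in> borel_measurable P" "Z \<in> borel_measurable P"
    and "tendsto_in_prob P X Y sequentially" "tendsto_in_prob P X Z sequentially"
  shows "AE \<omega> in P. Y \<omega> = Z \<omega>"
proof -
  have "tendsto_in_prob P (\<lambda>n \<omega>. X n \<omega> + (-1) * X n \<omega>) (\<lambda>\<omega>. Y \<omega> + (-1) * Z \<omega>) sequentially"
    by (rule tendsto_in_prob_lincomb[OF P]) (use assms in auto)
  then have "AE \<omega> in P. Y \<omega> - Z \<omega> = 0"
    by (intro AE_zero_if_tails_zero[OF P]) (auto simp: tendsto_in_prob_def LIMSEQ_const_iff dist_norm norm_minus_commute)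
  then show ?thesis by simp
qed

lemma AE_zero_if_chf_one:
  assumes P: "prob_space P" and [measurable]: "Y \<in> borel_measurable P" and one: "\<And>z. chf P (\<lambda>\<omega>. z * Y \<omega>) = 1"
  shows "AE \<omega> in P. Y \<omega> = 0"
proof (rule AE_zero_if_tails_zero[OF P])
  fix e :: real assume "0 < e"
  then have "\<P>(\<omega> in P. norm (Y \<omega>) > e) \<le> 48 * 0 * e powr (-1)"
    by (intro chf_tail_bound[OF P]) (auto simp: one)
  then show "\<P>(\<omega> in P. norm (Y \<omega>) > e) = 0" by (simp add: measure_le_0_iff)
qed auto

section \<open>The stochastic integral of functions with integrable powers\<close>

text \<open>
  A Levy process with a real exponent of at most stable growth. Both \<open>L\<close> itself and the stable
  process in the limit are of this kind, so the integral is developed once for both.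
\<close>
locale levy_noise =
  fixes P :: "'a measure" and L :: "real \<Rightarrow> 'a \<Rightarrow> complex" and \<Psi> :: "complex \<Rightarrow> real" and \<alpha> K :: real
  assumes levy: "levy_process P L"
    and alpha: "0 < \<alpha>" "\<alpha> < 2"
    and Psi_nonneg: "\<And>z. 0 \<le> \<Psi> z"
    and Psi_le: "\<And>z. \<Psi> z \<le> K * norm z powr \<alpha>"
    and Psi_cont: "continuous_on UNIV \<Psi>"
    and chf_L: "\<And>t z. 0 \<le> t \<Longrightarrow> chf P (\<lambda>\<omega>. z * L t \<omega>) = of_real (exp (- t * \<Psi> z))"
begin

lemma prob_P: "prob_space P" and L_meas [measurable]: "L t \<in> borel_measurable P"
  and L_0: "AE \<omega> in P. L 0 \<omega> = 0"
  using levy unfolding levy_process_def by auto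

sublocale prob_space P by (rule prob_P)

lemma K_nonneg: "0 \<le> K"
  using Psi_nonneg[of 1] Psi_le[of 1] by simp

lemma Psi_0: "\<Psi> 0 = 0"
  using Psi_nonneg[of 0] Psi_le[of 0] alpha by simp

lemma Psi_meas [measurable]: "\<Psi> \<in> borel_measurable borel"
  using Psi_cont by (rule borel_measurable_continuous_onI)

lemma chf_increment:
  assumes "s \<le> t"
  shows "chf P (\<lambda>\<omega>. z * (L t \<omega> - L s \<omega>)) = of_real (exp (- (t - s) * \<Psi> z))"
proof -
  have stationary: "\<forall>s t h. s \<le> t \<longrightarrow>
        distr P borel (\<lambda>\<omega>. L (t + h) \<omega> - L (s + h) \<omega>) = distr P borel (\<lambda>\<omega>. L t \<omega> - L s \<omega>)"
    using levy unfolding levy_process_def by blast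
  have "distr P borel (\<lambda>\<omega>. L ((t - s) + s) \<omega> - L (0 + s) \<omega>) = distr P borel (\<lambda>\<omega>. L (t - s) \<omega> - L 0 \<omega>)"
    using stationary[rule_format, of 0 "t - s" s] assms by simp
  then have eq: "distr P borel (\<lambda>\<omega>. L t \<omega> - L s \<omega>) = distr P borel (\<lambda>\<omega>. L (t - s) \<omega> - L 0 \<omega>)" by simp
  have "chf P (\<lambda>\<omega>. z * (L t \<omega> - L s \<omega>)) = chf (distr P borel (\<lambda>\<omega>. L t \<omega> - L s \<omega>)) (\<lambda>x. z * x)"
    by (subst chf_distr) auto
  also have "\<dots> = chf P (\<lambda>\<omega>. z * (L (t - s) \<omega> - L 0 \<omega>))"
    unfolding eq by (subst chf_distr) auto
  also have "\<dots> = chf P (\<lambda>\<omega>. z * L (t - s) \<omega>)"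
    using L_0 by (intro chf_cong_AE) auto
  finally show ?thesis using chf_L[of "t - s" z] assms by simp
qed

definition stepI :: "real set \<Rightarrow> (real \<Rightarrow> complex) \<Rightarrow> 'a \<Rightarrow> complex" where
  "stepI J w \<omega> = (\<Sum>t\<in>J. w t * (L t \<omega> - L 0 \<omega>))"

lemma stepI_meas [measurable]: "stepI J w \<in> borel_measurable P"
  unfolding stepI_def by measurable

text \<open>
  On a grid containing the jumps the integral becomes a combination of independent increments, and the
  product of their characteristic functions is the exponential of a Riemann sum that equals the
  integral.
\<close>
lemma chf_stepI:
  assumes "finite J"
  shows "chf P (stepI J w) = of_real (exp (- (\<integral>s. \<Psi> (stepf J w s) \<partial>lborel)))"
proof -
  obtain \<tau> N m where \<tau>: "strict_mono \<tau>" "J \<subseteq> \<tau> ` {..N::nat}" "m \<le> N" "\<tau> m = 0"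
    using grid_exists[OF assms] by blast
  define c where "c k = stepf J w (\<tau> (Suc k))" for k
  define Y where "Y k \<omega> = L (\<tau> (Suc k)) \<omega> - L (\<tau> k) \<omega>" for k \<omega>
  have [measurable]: "Y k \<in> borel_measurable P" for k unfolding Y_def by measurable
  have "stepI J w \<omega> = (\<Sum>k<N. c k * Y k \<omega>)" for \<omega>
  proof -
    have "L t \<omega> - L 0 \<omega> = (\<Sum>k<N. of_real (hstep t (\<tau> (Suc k))) * Y k \<omega>)" if tJ: "t \<in> J" for t
    proof -
      obtain j where "t = \<tau> j" "j \<le> N" using tJ \<tau>(2) by auto
      then show ?thesis using hstep_telescope[OF \<tau>(1) _ \<tau>(3,4), of j "\<lambda>k. L (\<tau> k) \<omega>"] \<tau>(4) by (simp add: Y_def)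
    qed
    then have "stepI J w \<omega> = (\<Sum>t\<in>J. \<Sum>k<N. w t * of_real (hstep t (\<tau> (Suc k))) * Y k \<omega>)"
      unfolding stepI_def by (intro sum.cong) (auto simp: sum_distrib_left mult.assoc)
    also have "\<dots> = (\<Sum>k<N. c k * Y k \<omega>)"
      unfolding c_def stepf_def by (subst sum.swap) (simp add: sum_distrib_right)
    finally show ?thesis .
  qed
  then have "chf P (stepI J w) = chf P (\<lambda>\<omega>. \<Sum>k<N. c k * Y k \<omega>)" by presburger
  also have "\<dots> = (\<Prod>k<N. chf P (\<lambda>\<omega>. c k * Y k \<omega>))"
    using levy \<tau>(1) unfolding levy_process_def Y_def by (intro chf_sum_indep prob_P) auto
  also have "\<dots> = (\<Prod>k<N. of_real (exp (- (\<tau> (Suc k) - \<tau> k) * \<Psi> (c k))))"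
    unfolding Y_def by (intro prod.cong refl chf_increment) (simp add: strict_mono_less_eq[OF \<tau>(1)])
  also have "\<dots> = of_real (exp (\<Sum>k<N. - (\<tau> (Suc k) - \<tau> k) * \<Psi> (c k)))"
    by (simp add: exp_sum)
  also have "(\<Sum>k<N. - (\<tau> (Suc k) - \<tau> k) * \<Psi> (c k)) = - (\<integral>s. \<Psi> (stepf J w s) \<partial>lborel)"
    unfolding stepf_integral(2)[of \<tau> J N m \<Psi>, OF \<tau> Psi_0] c_def sum_negf[symmetric] by (auto intro!: sum.cong simp: algebra_simps)
  finally show ?thesis .
qed

lemma apow_stepf_finite:
  assumes "finite J"
  shows "apow \<alpha> (stepf J w) < \<infinity>"
proof -
  obtain \<tau> N m where \<tau>: "strict_mono \<tau>" "J \<subseteq> \<tau> ` {..N::nat}" "m \<le> N" "\<tau> m = 0"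
    using grid_exists[OF assms] by blast
  have "integrable lborel (\<lambda>s. norm (stepf J w s) powr \<alpha>)"
    using stepf_integral(1)[of \<tau> J N m "\<lambda>z. norm z powr \<alpha>", OF \<tau>] alpha by simp
  then show ?thesis
    unfolding apow_def by (simp add: integrable_iff_bounded)
qed

definition La :: "(real \<Rightarrow> complex) \<Rightarrow> bool" where
  "La g \<longleftrightarrow> g \<in> borel_measurable borel \<and> apow \<alpha> g < \<infinity>"

lemma La_meas: "La g \<Longrightarrow> g \<in> borel_measurable borel" by (simp add: La_def)

lemma La_lincomb:
  assumes "La f" "La g"
  shows "La (\<lambda>s. f s + c * g s)"
proof -
  note [measurable] = La_meas[OF assms(1)] La_meas[OF assms(2)]
  have "apow \<alpha> (\<lambda>s. f s + c * g s) \<le> 4 * (apow \<alpha> f + ennreal (norm c powr \<alpha>) * apow \<alpha> g)"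
    using apow_add_le[OF alpha, of f "\<lambda>s. c * g s"] by (simp add: apow_scale)
  also have "\<dots> < \<infinity>" using assms unfolding La_def by (simp add: ennreal_mult_less_top)
  finally show ?thesis unfolding La_def by simp
qed

lemma La_zero: "La (\<lambda>s. 0)"
  using alpha by (simp add: La_def apow_def)

lemma La_scale: "La g \<Longrightarrow> La (\<lambda>s. c * g s)"
  using La_lincomb[OF La_zero] by simp

lemma La_diff: "La f \<Longrightarrow> La g \<Longrightarrow> La (\<lambda>s. f s - g s)"
  using La_lincomb[of f g "-1"] by simp

lemma La_dominated:
  assumes "La g" "f \<in> borel_measurable borel" "\<And>s. norm (f s) \<le> norm (g s)"
  shows "La f"
  using assms apow_mono[of \<alpha> f g, OF alpha(1) assms(3)] unfolding La_def by (auto intro: le_less_trans)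

lemma La_restrict:
  assumes "La g" "A \<in> sets borel"
  shows "La (\<lambda>s. g s * indicator A s)"
  using assms(2) La_meas[OF assms(1)] by (intro La_dominated[OF assms(1)]) (auto simp: indicator_def)

lemma La_stepf: "finite J \<Longrightarrow> La (stepf J w)"
  using apow_stepf_finite by (simp add: La_def)

lemma La_indicator: "A \<in> sets borel \<Longrightarrow> bounded A \<Longrightarrow> La (indicator A)"
  using emeasure_bounded_finite[of A] by (simp add: La_def apow_indicator)

lemma Psi_integrable:
  assumes "La g"
  shows "integrable lborel (\<lambda>s. \<Psi> (g s))"
    and "(\<integral>s. \<Psi> (g s) \<partial>lborel) \<le> K * enn2real (apow \<alpha> g)"
    and "0 \<le> (\<integral>s. \<Psi> (g s) \<partial>lborel)"
    and "(\<integral>\<^sup>+s. ennreal (\<Psi> (g s)) \<partial>lborel) = ennreal (\<integral>s. \<Psi> (g s) \<partial>lborel)"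
proof -
  note [measurable] = La_meas[OF assms]
  have i: "integrable lborel (\<lambda>s. norm (g s) powr \<alpha>)"
    using assms unfolding La_def apow_def by (simp add: integrable_iff_bounded)
  show 1: "integrable lborel (\<lambda>s. \<Psi> (g s))"
    by (rule Bochner_Integration.integrable_bound[OF integrable_mult_right[OF i, of K]])
      (use Psi_le Psi_nonneg K_nonneg in auto)
  have "(\<integral>s. \<Psi> (g s) \<partial>lborel) \<le> (\<integral>s. K * norm (g s) powr \<alpha> \<partial>lborel)"
    using i 1 Psi_le by (intro integral_mono) auto
  also have "\<dots> = K * enn2real (apow \<alpha> g)"
    unfolding apow_def by (simp add: enn2real_nn_integral_eq_integral[of _ "\<lambda>s. norm (g s) powr \<alpha>"])
  finally show "(\<integral>s. \<Psi> (g s) \<partial>lborel) \<le> K * enn2real (apow \<alpha> g)" .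
  show "0 \<le> (\<integral>s. \<Psi> (g s) \<partial>lborel)" using Psi_nonneg by simp
  show "(\<integral>\<^sup>+s. ennreal (\<Psi> (g s)) \<partial>lborel) = ennreal (\<integral>s. \<Psi> (g s) \<partial>lborel)"
    using 1 Psi_nonneg by (intro nn_integral_eq_integral) auto
qed

text \<open>
  \<open>Y\<close> is a version of the integral of \<open>g\<close>: the pair \<open>(g, Y)\<close> lies in the closure of the graph of
  \<open>stepI\<close>, with respect to convergence in the \<open>\<alpha>\<close>-th mean and in probability. Taking a relation
  instead of choosing a version makes linearity immediate.
\<close>
definition isI :: "(real \<Rightarrow> complex) \<Rightarrow> ('a \<Rightarrow> complex) \<Rightarrow> bool" where
  "isI g Y \<longleftrightarrow> La g \<and> Y \<in> borel_measurable P \<and>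
     (\<exists>J w. (\<forall>n::nat. finite (J n)) \<and> (\<lambda>n. apow \<alpha> (\<lambda>s. stepf (J n) (w n) s - g s)) \<longlonglongrightarrow> 0 \<and>
        tendsto_in_prob P (\<lambda>n. stepI (J n) (w n)) Y sequentially)"

lemma isI_La: "isI g Y \<Longrightarrow> La g" and isI_meas: "isI g Y \<Longrightarrow> Y \<in> borel_measurable P"
  unfolding isI_def by auto

lemma isI_stepI: "finite J \<Longrightarrow> isI (stepf J w) (stepI J w)"
  unfolding isI_def using alpha
  by (auto intro!: La_stepf exI[of _ "\<lambda>_. J"] exI[of _ "\<lambda>_. w"] simp: apow_def tendsto_in_prob_def)

lemma isI_zero: "isI (\<lambda>s. 0) (\<lambda>\<omega>. 0)"
  using isI_stepI[of "{}"] by (simp add: stepf_def[abs_def] stepI_def[abs_def])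

lemma isI_lincomb:
  assumes "isI f X" "isI g Y"
  shows "isI (\<lambda>s. f s + c * g s) (\<lambda>\<omega>. X \<omega> + c * Y \<omega>)"
proof -
  note [measurable] = isI_meas[OF assms(1)] isI_meas[OF assms(2)] La_meas[OF isI_La[OF assms(1)]] La_meas[OF isI_La[OF assms(2)]]
  obtain J w where J: "\<And>n::nat. finite (J n)" and a: "(\<lambda>n. apow \<alpha> (\<lambda>s. stepf (J n) (w n) s - f s)) \<longlonglongrightarrow> 0"
    and p: "tendsto_in_prob P (\<lambda>n. stepI (J n) (w n)) X sequentially"
    using assms(1) unfolding isI_def by auto
  obtain J' w' where J': "\<And>n::nat. finite (J' n)" and a': "(\<lambda>n. apow \<alpha> (\<lambda>s. stepf (J' n) (w' n) s - g s)) \<longlonglongrightarrow> 0"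
    and p': "tendsto_in_prob P (\<lambda>n. stepI (J' n) (w' n)) Y sequentially"
    using assms(2) unfolding isI_def by auto
  define u where "u n t = (if t \<in> J n then w n t else 0) + c * (if t \<in> J' n then w' n t else 0)" for n t
  have st: "stepf (J n \<union> J' n) (u n) s = stepf (J n) (w n) s + c * stepf (J' n) (w' n) s" for n s
    unfolding stepf_def u_def by (rule stepf_combine[OF J J'])
  have sI: "stepI (J n \<union> J' n) (u n) \<omega> = stepI (J n) (w n) \<omega> + c * stepI (J' n) (w' n) \<omega>" for n \<omega>
    unfolding stepI_def u_def by (rule stepf_combine[OF J J'])
  have "(\<lambda>n. apow \<alpha> (\<lambda>s. (stepf (J n) (w n) s - f s) + c * (stepf (J' n) (w' n) s - g s))) \<longlonglongrightarrow> 0"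
    by (rule apow_lincomb_tendsto[OF alpha _ _ a a']) auto
  then have "(\<lambda>n. apow \<alpha> (\<lambda>s. stepf (J n \<union> J' n) (u n) s - (f s + c * g s))) \<longlonglongrightarrow> 0"
    by (simp add: st algebra_simps)
  moreover have "tendsto_in_prob P (\<lambda>n. stepI (J n \<union> J' n) (u n)) (\<lambda>\<omega>. X \<omega> + c * Y \<omega>) sequentially"
    unfolding sI[abs_def] by (rule tendsto_in_prob_lincomb[OF prob_P _ _ _ _ p p']) auto
  ultimately show ?thesis
    unfolding isI_def using J J' La_lincomb[OF isI_La[OF assms(1)] isI_La[OF assms(2)]]
    by (intro conjI exI[of _ "\<lambda>n. J n \<union> J' n"] exI[of _ u]) auto
qed

lemma isI_scale: "isI g Y \<Longrightarrow> isI (\<lambda>s. c * g s) (\<lambda>\<omega>. c * Y \<omega>)"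
  using isI_lincomb[OF isI_zero] by simp

lemma isI_diff: "isI f X \<Longrightarrow> isI g Y \<Longrightarrow> isI (\<lambda>s. f s - g s) (\<lambda>\<omega>. X \<omega> - Y \<omega>)"
  using isI_lincomb[of f X g Y "-1"] by simp

lemma isI_sum:
  assumes "finite A" "\<And>i. i \<in> A \<Longrightarrow> isI (g i) (Y i)"
  shows "isI (\<lambda>s. \<Sum>i\<in>A. c i * g i s) (\<lambda>\<omega>. \<Sum>i\<in>A. c i * Y i \<omega>)"
  using assms
proof (induction A)
  case empty show ?case by (simp add: isI_zero)
next
  case (insert i A)
  then show ?case using isI_lincomb[of "\<lambda>s. \<Sum>i\<in>A. c i * g i s" "\<lambda>\<omega>. \<Sum>i\<in>A. c i * Y i \<omega>" "g i" "Y i" "c i"]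
    by (simp add: add.commute)
qed

lemma isI_cong_AE:
  assumes "isI g Y" "Y' \<in> borel_measurable P" "AE \<omega> in P. Y \<omega> = Y' \<omega>"
  shows "isI g Y'"
  using assms(1) unfolding isI_def
  by (auto intro: assms(2) tendsto_in_prob_cong_AE[OF stepI_meas isI_meas[OF assms(1)] stepI_meas assms(2) _ assms(3)])

text \<open>
  Summable distances in the \<open>\<alpha>\<close>-th mean give convergence almost everywhere together with the common
  dominating function \<open>4 * K * (D s + norm (g s) powr \<alpha>)\<close>.
\<close>
lemma Psi_integral_convergence:
  assumes [measurable]: "\<And>n. F n \<in> borel_measurable borel" and g: "La g"
    and fast: "\<And>n. apow \<alpha> (\<lambda>s. F n s - g s) \<le> ennreal ((1/2) ^ n)"
  shows "(\<lambda>n. \<integral>s. \<Psi> (F n s) \<partial>lborel) \<longlonglongrightarrow> (\<integral>s. \<Psi> (g s) \<partial>lborel)"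
proof -
  note [measurable] = La_meas[OF g]
  \<comment> \<open>A finite integral of the sum of all the errors controls them simultaneously.\<close>
  define D where "D s = (\<Sum>n. ennreal (norm (F n s - g s) powr \<alpha>))" for s
  have [measurable]: "D \<in> borel_measurable borel" unfolding D_def by measurable
  have "(\<integral>\<^sup>+s. D s \<partial>lborel) = (\<Sum>n. apow \<alpha> (\<lambda>s. F n s - g s))"
    unfolding D_def apow_def by (intro nn_integral_suminf) auto
  also have "\<dots> \<le> (\<Sum>n. ennreal ((1/2) ^ n))"
    using fast by (intro suminf_le) auto
  also have "\<dots> = ennreal (\<Sum>n. (1/2) ^ n)"
    by (intro suminf_ennreal2) (auto intro: summable_geometric)
  finally have Dfin: "(\<integral>\<^sup>+s. D s \<partial>lborel) < \<infinity>" by (simp add: le_less_trans)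
  then have Dae: "AE s in lborel. D s \<noteq> \<infinity>"
    by (intro nn_integral_PInf_AE) auto
  have ae: "AE s in lborel. (\<lambda>n. F n s) \<longlonglongrightarrow> g s"
    using Dae
  proof eventually_elim
    case (elim s)
    then have "summable (\<lambda>n. norm (F n s - g s) powr \<alpha>)"
      unfolding D_def by (intro summable_suminf_not_top) auto
    then have "(\<lambda>n. norm (F n s - g s) powr \<alpha>) \<longlonglongrightarrow> 0" by (rule summable_LIMSEQ_zero)
    then have "(\<lambda>n. (norm (F n s - g s) powr \<alpha>) powr (1/\<alpha>)) \<longlonglongrightarrow> 0 powr (1/\<alpha>)"
      using alpha by (intro tendsto_powr') auto
    then have "(\<lambda>n. norm (F n s - g s)) \<longlonglongrightarrow> 0" using alpha by (simp add: powr_powr)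
    then show ?case by (simp add: LIM_zero_iff tendsto_norm_zero_iff)
  qed
  have "(\<lambda>n. \<integral>\<^sup>+s. ennreal (\<Psi> (F n s)) \<partial>lborel) \<longlonglongrightarrow> (\<integral>\<^sup>+s. ennreal (\<Psi> (g s)) \<partial>lborel)"
  proof (rule nn_integral_dominated_convergence[where w="\<lambda>s. ennreal (4 * K) * (D s + ennreal (norm (g s) powr \<alpha>))"])
    show "(\<integral>\<^sup>+ s. ennreal (4 * K) * (D s + ennreal (norm (g s) powr \<alpha>)) \<partial>lborel) < \<infinity>"
      using Dfin g unfolding La_def apow_def
      by (subst nn_integral_cmult) (auto simp: nn_integral_add ennreal_mult_less_top)
    show "AE s in lborel. ennreal (\<Psi> (F n s)) \<le> ennreal (4 * K) * (D s + ennreal (norm (g s) powr \<alpha>))" for n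
    proof (rule AE_I2)
      fix s
      have "\<Psi> (F n s) \<le> K * norm ((F n s - g s) + g s) powr \<alpha>" using Psi_le[of "F n s"] by simp
      also have "\<dots> \<le> K * (4 * (norm (F n s - g s) powr \<alpha> + norm (g s) powr \<alpha>))"
        by (intro mult_left_mono norm_add_powr_le alpha K_nonneg)
      also have "\<dots> = 4 * K * (norm (F n s - g s) powr \<alpha> + norm (g s) powr \<alpha>)" by simp
      finally have "ennreal (\<Psi> (F n s)) \<le> ennreal (4 * K * (norm (F n s - g s) powr \<alpha> + norm (g s) powr \<alpha>))"
        by (rule ennreal_leI)
      also have "\<dots> = ennreal (4 * K) * (ennreal (norm (F n s - g s) powr \<alpha>) + ennreal (norm (g s) powr \<alpha>))"
        using K_nonneg by (subst ennreal_mult) auto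
      also have "\<dots> \<le> ennreal (4 * K) * (D s + ennreal (norm (g s) powr \<alpha>))"
      proof (intro mult_left_mono add_right_mono)
        show "ennreal (norm (F n s - g s) powr \<alpha>) \<le> D s"
        proof -
          have "(\<Sum>i\<in>{n}. f i) \<le> suminf f" for f :: "nat \<Rightarrow> ennreal" by (intro sum_le_suminf) auto
          from this[of "\<lambda>n. ennreal (norm (F n s - g s) powr \<alpha>)"] show ?thesis unfolding D_def by simp
        qed
      qed simp
      finally show "ennreal (\<Psi> (F n s)) \<le> ennreal (4 * K) * (D s + ennreal (norm (g s) powr \<alpha>))" .
    qed
    show "AE s in lborel. (\<lambda>n. ennreal (\<Psi> (F n s))) \<longlonglongrightarrow> ennreal (\<Psi> (g s))"
      using ae
    proof eventually_elim
      case (elim s)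
      then have "(\<lambda>n. \<Psi> (F n s)) \<longlonglongrightarrow> \<Psi> (g s)"
        using Psi_cont by (intro isCont_tendsto_compose[of _ \<Psi>]) (auto simp: continuous_on_eq_continuous_at)
      then show ?case by (rule tendsto_ennrealI)
    qed
  qed auto
  moreover have FLa: "La (F n)" for n
  proof -
    have "La (\<lambda>s. F n s - g s)"
      unfolding La_def using fast[of n] by (auto intro: le_less_trans)
    from La_lincomb[OF this g, of 1] show ?thesis by simp
  qed
  ultimately have "(\<lambda>n. ennreal (\<integral>s. \<Psi> (F n s) \<partial>lborel)) \<longlonglongrightarrow> ennreal (\<integral>s. \<Psi> (g s) \<partial>lborel)"
    using Psi_integrable(4)[OF FLa] Psi_integrable(4)[OF g] by simp
  then show ?thesis
    using Psi_integrable(3)[OF FLa] Psi_integrable(3)[OF g] by (simp add: tendsto_ennreal_iff)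
qed

text \<open>
  Passage to the limit along a subsequence of approximating step functions that converges fast enough
  for \<open>Psi_integral_convergence\<close>.
\<close>
lemma isI_chf:
  assumes "isI g Y"
  shows "chf P (\<lambda>\<omega>. z * Y \<omega>) = of_real (exp (- (\<integral>s. \<Psi> (z * g s) \<partial>lborel)))"
proof -
  have main: "chf P Y = of_real (exp (- (\<integral>s. \<Psi> (g s) \<partial>lborel)))" if I: "isI g Y" for g Y
  proof -
    note [measurable] = isI_meas[OF I] La_meas[OF isI_La[OF I]]
    obtain J w where J: "\<And>n::nat. finite (J n)" and a: "(\<lambda>n. apow \<alpha> (\<lambda>s. stepf (J n) (w n) s - g s)) \<longlonglongrightarrow> 0"
      and p: "tendsto_in_prob P (\<lambda>n. stepI (J n) (w n)) Y sequentially"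
      using I unfolding isI_def by auto
    have "\<exists>r. strict_mono r \<and> (\<forall>n. apow \<alpha> (\<lambda>s. stepf (J (r n)) (w (r n)) s - g s) \<le> ennreal ((1/2)^n))"
    proof -
      have ev: "\<exists>N. \<forall>k\<ge>N. apow \<alpha> (\<lambda>s. stepf (J k) (w k) s - g s) < ennreal ((1/2)^n)" for n
        using order_tendstoD(2)[OF a, of "ennreal ((1/2)^n)"] by (auto simp: eventually_sequentially)
      then obtain N where N: "\<And>n k. k \<ge> N n \<Longrightarrow> apow \<alpha> (\<lambda>s. stepf (J k) (w k) s - g s) < ennreal ((1/2)^n)"
        by metis
      define r where "r n = (\<Sum>i\<le>n. N i) + n" for n
      have "strict_mono r" by (rule strict_monoI_Suc) (simp add: r_def)
      moreover have "N n \<le> r n" for n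
        using member_le_sum[of n "{..n}" N] by (simp add: r_def)
      ultimately show ?thesis using N by (auto intro!: exI[of _ r] less_imp_le)
    qed
    then obtain r where r: "strict_mono r" "\<And>n. apow \<alpha> (\<lambda>s. stepf (J (r n)) (w (r n)) s - g s) \<le> ennreal ((1/2)^n)" by auto
    have "(\<lambda>n. chf P (\<lambda>\<omega>. 1 * stepI (J (r n)) (w (r n)) \<omega>)) \<longlonglongrightarrow> chf P (\<lambda>\<omega>. 1 * Y \<omega>)"
      by (rule tendsto_in_prob_chf[OF prob_P _ _ tendsto_in_prob_subseq[OF p r(1)]]) auto
    moreover have "(\<lambda>n. complex_of_real (exp (- (\<integral>s. \<Psi> (stepf (J (r n)) (w (r n)) s) \<partial>lborel)))) \<longlonglongrightarrow> of_real (exp (- (\<integral>s. \<Psi> (g s) \<partial>lborel)))"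
      by (intro tendsto_intros Psi_integral_convergence isI_La[OF I] r(2)) auto
    ultimately show ?thesis
      using chf_stepI[OF J] LIMSEQ_unique by simp
  qed
  show ?thesis using main[OF isI_scale[OF assms, of z]] .
qed

text \<open>
  The estimate behind uniqueness and continuity of the integral: since \<open>1 - exp (- x) \<le> x\<close>, the growth
  bound on \<open>\<Psi>\<close> puts the integral into the scope of \<open>chf_tail_bound\<close>.
\<close>
lemma isI_tail:
  assumes Y: "isI g Y" and "0 < e"
  shows "\<P>(\<omega> in P. norm (Y \<omega>) > e) \<le> (48 * K * e powr (-\<alpha>)) * enn2real (apow \<alpha> g)"
proof -
  note g = isI_La[OF Y] and [measurable] = isI_meas[OF Y] La_meas[OF isI_La[OF Y]]
  have "\<P>(\<omega> in P. norm (Y \<omega>) > e) \<le> 48 * (K * enn2real (apow \<alpha> g)) * e powr (-\<alpha>)"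
  proof (rule chf_tail_bound[OF prob_P _ alpha _ _ \<open>0 < e\<close>])
    show "0 \<le> K * enn2real (apow \<alpha> g)" using K_nonneg by simp
    fix z
    have "1 - exp (- (\<integral>s. \<Psi> (z * g s) \<partial>lborel)) \<le> (\<integral>s. \<Psi> (z * g s) \<partial>lborel)"
      using exp_ge_add_one_self[of "- (\<integral>s. \<Psi> (z * g s) \<partial>lborel)"] by linarith
    also have "\<dots> \<le> K * enn2real (apow \<alpha> (\<lambda>s. z * g s))"
      by (rule Psi_integrable(2)[OF La_scale[OF g]])
    also have "\<dots> = K * enn2real (apow \<alpha> g) * norm z powr \<alpha>"
      by (subst apow_scale) (auto simp: enn2real_mult)
    finally show "1 - Re (chf P (\<lambda>\<omega>. z * Y \<omega>)) \<le> K * enn2real (apow \<alpha> g) * norm z powr \<alpha>"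
      by (simp add: isI_chf[OF Y])
  qed simp
  then show ?thesis by (simp add: ac_simps)
qed

lemma isI_zero_AE:
  assumes "isI g Y" "apow \<alpha> g = 0"
  shows "AE \<omega> in P. Y \<omega> = 0"
  using isI_tail[OF assms(1)] assms(2)
  by (intro AE_zero_if_tails_zero[OF prob_P isI_meas[OF assms(1)]]) (simp add: measure_le_0_iff)

lemma isI_unique:
  assumes "isI g X" "isI g Y"
  shows "AE \<omega> in P. X \<omega> = Y \<omega>"
  using isI_zero_AE[OF isI_diff[OF assms]] alpha by (simp add: apow_def)

lemma isI_tendsto:
  assumes "\<And>n. isI (G n) (Y n)" "isI g Z" "(\<lambda>n. apow \<alpha> (\<lambda>s. G n s - g s)) \<longlonglongrightarrow> 0"
  shows "tendsto_in_prob P Y Z sequentially"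
proof (rule tendsto_in_prob_if_bounded)
  show "\<P>(\<omega> in P. dist (Y n \<omega>) (Z \<omega>) > e) \<le> (48 * K * e powr (-\<alpha>)) * enn2real (apow \<alpha> (\<lambda>s. G n s - g s))"
    if "0 < e" for n e
    unfolding dist_norm by (rule isI_tail[OF isI_diff[OF assms(1,2)] that])
  show "(\<lambda>n. enn2real (apow \<alpha> (\<lambda>s. G n s - g s))) \<longlonglongrightarrow> 0"
    using tendsto_enn2real[of _ 0] assms(3) by simp
qed

text \<open>
  Approximate \<open>g\<close> by step functions at the rate \<open>8^(-n)\<close>. Consecutive integrals then differ by more
  than \<open>2^(-n)\<close> with probability of order \<open>2^(\<alpha> n) 8^(-n) \<le> 2^(-n)\<close>, so they converge almost surely by
  the Borel-Cantelli lemma.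
\<close>
lemma isI_exists:
  assumes g: "La g"
  shows "\<exists>Y. isI g Y"
proof -
  note [measurable] = La_meas[OF g]
  obtain J w where J: "\<And>n. finite (J n)" "\<And>n. apow \<alpha> (\<lambda>s. stepf (J n) (w n) s - g s) < ennreal ((1/8) ^ n)"
    using step_approx_seq[OF step_approx_La[OF alpha La_meas[OF g]], of "1/8"] g unfolding La_def by auto
  define X where "X n = stepI (J n) (w n)" for n
  have [measurable]: "X n \<in> borel_measurable P" for n unfolding X_def by measurable
  have X: "isI (stepf (J n) (w n)) (X n)" for n unfolding X_def by (rule isI_stepI[OF J(1)])
  have inc: "enn2real (apow \<alpha> (\<lambda>s. stepf (J (Suc n)) (w (Suc n)) s - stepf (J n) (w n) s)) \<le> 8 * (1/8)^n" for n
  proof -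
    have "apow \<alpha> (\<lambda>s. stepf (J (Suc n)) (w (Suc n)) s - stepf (J n) (w n) s) =
        apow \<alpha> (\<lambda>s. (stepf (J (Suc n)) (w (Suc n)) s - g s) + (g s - stepf (J n) (w n) s))" by simp
    also have "\<dots> \<le> 4 * (apow \<alpha> (\<lambda>s. stepf (J (Suc n)) (w (Suc n)) s - g s) + apow \<alpha> (\<lambda>s. g s - stepf (J n) (w n) s))"
      by (rule apow_add_le[OF alpha]) auto
    also have "\<dots> \<le> 4 * (ennreal ((1/8)^n) + ennreal ((1/8)^n))"
    proof (intro mult_left_mono add_mono)
      have "apow \<alpha> (\<lambda>s. stepf (J (Suc n)) (w (Suc n)) s - g s) \<le> ennreal ((1/8)^Suc n)"
        using J(2)[of "Suc n"] by simp
      also have "\<dots> \<le> ennreal ((1/8)^n)" by (intro ennreal_leI power_decreasing) auto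
      finally show "apow \<alpha> (\<lambda>s. stepf (J (Suc n)) (w (Suc n)) s - g s) \<le> ennreal ((1/8)^n)" .
      show "apow \<alpha> (\<lambda>s. g s - stepf (J n) (w n) s) \<le> ennreal ((1/8)^n)"
        using J(2)[of n] by (subst apow_minus) simp
    qed simp
    also have "\<dots> = ennreal (8 * (1/8)^n)"
    proof -
      have "ennreal (8 * (1/8)^n) = ennreal (4 * ((1/8)^n + (1/8)^n))" by simp
      also have "\<dots> = ennreal 4 * ennreal ((1/8)^n + (1/8)^n)" by (rule ennreal_mult) auto
      also have "ennreal ((1/8)^n + (1/8)^n) = ennreal ((1/8)^n) + ennreal ((1/8)^n)" by (rule ennreal_plus) auto
      finally show ?thesis by simp
    qed
    finally show ?thesis by (intro enn2real_leI) auto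
  qed
  have bc: "\<P>(\<omega> in P. norm (X (Suc n) \<omega> - X n \<omega>) > (1/2)^n) \<le> (48 * K * 8) * (1/2)^n" for n
  proof -
    have "\<P>(\<omega> in P. norm (X (Suc n) \<omega> - X n \<omega>) > (1/2)^n) \<le> (48 * K * ((1/2)^n) powr (-\<alpha>)) * (8 * (1/8)^n)"
    proof (rule order_trans[OF isI_tail[OF isI_diff[OF X X]] mult_left_mono[OF inc]])
      show "0 \<le> 48 * K * ((1/2)^n) powr (-\<alpha>)" using K_nonneg by simp
    qed simp
    also have "((1/2)^n) powr (-\<alpha>) \<le> 4 ^ n"
    proof -
      have "((1/2::real)^n) powr (-\<alpha>) = (2^n) powr \<alpha>"
        by (simp add: powr_minus powr_divide power_one_over)
      also have "\<dots> \<le> (2^n) powr 2" using alpha by (intro powr_mono) auto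
      also have "\<dots> = 4 ^ n" by (simp add: powr_numeral power_mult[symmetric] mult.commute[of n] power_mult)
      finally show ?thesis .
    qed
    then have "(48 * K * ((1/2)^n) powr (-\<alpha>)) * (8 * (1/8)^n) \<le> (48 * K * 4^n) * (8 * (1/8)^n)"
      using K_nonneg by (intro mult_right_mono mult_left_mono) auto
    also have "\<dots> = (48 * K * 8) * (1/2)^n"
    proof -
      have "(4::real)^n * (1/8)^n = (1/2)^n" by (simp flip: power_mult_distrib)
      then show ?thesis by (simp add: mult.assoc mult.left_commute)
    qed
    finally show ?thesis .
  qed
  have "AE \<omega> in P. eventually (\<lambda>n. \<omega> \<in> space P - {\<omega> \<in> space P. norm (X (Suc n) \<omega> - X n \<omega>) > (1/2)^n}) sequentially"
  proof (rule borel_cantelli_AE1)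
    show "summable (\<lambda>n. \<P>(\<omega> in P. norm (X (Suc n) \<omega> - X n \<omega>) > (1/2)^n))"
      by (rule summable_comparison_test'[where g="\<lambda>n. (48 * K * 8) * (1/2)^n" and N=0]) (use bc in \<open>auto intro!: summable_mult summable_geometric\<close>)
  qed (auto simp: less_top[symmetric])
  then have cv: "AE \<omega> in P. (\<lambda>n. X n \<omega>) \<longlonglongrightarrow> lim (\<lambda>n. X n \<omega>)"
  proof eventually_elim
    case (elim \<omega>)
    then obtain N where N: "\<And>n. n \<ge> N \<Longrightarrow> norm (X (Suc n) \<omega> - X n \<omega>) \<le> (1/2)^n"
      by (auto simp: eventually_sequentially not_less)
    have "summable (\<lambda>n. X (Suc n) \<omega> - X n \<omega>)"
      by (rule summable_comparison_test'[where g="\<lambda>n. (1/2)^n" and N=N]) (use N in \<open>auto intro: summable_geometric\<close>)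
    from tendsto_add[OF summable_LIMSEQ[OF this] tendsto_const[of "X 0 \<omega>"]]
    have "convergent (\<lambda>n. X n \<omega>)" unfolding sum_lessThan_telescope[of "\<lambda>n. X n \<omega>"] by (auto simp: convergent_def)
    then show ?case by (simp add: convergent_LIMSEQ_iff)
  qed
  define Y where "Y \<omega> = lim (\<lambda>n. X n \<omega>)" for \<omega>
  have [measurable]: "Y \<in> borel_measurable P" unfolding Y_def by measurable
  have "tendsto_in_prob P X Y sequentially"
    using cv unfolding Y_def[symmetric] by (intro tendsto_in_prob_if_AE prob_P) auto
  moreover have "(\<lambda>n. apow \<alpha> (\<lambda>s. stepf (J n) (w n) s - g s)) \<longlonglongrightarrow> 0"
  proof (rule tendsto_sandwich[OF _ _ tendsto_const])
    have "(\<lambda>n. ennreal ((1/8) ^ n)) \<longlonglongrightarrow> ennreal 0"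
      by (intro tendsto_ennrealI LIMSEQ_realpow_zero) auto
    then show "(\<lambda>n. ennreal ((1/8) ^ n)) \<longlonglongrightarrow> 0" by simp
  qed (auto intro!: always_eventually less_imp_le J)
  ultimately show ?thesis
    unfolding isI_def X_def using g J(1) by (intro exI[of _ Y]) auto
qed

lemma isI_increment:
  assumes "s < t"
  shows "isI (indicator {s<..t}) (\<lambda>\<omega>. L t \<omega> - L s \<omega>)"
proof -
  have "stepI {s, t} (\<lambda>u. if u = t then 1 else -1) = (\<lambda>\<omega>. L t \<omega> - L s \<omega>)"
    using assms by (auto simp: stepI_def)
  moreover have "stepf {s, t} (\<lambda>u. if u = t then 1 else -1) = indicator {s<..t}"
    using indicator_Ioc_stepf[OF assms] by auto
  ultimately show ?thesis using isI_stepI[of "{s,t}" "\<lambda>u. if u = t then 1 else -1"] by simp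
qed

end

section \<open>A gliding hump argument\<close>

text \<open>
  Suppose that the total masses of the measures with densities \<open>f n\<close> do not tend to \<open>0\<close>. Since
  \<open>f n\<close> tends to \<open>0\<close> almost everywhere, nearly all of a mass that stays above \<open>d\<close> sits on the set \<open>E n\<close>
  where \<open>f n\<close> exceeds a fixed small integrable function, and these sets escape: each fixed measure gives
  them vanishing mass. Along a sparse subsequence the humps are therefore almost disjoint. A set \<open>A\<close> that
  collects every other hump receives a large mass at even indices and a small one at odd indices, which
  contradicts convergence over \<open>A\<close>.
\<close>
lemma gliding_hump:
  fixes f :: "nat \<Rightarrow> real \<Rightarrow> real"
  assumes [measurable]: "\<And>n. f n \<in> borel_measurable borel" and nn: "\<And>n s. 0 \<le> f n s"
    and int: "\<And>n. integrable lborel (f n)"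
    and lim: "AE s in lborel. (\<lambda>n. f n s) \<longlonglongrightarrow> 0"
    and conv: "\<And>A. A \<in> sets borel \<Longrightarrow> convergent (\<lambda>n. exp (- (\<integral>s. f n s * indicator A s \<partial>lborel)))"
  shows "(\<lambda>n. \<integral>s. f n s \<partial>lborel) \<longlonglongrightarrow> 0"
proof (rule ccontr)
  assume "\<not> ?thesis"
  then obtain d where d: "0 < d" "\<And>m. \<exists>n\<ge>m. \<not> \<bar>\<integral>s. f n s \<partial>lborel\<bar> < d"
    unfolding LIMSEQ_iff by auto
  define \<mu> where "\<mu> n = density lborel (\<lambda>s. ennreal (f n s))" for n
  have [measurable_cong, simp]: "sets (\<mu> n) = sets borel" and [simp]: "space (\<mu> n) = UNIV" for n
    by (simp_all add: \<mu>_def)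
  have mu: "measure (\<mu> n) A = (\<integral>s. f n s * indicator A s \<partial>lborel)"
    and iA: "integrable lborel (\<lambda>s. f n s * indicator A s)"
    and fin: "emeasure (\<mu> n) A < \<infinity>" if [measurable]: "A \<in> sets borel" for A n
  proof -
    show i: "integrable lborel (\<lambda>s. f n s * indicator A s)"
      by (rule integrable_real_mult_indicator[OF _ int]) simp
    have e: "emeasure (\<mu> n) A = ennreal (\<integral>s. f n s * indicator A s \<partial>lborel)"
    proof -
      have "emeasure (\<mu> n) A = (\<integral>\<^sup>+s. ennreal (f n s * indicator A s) \<partial>lborel)"
        unfolding \<mu>_def by (subst emeasure_density) (auto intro!: nn_integral_cong simp: indicator_def)
      also have "\<dots> = ennreal (\<integral>s. f n s * indicator A s \<partial>lborel)"
        using nn i by (intro nn_integral_eq_integral) auto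
      finally show ?thesis .
    qed
    show "emeasure (\<mu> n) A < \<infinity>" using e by simp
    show "measure (\<mu> n) A = (\<integral>s. f n s * indicator A s \<partial>lborel)"
      using nn by (simp add: measure_def e)
  qed
  interpret \<mu>: finite_measure "\<mu> n" for n
    by standard (use fin[of UNIV n] in auto)
  have big: "\<exists>n\<ge>m. d \<le> measure (\<mu> n) UNIV" for m
    using d(2)[of m] nn mu[of UNIV] by (auto simp: not_less abs_of_nonneg)
  define \<eta> where "\<eta> = d / 8"
  have \<eta>: "0 < \<eta>" using d by (simp add: \<eta>_def)
  \<comment> \<open>Any strictly positive integrable function of total mass \<open>\<eta>\<close> would do in place of the multiple of the
    normal density.\<close>
  define E where "E n = {s. f n s > \<eta> * std_normal_density s}" for n
  have [measurable]: "E n \<in> sets borel" for n unfolding E_def by measurable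
  have offE: "measure (\<mu> n) (UNIV - E n) \<le> \<eta>" for n
  proof -
    have "measure (\<mu> n) (UNIV - E n) \<le> (\<integral>s. \<eta> * std_normal_density s \<partial>lborel)"
      unfolding mu[of "UNIV - E n" n, simplified]
      using integrable_normal_density[of 1 0] \<eta> nn
      by (intro integral_mono iA) (auto simp: E_def indicator_def not_less normal_density_nonneg)
    also have "\<dots> = \<eta>" using integral_normal_density[of 1 0] by simp
    finally show ?thesis .
  qed
  have van: "(\<lambda>n. measure (\<mu> j) (E n)) \<longlonglongrightarrow> 0" for j
  proof -
    have "(\<lambda>n. \<integral>s. f j s * indicator (E n) s \<partial>lborel) \<longlonglongrightarrow> (\<integral>s. 0 \<partial>(lborel :: real measure))"
    proof (rule integral_dominated_convergence[where w="f j"])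
      show "AE s in lborel. (\<lambda>n. f j s * indicator (E n) s) \<longlonglongrightarrow> 0"
        using lim
      proof eventually_elim
        case (elim s)
        have "0 < \<eta> * std_normal_density s" using \<eta> by (simp add: normal_density_pos)
        then have "\<forall>\<^sub>F n in sequentially. f n s < \<eta> * std_normal_density s"
          by (rule order_tendstoD(2)[OF elim])
        then have "\<forall>\<^sub>F n in sequentially. f j s * indicator (E n) s = 0"
          by eventually_elim (simp add: E_def)
        then show ?case by (rule tendsto_eventually)
      qed
    qed (use int nn in \<open>auto simp: indicator_def\<close>)
    then show ?thesis using mu by simp
  qed
  have "\<exists>n>m. d \<le> measure (\<mu> n) UNIV \<and> (\<forall>j\<le>m. measure (\<mu> j) (E n) < \<eta> * (1/2)^(Suc m))" for m
  proof -
    have "\<forall>\<^sub>F n in sequentially. \<forall>j\<in>{..m}. measure (\<mu> j) (E n) < \<eta> * (1/2)^(Suc m)"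
      by (intro eventually_ball_finite ballI order_tendstoD(2)[OF van]) (use \<eta> in auto)
    then obtain n0 where n0: "\<And>n j. n \<ge> n0 \<Longrightarrow> j \<le> m \<Longrightarrow> measure (\<mu> j) (E n) < \<eta> * (1/2)^(Suc m)"
      by (auto simp: eventually_sequentially)
    from big[of "max n0 (Suc m)"] show ?thesis using n0 by (auto simp: Suc_le_eq)
  qed
  then obtain N where N: "\<And>m. N m > m" "\<And>m. d \<le> measure (\<mu> (N m)) UNIV"
      "\<And>m j. j \<le> m \<Longrightarrow> measure (\<mu> j) (E (N m)) < \<eta> * (1/2)^(Suc m)" by metis
  \<comment> \<open>The sparse subsequence: each hump is small for all the measures chosen before it.\<close>
  define n where "n k = (N ^^ Suc k) 0" for k
  have nS: "n (Suc k) = N (n k)" for k by (simp add: n_def)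
  have sm: "strict_mono n" by (rule strict_monoI_Suc) (simp add: nS N)
  have nd: "d \<le> measure (\<mu> (n k)) UNIV" for k unfolding n_def using N(2) by simp
  have small: "measure (\<mu> (n k)) (E (n (Suc i))) \<le> \<eta> * (1/2)^(Suc i)" if "k \<le> i" for i k
  proof -
    have "n k \<le> n i" using sm that by (simp add: strict_mono_less_eq)
    then have "measure (\<mu> (n k)) (E (n (Suc i))) \<le> \<eta> * (1/2)^(Suc (n i))"
      using N(3)[of "n k" "n i"] by (simp add: nS)
    also have "\<dots> \<le> \<eta> * (1/2)^(Suc i)"
      using \<eta> seq_suble[OF sm, of i] by (intro mult_left_mono power_decreasing) auto
    finally show ?thesis .
  qed
  \<comment> \<open>All the humps after the \<open>k\<close>-th one; they are negligible for the \<open>k\<close>-th measure.\<close>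
  define U where "U k = (\<Union>i. E (n (Suc (k + i))))" for k
  have [measurable]: "U k \<in> sets borel" for k unfolding U_def by measurable
  have Usmall: "measure (\<mu> (n k)) (U k) \<le> \<eta>" for k
  proof -
    have le: "measure (\<mu> (n k)) (E (n (Suc (k + i)))) \<le> \<eta> * (1/2)^(Suc i)" for i
      by (rule order_trans[OF small[of k "k+i"]]) (use \<eta> in \<open>auto intro!: mult_left_mono power_decreasing\<close>)
    have sg: "(\<lambda>i. \<eta> * (1/2)^(Suc i)) sums \<eta>"
      using sums_mult[OF power_half_series, of \<eta>] by simp
    have su: "summable (\<lambda>i. measure (\<mu> (n k)) (E (n (Suc (k + i)))))"
      by (rule summable_comparison_test'[OF sums_summable[OF sg], of 0]) (use le in auto)
    have "measure (\<mu> (n k)) (U k) \<le> (\<Sum>i. measure (\<mu> (n k)) (E (n (Suc (k + i)))))"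
      unfolding U_def by (intro \<mu>.finite_measure_subadditive_countably su) auto
    also have "\<dots> \<le> (\<Sum>i. \<eta> * (1/2)^(Suc i))" by (intro suminf_le su sums_summable[OF sg] le)
    also have "\<dots> = \<eta>" using sg by (simp add: sums_iff)
    finally show ?thesis .
  qed
  define A where "A = (\<Union>k. E (n (2*k)) - U (2*k))"
  have [measurable]: "A \<in> sets borel" unfolding A_def by measurable
  have inU: "s \<in> U k" if "s \<in> E (n j)" "k < j" for s k j
    using that less_imp_Suc_add[of k j] by (auto simp: U_def)
  have even_big: "6 * \<eta> \<le> measure (\<mu> (n (2*k))) A" for k
  proof -
    let ?m = "\<mu> (n (2*k))"
    have "measure ?m UNIV \<le> measure ?m (A \<union> ((UNIV - E (n (2*k))) \<union> U (2*k)))"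
      by (intro \<mu>.finite_measure_mono) (auto simp: A_def)
    also have "\<dots> \<le> measure ?m A + (measure ?m (UNIV - E (n (2*k))) + measure ?m (U (2*k)))"
      by (rule order_trans[OF measure_Un_le add_left_mono[OF measure_Un_le]]) auto
    finally show ?thesis using nd[of "2*k"] offE[of "n (2*k)"] Usmall[of "2*k"] by (simp add: \<eta>_def)
  qed
  have odd_small: "measure (\<mu> (n (2*k+1))) A \<le> 2 * \<eta>" for k
  proof -
    let ?m = "\<mu> (n (2*k+1))"
    have "A \<subseteq> (UNIV - E (n (2*k+1))) \<union> U (2*k+1)"
    proof
      fix s assume "s \<in> A"
      then obtain j where j: "s \<in> E (n (2*j))" "s \<notin> U (2*j)" by (auto simp: A_def)
      show "s \<in> (UNIV - E (n (2*k+1))) \<union> U (2*k+1)"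
      proof (cases "2*j < 2*k+1")
        case True
        then show ?thesis using inU[of s "2*k+1" "2*j"] j by auto
      next
        case False
        then have "2*k+1 < 2*j" by presburger
        then show ?thesis using inU[of s "2*j" "2*k+1"] j by auto
      qed
    qed
    then have "measure ?m A \<le> measure ?m ((UNIV - E (n (2*k+1))) \<union> U (2*k+1))"
      by (intro \<mu>.finite_measure_mono) auto
    also have "\<dots> \<le> measure ?m (UNIV - E (n (2*k+1))) + measure ?m (U (2*k+1))"
      by (rule measure_Un_le) auto
    finally show ?thesis using offE[of "n (2*k+1)"] Usmall[of "2*k+1"] by simp
  qed
  obtain l where l: "(\<lambda>n. exp (- measure (\<mu> n) A)) \<longlonglongrightarrow> l"
    using conv[of A] mu[of A] by (auto simp: convergent_def)
  have "(\<lambda>k. exp (- measure (\<mu> (n (2*k))) A)) \<longlonglongrightarrow> l"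
    using LIMSEQ_subseq_LIMSEQ[OF l, of "\<lambda>k. n (2*k)"] sm by (auto simp: strict_mono_def comp_def)
  then have 1: "l \<le> exp (- (6 * \<eta>))"
    by (rule LIMSEQ_le_const2) (use even_big in auto)
  have "(\<lambda>k. exp (- measure (\<mu> (n (2*k+1))) A)) \<longlonglongrightarrow> l"
    using LIMSEQ_subseq_LIMSEQ[OF l, of "\<lambda>k. n (2*k+1)"] sm by (auto simp: strict_mono_def comp_def)
  then have 2: "exp (- (2 * \<eta>)) \<le> l"
    by (rule LIMSEQ_le_const) (use odd_small in auto)
  from 1 2 have "exp (- (2 * \<eta>)) \<le> exp (- (6 * \<eta>))" by linarith
  then show False using \<eta> by simp
qed

section \<open>A maximal inequality for symmetric sums\<close>

text \<open>
  Reflection. Let \<open>j\<close> be the first index at which a partial sum leaves the ball. As \<open>2 S_j\<close> is the sum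
  of \<open>S_n\<close> and of the reflected value \<open>2 S_j - S_n\<close>, one of these two is outside of the ball as well;
  changing the signs of the summands from \<open>j\<close> on exchanges the two without changing the joint law.
\<close>
lemma levy_maximal_inequality:
  fixes X :: "nat \<Rightarrow> 'a \<Rightarrow> complex"
  assumes P: "prob_space P" and [measurable]: "\<And>k. X k \<in> borel_measurable P"
    and flip: "\<And>k. k \<le> n \<Longrightarrow>
      distr P borel (padded n (\<lambda>i \<omega>. if i < k then X i \<omega> else - X i \<omega>)) = distr P borel (padded n X)"
  shows "\<P>(\<omega> in P. \<exists>j\<le>n. norm (\<Sum>i<j. X i \<omega>) > e) \<le> 2 * \<P>(\<omega> in P. norm (\<Sum>i<n. X i \<omega>) > e)"
proof -
  interpret prob_space P by fact
  define S where "S j \<omega> = (\<Sum>i<j. X i \<omega>)" for j \<omega>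
  have [measurable]: "S j \<in> borel_measurable P" for j unfolding S_def by measurable
  \<comment> \<open>The event that \<open>j\<close> is the first exit time, and its counterpart \<open>B j\<close> on the space of paths, which also
    records that the final sum lies outside.\<close>
  define E where "E j = {\<omega> \<in> space P. norm (S j \<omega>) > e \<and> (\<forall>i<j. norm (S i \<omega>) \<le> e)}" for j
  have [measurable]: "E j \<in> sets P" for j unfolding E_def by measurable
  define B where "B j = {x :: nat \<Rightarrow> complex. norm (\<Sum>i<j. x i) > e \<and> (\<forall>i<j. norm (\<Sum>l<i. x l) \<le> e) \<and> norm (\<Sum>i<n. x i) > e}" for j
  have [measurable]: "(\<lambda>x :: nat \<Rightarrow> complex. x i) \<in> borel_measurable borel" for i
    by (intro borel_measurable_continuous_onI) auto
  have B[measurable]: "B j \<in> sets borel" for j unfolding B_def by measurable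
  define Fj where "Fj j = E j \<inter> {\<omega> \<in> space P. norm (S n \<omega>) > e}" for j
  have [measurable]: "Fj j \<in> sets P" for j unfolding Fj_def by measurable
  have step: "measure P (E j) \<le> 2 * measure P (Fj j)" if "j \<le> n" for j
  proof -
    define X' where "X' i \<omega> = (if i < j then X i \<omega> else - X i \<omega>)" for i \<omega>
    have [measurable]: "X' i \<in> borel_measurable P" for i unfolding X'_def by (cases "i < j") auto
    have s1: "(\<Sum>l<i. padded n X \<omega> l) = S i \<omega>" if "i \<le> n" for i \<omega>
      unfolding S_def padded_def using that by (intro sum.cong) auto
    have s2: "(\<Sum>l<i. padded n X' \<omega> l) = S i \<omega>" if "i \<le> j" for i \<omega>
      unfolding S_def padded_def X'_def using that \<open>j \<le> n\<close> by (intro sum.cong) auto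
    have s3: "(\<Sum>l<n. padded n X' \<omega> l) = 2 * S j \<omega> - S n \<omega>" for \<omega>
    proof -
      have un: "{..<n} = {..<j} \<union> {j..<n}" using \<open>j \<le> n\<close> by auto
      have "(\<Sum>l<n. padded n X' \<omega> l) = (\<Sum>l<j. X l \<omega>) + (\<Sum>l=j..<n. - X l \<omega>)"
        unfolding un by (subst sum.union_disjoint) (auto intro!: arg_cong2[where f="(+)"] sum.cong simp: padded_def X'_def intro: less_le_trans[OF _ \<open>j \<le> n\<close>])
      moreover have "S n \<omega> = (\<Sum>l<j. X l \<omega>) + (\<Sum>l=j..<n. X l \<omega>)"
        unfolding S_def un by (subst sum.union_disjoint) auto
      ultimately show ?thesis by (simp add: S_def sum_negf)
    qed
    have m1: "measure P (Fj j) = measure (distr P borel (padded n X)) (B j)"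
      using that by (subst measure_distr) (auto intro!: arg_cong[where f="measure P"] simp: Fj_def E_def B_def s1)
    have m2: "measure P (E j \<inter> {\<omega> \<in> space P. norm (2 * S j \<omega> - S n \<omega>) > e}) = measure (distr P borel (padded n X')) (B j)"
      by (subst measure_distr) (auto intro!: arg_cong[where f="measure P"] simp: E_def B_def s2 s3)
    have m12: "measure P (E j \<inter> {\<omega> \<in> space P. norm (2 * S j \<omega> - S n \<omega>) > e}) = measure P (Fj j)"
      unfolding m1 m2 using flip[OF that] unfolding X'_def by simp
    have "E j \<subseteq> Fj j \<union> (E j \<inter> {\<omega> \<in> space P. norm (2 * S j \<omega> - S n \<omega>) > e})"
    proof
      fix \<omega> assume w: "\<omega> \<in> E j"
      have "2 * norm (S j \<omega>) = norm (S n \<omega> + (2 * S j \<omega> - S n \<omega>))" by (simp add: norm_mult)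
      also have "\<dots> \<le> norm (S n \<omega>) + norm (2 * S j \<omega> - S n \<omega>)" by (rule norm_triangle_ineq)
      finally show "\<omega> \<in> Fj j \<union> (E j \<inter> {\<omega> \<in> space P. norm (2 * S j \<omega> - S n \<omega>) > e})"
        using w by (auto simp: E_def Fj_def)
    qed
    then have "measure P (E j) \<le> measure P (Fj j \<union> (E j \<inter> {\<omega> \<in> space P. norm (2 * S j \<omega> - S n \<omega>) > e}))"
      by (intro finite_measure_mono) auto
    also have "\<dots> \<le> measure P (Fj j) + measure P (E j \<inter> {\<omega> \<in> space P. norm (2 * S j \<omega> - S n \<omega>) > e})"
      by (rule measure_Un_le) auto
    finally show ?thesis using m12 by simp
  qed
  have "{\<omega> \<in> space P. \<exists>j\<le>n. norm (S j \<omega>) > e} \<subseteq> (\<Union>j\<le>n. E j)"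
  proof
    fix \<omega> assume w: "\<omega> \<in> {\<omega> \<in> space P. \<exists>j\<le>n. norm (S j \<omega>) > e}"
    then obtain j where j: "j \<le> n" "norm (S j \<omega>) > e" by auto
    define i where "i = (LEAST i. norm (S i \<omega>) > e)"
    have "norm (S i \<omega>) > e" unfolding i_def using j(2) by (rule LeastI)
    moreover have "i \<le> j" unfolding i_def using j(2) by (rule Least_le)
    moreover have "\<forall>l<i. norm (S l \<omega>) \<le> e" unfolding i_def using not_less_Least not_less by blast
    ultimately show "\<omega> \<in> (\<Union>j\<le>n. E j)" using j w by (auto simp: E_def)
  qed
  then have "\<P>(\<omega> in P. \<exists>j\<le>n. norm (S j \<omega>) > e) \<le> measure P (\<Union>j\<le>n. E j)"
    by (intro finite_measure_mono) auto
  also have "\<dots> \<le> (\<Sum>j\<le>n. measure P (E j))" by (rule measure_UNION_le) auto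
  also have "\<dots> \<le> (\<Sum>j\<le>n. 2 * measure P (Fj j))" by (intro sum_mono step) auto
  also have "\<dots> = 2 * measure P (\<Union>j\<le>n. Fj j)"
  proof -
    have "disjoint_family_on Fj {..n}"
      unfolding disjoint_family_on_def
    proof (intro ballI impI)
      fix a b :: nat assume "a \<noteq> b"
      then show "Fj a \<inter> Fj b = {}"
        by (cases a b rule: linorder_cases) (auto simp: Fj_def E_def not_le dest: spec)
    qed
    then show ?thesis by (subst finite_measure_finite_Union) (auto simp: sum_distrib_left)
  qed
  also have "\<dots> \<le> 2 * \<P>(\<omega> in P. norm (S n \<omega>) > e)"
    by (intro mult_left_mono finite_measure_mono) (auto simp: Fj_def)
  finally show ?thesis unfolding S_def .
qed

section \<open>The random measure of a Levy process\<close>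

lemma chf_minus:
  assumes "Y \<in> borel_measurable P"
  shows "chf P (\<lambda>\<omega>. - Y \<omega>) = cnj (chf P Y)"
  unfolding chf_def by (simp flip: cis_cnj)

lemma chf_PiM_iid_sum:
  assumes "prob_space \<rho>" "sets \<rho> = sets borel"
  shows "chf (Pi\<^sub>M {..<n::nat} (\<lambda>_. \<rho>)) (\<lambda>x. z * (\<Sum>i<n. x i)) = chf \<rho> (\<lambda>x. z * x) ^ n"
  using chf_PiM_sum[of "{..<n}" "\<lambda>_. \<rho>" "\<lambda>_. z"] assms by (simp add: sum_distrib_left)

text \<open>
  Independence only involves finitely many indices at a time.
\<close>
lemma indep_vars_UNIV_if_initial:
  assumes P: "prob_space P" and [measurable]: "\<And>i::nat. Y i \<in> borel_measurable P"
    and ind: "\<And>n. prob_space.indep_vars P (\<lambda>_. borel) Y {..<n}"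
  shows "prob_space.indep_vars P (\<lambda>_. borel) Y UNIV"
proof -
  interpret prob_space P by fact
  have "indep_sets (\<lambda>i. {Y i -` A \<inter> space P |A. A \<in> sets borel}) UNIV"
  proof (subst indep_sets_finite_index_sets, intro allI impI)
    fix J :: "nat set" assume J: "J \<subseteq> UNIV" "J \<noteq> {}" "finite J"
    then obtain n where "J \<subseteq> {..<n}" using finite_nat_bounded by blast
    then show "indep_sets (\<lambda>i. {Y i -` A \<inter> space P |A. A \<in> sets borel}) J"
      using ind[of n] unfolding indep_vars_def2 by (blast intro: indep_sets_mono_index)
  qed
  then show ?thesis unfolding indep_vars_def2 by auto
qed

text \<open>
  The constant sequence \<open>M {}, M {}, ...\<close> is almost surely summable.
\<close>
lemma irm_empty:
  assumes "indep_scattered_id_measure P M"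
  shows "AE \<omega> in P. M {} \<omega> = 0"
proof -
  have "AE \<omega> in P. (\<lambda>n::nat. M {} \<omega>) sums M (\<Union>n::nat. {}) \<omega>"
    using assms unfolding indep_scattered_id_measure_def
    by (auto simp: disjoint_family_on_def dest!: conjunct2 spec[of _ "\<lambda>_. {}"])
  then show ?thesis
    by eventually_elim (auto dest!: sums_summable summable_LIMSEQ_zero simp: LIMSEQ_const_iff)
qed

lemma irm_sums:
  assumes "indep_scattered_id_measure P M" "\<And>n::nat. A n \<in> sets borel" "\<And>n. bounded (A n)"
    "disjoint_family A" "bounded (\<Union>n. A n)"
  shows "AE \<omega> in P. (\<lambda>n. M (A n) \<omega>) sums M (\<Union>n. A n) \<omega>"
  using assms unfolding indep_scattered_id_measure_def by blast

lemma irm_additive: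
  assumes M: "indep_scattered_id_measure P M"
    and A: "A \<in> sets borel" "bounded A" "B \<in> sets borel" "bounded B" "A \<inter> B = {}"
  shows "AE \<omega> in P. M (A \<union> B) \<omega> = M A \<omega> + M B \<omega>"
proof -
  have "AE \<omega> in P. (\<lambda>n. M (binaryset A B n) \<omega>) sums M (\<Union>n. binaryset A B n) \<omega>"
  proof (rule irm_sums[OF M])
    show "disjoint_family (binaryset A B)"
      using A(5) by (auto simp: disjoint_family_on_def binaryset_def)
    show "bounded (\<Union>n. binaryset A B n)" using A by (simp add: UN_binaryset_eq)
  qed (use A in \<open>auto simp: binaryset_def\<close>)
  with irm_empty[OF M] show ?thesis
  proof eventually_elim
    case (elim \<omega>)
    have "(\<lambda>n. M (binaryset A B n) \<omega>) sums (\<Sum>n\<in>{0,1}. M (binaryset A B n) \<omega>)"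
      using elim(1) by (intro sums_finite) (auto simp: binaryset_def)
    with elim(2) have "M (\<Union>n. binaryset A B n) \<omega> = (\<Sum>n\<in>{0,1}. M (binaryset A B n) \<omega>)"
      by (rule sums_unique2)
    then show ?case by (simp add: UN_binaryset_eq binaryset_def)
  qed
qed

context levy_noise
begin

text \<open>
  The characteristic function is real, and the sign change of the frequency conjugates it. Hence the
  noise is symmetric.
\<close>
lemma Psi_minus: "\<Psi> (- z) = \<Psi> z"
proof -
  have "chf P (\<lambda>\<omega>. - z * L 1 \<omega>) = cnj (chf P (\<lambda>\<omega>. z * L 1 \<omega>))"
    using chf_minus[of "\<lambda>\<omega>. z * L 1 \<omega>" P] by simp
  then have "complex_of_real (exp (- 1 * \<Psi> (- z))) = cnj (complex_of_real (exp (- 1 * \<Psi> z)))"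
    by (simp only: chf_L[OF zero_le_one])
  then show ?thesis unfolding complex_cnj_complex_of_real of_real_eq_iff by simp
qed

lemma isI_disjoint_chf:
  assumes "finite I" and A: "\<And>i. i \<in> I \<Longrightarrow> A i \<in> sets borel" "\<And>i. i \<in> I \<Longrightarrow> bounded (A i)"
    and dis: "disjoint_family_on A I" and Y: "\<And>i. i \<in> I \<Longrightarrow> isI (indicator (A i)) (Y i)"
  shows "chf P (\<lambda>\<omega>. \<Sum>i\<in>I. w i * Y i \<omega>) = of_real (exp (- (\<Sum>i\<in>I. measure lborel (A i) * \<Psi> (w i))))"
proof -
  have I: "isI (\<lambda>s. \<Sum>i\<in>I. w i * indicator (A i) s) (\<lambda>\<omega>. \<Sum>i\<in>I. w i * Y i \<omega>)"
    by (rule isI_sum[OF \<open>finite I\<close> Y])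
  have "(\<integral>s. \<Psi> (\<Sum>i\<in>I. w i * indicator (A i) s) \<partial>lborel) = (\<Sum>i\<in>I. measure lborel (A i) * \<Psi> (w i))"
    using assms Psi_0 by (intro disjoint_indicator_sum_integral)
  then show ?thesis using isI_chf[OF I, of 1] by simp
qed

text \<open>
  A version of the random measure of \<open>L\<close>: on bounded Borel sets some integral of the indicator.
\<close>
definition M0 :: "real set \<Rightarrow> 'a \<Rightarrow> complex" where
  "M0 A = (SOME Y. isI (indicator A) Y)"

lemma M0_isI:
  assumes "A \<in> sets borel" "bounded A"
  shows "isI (indicator A) (M0 A)"
  unfolding M0_def by (rule someI_ex[OF isI_exists[OF La_indicator[OF assms]]])

lemma M0_meas:
  assumes "A \<in> sets borel" "bounded A"
  shows "M0 A \<in> borel_measurable P"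
  by (rule isI_meas[OF M0_isI[OF assms]])

lemma M0_chf:
  assumes "A \<in> sets borel" "bounded A"
  shows "chf P (\<lambda>\<omega>. z * M0 A \<omega>) = of_real (exp (- measure lborel A * \<Psi> z))"
  using isI_disjoint_chf[of "{()}" "\<lambda>_. A" "\<lambda>_. M0 A" "\<lambda>_. z"] M0_isI[OF assms] assms
  by (simp add: disjoint_family_on_def)

text \<open>
  \<open>M0 A\<close> has the law of \<open>L\<close> at the time \<open>measure lborel A\<close>, and the \<open>n\<close>-th root of that law is the law
  at an \<open>n\<close>-th of the time.
\<close>
lemma M0_infinitely_divisible:
  assumes A: "A \<in> sets borel" "bounded A"
  shows "infinitely_divisible (distr P borel (M0 A))"
  unfolding infinitely_divisible_def
proof (intro allI impI)
  fix n :: nat assume n: "1 \<le> n"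
  \<comment> \<open>The root of order \<open>n\<close> of the law of \<open>M0 A\<close>.\<close>
  define \<rho> where "\<rho> = distr P borel (L (measure lborel A / real n))"
  have \<rho>: "prob_space \<rho>" "sets \<rho> = sets borel"
    unfolding \<rho>_def by (auto intro: prob_space_distr)
  note \<rho>(2)[measurable_cong]
  note [measurable] = M0_meas[OF A]
  have pp: "prob_space (Pi\<^sub>M {..<n} (\<lambda>_. \<rho>))" by (intro prob_space_PiM \<rho>)
  have "distr P borel (M0 A) = distr (Pi\<^sub>M {..<n} (\<lambda>_. \<rho>)) borel (\<lambda>x. \<Sum>i<n. x i)"
  proof (rule distr_eq_if_chf_eq[OF prob_P pp])
    fix z
    have "chf \<rho> (\<lambda>x. z * x) = chf P (\<lambda>\<omega>. z * L (measure lborel A / real n) \<omega>)"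
      unfolding \<rho>_def by (subst chf_distr) auto
    also have "\<dots> = of_real (exp (- (measure lborel A / real n) * \<Psi> z))"
      by (rule chf_L) simp
    finally have "chf \<rho> (\<lambda>x. z * x) ^ n = of_real (exp (- (measure lborel A / real n) * \<Psi> z)) ^ n" by simp
    also have "\<dots> = of_real (exp (real n * (- (measure lborel A / real n) * \<Psi> z)))"
      by (simp only: exp_of_nat_mult of_real_power)
    also have "real n * (- (measure lborel A / real n) * \<Psi> z) = - measure lborel A * \<Psi> z"
      using n by simp
    finally show "chf P (\<lambda>\<omega>. z * M0 A \<omega>) = chf (Pi\<^sub>M {..<n} (\<lambda>_. \<rho>)) (\<lambda>x. z * (\<Sum>i<n. x i))"
      by (simp only: chf_PiM_iid_sum[OF \<rho>] M0_chf[OF A])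
  qed auto
  then show "\<exists>\<rho>. prob_space \<rho> \<and> sets \<rho> = sets borel \<and>
      distr P borel (M0 A) = distr (Pi\<^sub>M {..<n} (\<lambda>_. \<rho>)) borel (\<lambda>x. \<Sum>i<n. x i)"
    using \<rho> by blast
qed

lemma M0_indep:
  assumes A: "\<And>n::nat. A n \<in> sets borel" "\<And>n. bounded (A n)" and dis: "disjoint_family A"
  shows "prob_space.indep_vars P (\<lambda>_. borel) (\<lambda>n. M0 (A n)) UNIV"
proof (rule indep_vars_UNIV_if_initial[OF prob_P M0_meas[OF A]])
  fix n
  show "prob_space.indep_vars P (\<lambda>_. borel) (\<lambda>n. M0 (A n)) {..<n}"
  proof (rule indep_vars_if_chf_prod[OF prob_P _ M0_meas[OF A]])
    fix w
    have "chf P (\<lambda>\<omega>. \<Sum>i<n. w i * M0 (A i) \<omega>) = of_real (exp (- (\<Sum>i<n. measure lborel (A i) * \<Psi> (w i))))"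
      using dis by (intro isI_disjoint_chf A M0_isI) (auto simp: disjoint_family_on_def)
    also have "\<dots> = (\<Prod>i<n. of_real (exp (- measure lborel (A i) * \<Psi> (w i))))"
      by (simp add: exp_sum sum_negf[symmetric] del: of_real_exp)
    finally show "chf P (\<lambda>\<omega>. \<Sum>i<n. w i * M0 (A i) \<omega>) = (\<Prod>i<n. chf P (\<lambda>\<omega>. w i * M0 (A i) \<omega>))"
      by (simp only: M0_chf[OF A])
  qed simp
qed

lemma isI_partial_sums:
  assumes A: "\<And>n::nat. A n \<in> sets borel" and dis: "disjoint_family A"
    and Y: "\<And>n. isI (indicator (A n)) (Y n)"
  shows "isI (indicator (\<Union>i\<in>{m..<n}. A i)) (\<lambda>\<omega>. \<Sum>i\<in>{m..<n}. Y i \<omega>)"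
proof -
  have "(indicator (\<Union>i\<in>{m..<n}. A i) s :: complex) = (\<Sum>i\<in>{m..<n}. 1 * indicator (A i) s)" for s
    using dis by (simp add: indicator_UN_disjoint disjoint_family_on_mono[of _ UNIV])
  then show ?thesis using isI_sum[of "{m..<n}" "\<lambda>i. indicator (A i)" Y "\<lambda>_. 1"] Y by simp presburger
qed

text \<open>
  Convergence in probability of the partial sums is the continuity of the integral. The maximal
  inequality, whose sign changes are allowed because \<open>\<Psi>\<close> is even, bounds the oscillation of the partial
  sums beyond \<open>m\<close> by the Lebesgue measure \<open>\<delta> m\<close> of what is left, and this tends to \<open>0\<close>.
\<close>
lemma M0_sums:
  assumes A: "\<And>n::nat. A n \<in> sets borel" "\<And>n. bounded (A n)" and dis: "disjoint_family A"
    and bU: "bounded (\<Union>n. A n)"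
  shows "AE \<omega> in P. (\<lambda>n. M0 (A n) \<omega>) sums M0 (\<Union>n. A n) \<omega>"
proof -
  define X where "X n = M0 (A n)" for n
  have XI: "isI (indicator (A n)) (X n)" for n unfolding X_def by (rule M0_isI[OF A])
  have [measurable]: "X n \<in> borel_measurable P" for n by (rule isI_meas[OF XI])
  have mU[measurable]: "(\<Union>n. A n) \<in> sets borel" using A by auto
  define \<delta> where "\<delta> m = measure lborel (\<Union>i. A (m + i))" for m
  have fl: "emeasure lborel B < top" if "B \<subseteq> (\<Union>n. A n)" for B
    using emeasure_bounded_finite[OF bounded_subset[OF bU that]] by simp
  have \<delta>: "\<delta> \<longlonglongrightarrow> 0"
  proof -
    have "(\<lambda>m. measure lborel (\<Union>i. A (m + i))) \<longlonglongrightarrow> measure lborel (\<Inter>m. \<Union>i. A (m + i))"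
    proof (rule Lim_measure_decseq)
      show "decseq (\<lambda>m. \<Union>i. A (m + i))"
        unfolding decseq_def by (safe, metis UN_I UNIV_I add.assoc le_add_diff_inverse)
    qed (use A in \<open>auto intro!: less_imp_neq fl\<close>)
    moreover have "(\<Inter>m. \<Union>i. A (m + i)) = {}"
    proof (rule ccontr)
      assume "(\<Inter>m. \<Union>i. A (m + i)) \<noteq> {}"
      then obtain s where "s \<in> (\<Inter>m. \<Union>i. A (m + i))" by blast
      then have s: "\<exists>i. s \<in> A (m + i)" for m by blast
      from s[of 0] obtain i where i: "s \<in> A i" by auto
      from s[of "Suc i"] obtain j where "s \<in> A (Suc i + j)" by auto
      with i dis show False unfolding disjoint_family_on_def by (metis UNIV_I disjoint_iff less_add_Suc1 less_irrefl add_Suc)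
    qed
    ultimately show ?thesis unfolding \<delta>_def by simp
  qed
  have tailS: "measure P {\<omega> \<in> space P. norm (\<Sum>i\<in>{m..<m+n}. X i \<omega>) > e} \<le> (48 * K * e powr (-\<alpha>)) * \<delta> m"
    if e: "0 < e" for m n e
  proof -
    have "measure P {\<omega> \<in> space P. norm (\<Sum>i\<in>{m..<m+n}. X i \<omega>) > e} \<le> (48 * K * e powr (-\<alpha>)) * enn2real (apow \<alpha> (indicator (\<Union>i\<in>{m..<m+n}. A i)))"
      by (rule isI_tail[OF isI_partial_sums[OF A(1) dis XI] e])
    also have "enn2real (apow \<alpha> (indicator (\<Union>i\<in>{m..<m+n}. A i))) = measure lborel (\<Union>i\<in>{m..<m+n}. A i)"
      using A by (subst apow_indicator) (auto simp: measure_def)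
    also have "\<dots> \<le> \<delta> m"
      unfolding \<delta>_def
    proof (rule measure_mono_fmeasurable)
      show "(\<Union>i\<in>{m..<m+n}. A i) \<subseteq> (\<Union>i. A (m + i))"
        by (auto) (metis le_add_diff_inverse)
      show "(\<Union>i. A (m + i)) \<in> fmeasurable lborel"
      proof (rule fmeasurableI)
        show "(\<Union>i. A (m + i)) \<in> sets lborel" using A by auto
        show "emeasure lborel (\<Union>i. A (m + i)) < \<infinity>"
          unfolding infinity_ennreal_def by (rule fl) blast
      qed
    qed (use A in auto)
    finally show ?thesis using K_nonneg by (auto simp: mult_left_mono)
  qed
  \<comment> \<open>Sign changes of the summands become sign changes of the frequencies, which \<open>\<Psi>\<close> does not see.\<close>
  have maxi: "\<P>(\<omega> in P. \<exists>j\<le>n. norm (\<Sum>i<j. X (m + i) \<omega>) > e) \<le> 2 * ((48 * K * e powr (-\<alpha>)) * \<delta> m)"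
    if e: "0 < e" for m n e
  proof -
    have disj: "disjoint_family_on (\<lambda>i. A (m + i)) {..<n}" using dis by (auto simp: disjoint_family_on_def)
    have "\<P>(\<omega> in P. \<exists>j\<le>n. norm (\<Sum>i<j. X (m + i) \<omega>) > e) \<le>
       2 * \<P>(\<omega> in P. norm (\<Sum>i<n. X (m + i) \<omega>) > e)"
    proof (rule levy_maximal_inequality[OF prob_P])
      fix k assume "k \<le> n"
      show "distr P borel (padded n (\<lambda>i \<omega>. if i < k then X (m + i) \<omega> else - X (m + i) \<omega>)) = distr P borel (padded n (\<lambda>i. X (m + i)))"
      proof (rule padded_distr_eq_if_chf_eq[OF prob_P prob_P])
        fix z :: "nat \<Rightarrow> complex"
        have "chf P (\<lambda>\<omega>. \<Sum>i<n. z i * (if i < k then X (m + i) \<omega> else - X (m + i) \<omega>)) =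
              chf P (\<lambda>\<omega>. \<Sum>i<n. (if i < k then z i else - z i) * X (m + i) \<omega>)"
          by (intro arg_cong[where f="chf P"] ext sum.cong) auto
        also have "\<dots> = of_real (exp (- (\<Sum>i<n. measure lborel (A (m + i)) * \<Psi> (if i < k then z i else - z i))))"
          by (intro isI_disjoint_chf A XI disj) auto
        also have "\<dots> = of_real (exp (- (\<Sum>i<n. measure lborel (A (m + i)) * \<Psi> (z i))))"
          by (simp add: if_distrib[of \<Psi>] Psi_minus cong: if_cong)
        also have "\<dots> = chf P (\<lambda>\<omega>. \<Sum>i<n. z i * X (m + i) \<omega>)"
          by (intro isI_disjoint_chf[symmetric] A XI disj) auto
        finally show "chf P (\<lambda>\<omega>. \<Sum>i<n. z i * (if i < k then X (m + i) \<omega> else - X (m + i) \<omega>)) = chf P (\<lambda>\<omega>. \<Sum>i<n. z i * X (m + i) \<omega>)" .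
      next
        show "(\<lambda>\<omega>. if i < k then X (m + i) \<omega> else - X (m + i) \<omega>) \<in> borel_measurable P" for i
          by (cases "i < k") auto
      qed auto
    qed auto
    also have "\<dots> \<le> 2 * ((48 * K * e powr (-\<alpha>)) * \<delta> m)"
    proof -
      have "(\<Sum>i<n. X (m + i) \<omega>) = (\<Sum>i\<in>{m..<m+n}. X i \<omega>)" for \<omega>
        using sum.shift_bounds_nat_ivl[of "\<lambda>i. X i \<omega>" 0 m n] by (simp add: atLeast0LessThan add.commute)
      then show ?thesis by (simp only:) (rule mult_left_mono[OF tailS[OF e]], simp)
    qed
    finally show ?thesis .
  qed
  have maxinf: "\<P>(\<omega> in P. \<exists>j. norm (\<Sum>i<j. X (m + i) \<omega>) > e) \<le> 2 * ((48 * K * e powr (-\<alpha>)) * \<delta> m)"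
    if e: "0 < e" for m e
  proof -
    have "(\<lambda>n. \<P>(\<omega> in P. \<exists>j\<le>n. norm (\<Sum>i<j. X (m + i) \<omega>) > e)) \<longlonglongrightarrow>
       measure P (\<Union>n. {\<omega> \<in> space P. \<exists>j\<le>n. norm (\<Sum>i<j. X (m + i) \<omega>) > e})"
      by (rule finite_Lim_measure_incseq) (auto simp: incseq_def intro: order_trans)
    moreover have "(\<Union>n. {\<omega> \<in> space P. \<exists>j\<le>n. norm (\<Sum>i<j. X (m + i) \<omega>) > e}) = {\<omega> \<in> space P. \<exists>j. norm (\<Sum>i<j. X (m + i) \<omega>) > e}"
      by auto
    ultimately show ?thesis using maxi[OF e, of _ m] by (auto intro: LIMSEQ_le_const2)
  qed
  \<comment> \<open>A path without this property belongs, for every \<open>m\<close>, to an event of probability of order \<open>\<delta> m\<close>.\<close>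
  have osc: "AE \<omega> in P. \<exists>m. \<forall>j. norm (\<Sum>i<j. X (m + i) \<omega>) \<le> e" if e: "0 < e" for e
  proof -
    have [measurable]: "{\<omega> \<in> space P. \<exists>j. norm (\<Sum>i<j. X (m + i) \<omega>) > e} \<in> sets P" for m by measurable
    have N[measurable]: "{\<omega> \<in> space P. \<forall>m. \<exists>j. norm (\<Sum>i<j. X (m + i) \<omega>) > e} \<in> sets P" by measurable
    have le: "\<P>(\<omega> in P. \<forall>m. \<exists>j. norm (\<Sum>i<j. X (m + i) \<omega>) > e) \<le> 2 * ((48 * K * e powr (-\<alpha>)) * \<delta> m)" for m
      by (rule order_trans[OF finite_measure_mono maxinf[OF e, of m]]) auto
    have lim: "(\<lambda>m. 2 * ((48 * K * e powr (-\<alpha>)) * \<delta> m)) \<longlonglongrightarrow> 2 * ((48 * K * e powr (-\<alpha>)) * 0)"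
      by (intro tendsto_intros \<delta>)
    have "\<P>(\<omega> in P. \<forall>m. \<exists>j. norm (\<Sum>i<j. X (m + i) \<omega>) > e) \<le> 2 * ((48 * K * e powr (-\<alpha>)) * 0)"
      by (rule LIMSEQ_le_const[OF lim]) (use le in blast)
    then have "emeasure P {\<omega> \<in> space P. \<forall>m. \<exists>j. norm (\<Sum>i<j. X (m + i) \<omega>) > e} = 0"
      by (simp add: emeasure_eq_measure measure_le_0_iff)
    then show ?thesis by (subst AE_iff_measurable[OF N]) (auto simp: not_le)
  qed
  have "AE \<omega> in P. \<forall>r. \<exists>m. \<forall>j. norm (\<Sum>i<j. X (m + i) \<omega>) \<le> 1 / real (Suc r)"
    by (subst AE_all_countable) (auto intro: osc)
  then have cv: "AE \<omega> in P. summable (\<lambda>i. X i \<omega>)"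
  proof eventually_elim
    case (elim \<omega>)
    show ?case
      unfolding summable_Cauchy
    proof (intro allI impI)
      fix e :: real assume "0 < e"
      then obtain r where r: "1 / real (Suc r) < e / 2" using reals_Archimedean[of "e/2"] by (auto simp: inverse_eq_divide)
      obtain m where m: "\<And>j. norm (\<Sum>i<j. X (m + i) \<omega>) \<le> 1 / real (Suc r)" using elim by blast
      have "norm (sum (\<lambda>i. X i \<omega>) {a..<b}) < e" if "m \<le> a" for a b
      proof (cases "a \<le> b")
        case True
        have sh: "(\<Sum>i<j. X (m + i) \<omega>) = sum (\<lambda>i. X i \<omega>) {m..<m+j}" for j
          using sum.shift_bounds_nat_ivl[of "\<lambda>i. X i \<omega>" 0 m j] by (simp add: atLeast0LessThan add.commute)
        have "sum (\<lambda>i. X i \<omega>) {a..<b} = sum (\<lambda>i. X i \<omega>) {m..<b} - sum (\<lambda>i. X i \<omega>) {m..<a}"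
          using sum.atLeastLessThan_concat[of m a b "\<lambda>i. X i \<omega>"] that True by (simp add: algebra_simps)
        also have "norm \<dots> \<le> norm (sum (\<lambda>i. X i \<omega>) {m..<b}) + norm (sum (\<lambda>i. X i \<omega>) {m..<a})"
          by (rule norm_triangle_ineq4)
        also have "\<dots> \<le> 1 / real (Suc r) + 1 / real (Suc r)"
          using m[of "b - m"] m[of "a - m"] that True unfolding sh by (intro add_mono) auto
        finally show ?thesis using r by linarith
      qed (use \<open>0 < e\<close> in auto)
      then show "\<exists>N. \<forall>m\<ge>N. \<forall>n. norm (sum (\<lambda>i. X i \<omega>) {m..<n}) < e" by blast
    qed
  qed
  \<comment> \<open>The almost sure sum and \<open>M0\<close> of the union are limits in probability of the same partial sums.\<close>
  define S where "S \<omega> = (\<Sum>i. X i \<omega>)" for \<omega>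
  have [measurable]: "S \<in> borel_measurable P" unfolding S_def by measurable
  have 1: "tendsto_in_prob P (\<lambda>n \<omega>. \<Sum>i<n. X i \<omega>) S sequentially"
    by (rule tendsto_in_prob_if_AE[OF prob_P]) (use cv in \<open>auto simp: S_def elim!: eventually_mono intro: summable_LIMSEQ\<close>)
  have 2: "tendsto_in_prob P (\<lambda>n \<omega>. \<Sum>i<n. X i \<omega>) (M0 (\<Union>n. A n)) sequentially"
    by (rule isI_tendsto[OF _ M0_isI[OF mU bU] indicator_UN_tendsto[OF alpha A(1) bU]])
      (use isI_partial_sums[OF A(1) dis XI, of 0] in \<open>simp add: atLeast0LessThan\<close>)
  have "AE \<omega> in P. S \<omega> = M0 (\<Union>n. A n) \<omega>"
    by (rule tendsto_in_prob_unique[OF prob_P _ _ _ 1 2]) (use M0_meas[OF mU bU] in auto)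
  with cv show ?thesis
    by eventually_elim (auto simp: S_def X_def dest: summable_sums)
qed

lemma M0_induced: "induced_random_measure P L M0"
  unfolding induced_random_measure_def indep_scattered_id_measure_def
proof (intro conjI allI impI)
  show "AE \<omega> in P. M0 {s<..t} \<omega> = L t \<omega> - L s \<omega>" if "s < t" for s t
    by (rule isI_unique[OF M0_isI isI_increment[OF that]]) auto
qed (auto intro!: M0_meas M0_infinitely_divisible M0_indep M0_sums)

text \<open>
  Every random measure induced by \<open>L\<close>, not only \<open>M0\<close>, is given by the integral: the two agree on
  intervals, and both are additive and continuous along disjoint unions.
\<close>
lemma induced_isI:
  assumes M: "induced_random_measure P L M" and "A \<in> sets borel" "bounded A"
  shows "isI (indicator A) (M A)"
proof -
  have ism: "indep_scattered_id_measure P M" and inc: "\<And>s t. s < t \<Longrightarrow> AE \<omega> in P. M {s<..t} \<omega> = L t \<omega> - L s \<omega>"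
    using M unfolding induced_random_measure_def by auto
  have mM: "M B \<in> borel_measurable P" if "B \<in> sets borel" "bounded B" for B
    using ism that unfolding indep_scattered_id_measure_def by auto
  show ?thesis
    using assms(2,3)
  proof (induction rule: bounded_borel_induct)
    case empty
    have "isI (\<lambda>s. 0) (M {})"
      using irm_empty[OF ism] by (intro isI_cong_AE[OF isI_zero] mM) (auto elim: eventually_mono)
    then show ?case by simp
  next
    case (interval s t)
    show ?case using inc[OF interval] by (intro isI_cong_AE[OF isI_increment[OF interval]] mM) auto
  next
    case (diff A B)
    have bd: "bounded (B - A)" "bounded A" using diff(3,4) by (auto intro: bounded_subset)
    have "AE \<omega> in P. M ((B - A) \<union> A) \<omega> = M (B - A) \<omega> + M A \<omega>"
      using diff bd by (intro irm_additive[OF ism]) auto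
    moreover have "(B - A) \<union> A = B" using diff(4) by auto
    ultimately have "AE \<omega> in P. M B \<omega> = M (B - A) \<omega> + M A \<omega>" by (simp only:)
    then have "AE \<omega> in P. M B \<omega> - M A \<omega> = M (B - A) \<omega>" by eventually_elim simp
    then have "isI (\<lambda>s. indicator B s - indicator A s) (M (B - A))"
      using diff bd by (intro isI_cong_AE[OF isI_diff[OF diff(6,5)]] mM) auto
    moreover have "(\<lambda>s. indicator B s - indicator A s :: complex) = indicator (B - A)"
      using diff(4) by (intro ext) (auto simp: indicator_def)
    ultimately show ?case by simp
  next
    case (union B)
    have mU: "(\<Union>i. B i) \<in> sets borel" using union(1) by auto
    have bB: "bounded (B i)" for i using union(2) by (rule bounded_subset) auto
    note mB = mM[OF union(1) bB] and mMU = mM[OF mU union(2)] and MU = M0_isI[OF mU union(2)]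
    have "AE \<omega> in P. (\<lambda>n. M (B n) \<omega>) sums M (\<Union>n. B n) \<omega>"
      by (rule irm_sums[OF ism union(1) bB union(3,2)])
    then have 1: "tendsto_in_prob P (\<lambda>n \<omega>. \<Sum>i<n. M (B i) \<omega>) (M (\<Union>i. B i)) sequentially"
      using mB mMU by (intro tendsto_in_prob_if_AE[OF prob_P]) (auto simp: sums_def)
    have 2: "tendsto_in_prob P (\<lambda>n \<omega>. \<Sum>i<n. M (B i) \<omega>) (M0 (\<Union>n. B n)) sequentially"
      by (rule isI_tendsto[OF _ MU indicator_UN_tendsto[OF alpha union(1,2)]])
        (use isI_partial_sums[OF union(1,3,4), of 0] in \<open>simp add: atLeast0LessThan\<close>)
    have "AE \<omega> in P. M0 (\<Union>i. B i) \<omega> = M (\<Union>i. B i) \<omega>"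
      using mB by (intro tendsto_in_prob_unique[OF prob_P _ isI_meas[OF MU] mMU 2 1]) auto
    then show ?case by (rule isI_cong_AE[OF MU mMU])
  qed
qed

lemma simple_integral_isI:
  assumes M: "induced_random_measure P L M" and G: "bounded_simple G" and A: "A \<in> sets borel"
  shows "isI (\<lambda>s. G s * indicator A s) (simple_integral_rm M G A)"
proof -
  note bs = bounded_simple_sum[OF G]
  have "isI (\<lambda>s. \<Sum>z\<in>range G - {0}. z * indicator (A \<inter> G -` {z}) s) (\<lambda>\<omega>. \<Sum>z\<in>range G - {0}. z * M (A \<inter> G -` {z}) \<omega>)"
  proof (rule isI_sum[OF bs(2)])
    fix z assume "z \<in> range G - {0}"
    then show "isI (indicator (A \<inter> G -` {z})) (M (A \<inter> G -` {z}))"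
      using bs(3)[of z] A by (intro induced_isI[OF M]) (auto intro: bounded_subset)
  qed
  moreover have "(\<Sum>z\<in>range G - {0}. z * indicator (A \<inter> G -` {z}) s) = G s * indicator A s" for s
    by (subst bs(1)[of s]) (auto simp: sum_distrib_left sum_distrib_right indicator_inter_arith mult_ac intro!: sum.cong)
  ultimately show ?thesis unfolding simple_integral_rm_def[abs_def] by simp
qed

text \<open>
  Simple functions dominated by a multiple of \<open>g\<close> converge in the \<open>\<alpha>\<close>-th mean over every Borel set, so
  continuity of the integral gives all the required limits.
\<close>
lemma approximates_exists:
  assumes g: "La g"
  shows "\<exists>G. approximates P M0 g G \<and>
    (\<forall>Y. isI g Y \<longrightarrow> tendsto_in_prob P (\<lambda>n. simple_integral_rm M0 (G n) UNIV) Y sequentially)"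
proof -
  note [measurable] = La_meas[OF g]
  obtain G where G: "\<And>n. bounded_simple (G n)" "\<And>s. (\<lambda>n. G n s) \<longlonglongrightarrow> g s" "\<And>n s. norm (G n s) \<le> 2 * norm (g s)"
    using bounded_simple_approximation[OF alpha La_meas[OF g]] g unfolding La_def by blast
  note [measurable] = bounded_simple_sum(4)[OF G(1)]
  have lim: "(\<lambda>n. apow \<alpha> (\<lambda>s. G n s - g s)) \<longlonglongrightarrow> 0"
    by (rule apow_dominated_convergence[OF alpha _ _ G(2,3)]) (use g in \<open>auto simp: La_def\<close>)
  have conv: "tendsto_in_prob P (\<lambda>n. simple_integral_rm M0 (G n) A) Y sequentially"
    if A: "A \<in> sets borel" and Y: "isI (\<lambda>s. g s * indicator A s) Y" for A Y
  proof (rule isI_tendsto[OF simple_integral_isI[OF M0_induced G(1) A] Y])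
    show "(\<lambda>n. apow \<alpha> (\<lambda>s. G n s * indicator A s - g s * indicator A s)) \<longlonglongrightarrow> 0"
      by (rule tendsto_sandwich[OF _ _ tendsto_const lim])
        (auto intro!: always_eventually apow_mono[OF alpha(1)] simp: indicator_def)
  qed
  have "approximates P M0 g G"
    unfolding approximates_def
  proof (intro conjI ballI)
    fix A :: "real set" assume A: "A \<in> sets borel"
    obtain Z where Z: "isI (\<lambda>s. g s * indicator A s) Z" using isI_exists[OF La_restrict[OF g A]] by blast
    show "\<exists>Z\<in>borel_measurable P. tendsto_in_prob P (\<lambda>n. simple_integral_rm M0 (G n) A) Z sequentially"
      using conv[OF A Z] isI_meas[OF Z] by blast
  qed (use G in auto)
  then show ?thesis using conv[of UNIV] by (intro exI[of _ G]) auto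
qed

theorem levy_integrable_La: "La g \<Longrightarrow> levy_integrable P L g"
  unfolding levy_integrable_def using approximates_exists[of g] M0_induced La_meas by blast

lemma has_levy_integral_if_isI: "isI g Y \<Longrightarrow> has_levy_integral P L g UNIV Y"
  unfolding has_levy_integral_def
  using approximates_exists[OF isI_La[of g Y]] M0_induced La_meas[OF isI_La[of g Y]] isI_meas[of g Y] by blast

text \<open>
  An arbitrary approximating sequence \<open>G n\<close> is compared with a version \<open>Y0\<close> of the integral. The
  characteristic function of the difference at stage \<open>n\<close> is \<open>exp (- \<integral> \<Psi>(z (G n - g)))\<close>. The assumed
  convergence over every Borel set and the convergence almost everywhere are the hypotheses of
  \<open>gliding_hump\<close>, which shows that it tends to \<open>1\<close>.
\<close>
lemma isI_if_has_levy_integral: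
  assumes g: "La g" and int: "has_levy_integral P L g UNIV Y"
  shows "isI g Y"
proof -
  obtain M G where Y[measurable]: "Y \<in> borel_measurable P" and M: "induced_random_measure P L M" and ap: "approximates P M g G"
    and YG: "tendsto_in_prob P (\<lambda>n. simple_integral_rm M (G n) UNIV) Y sequentially"
    using int unfolding has_levy_integral_def by blast
  have G: "\<And>n. bounded_simple (G n)" and Glim: "AE s in lborel. (\<lambda>n. G n s) \<longlonglongrightarrow> g s"
    and GA: "\<And>A. A \<in> sets borel \<Longrightarrow> \<exists>Z\<in>borel_measurable P. tendsto_in_prob P (\<lambda>n. simple_integral_rm M (G n) A) Z sequentially"
    using ap unfolding approximates_def by auto
  note [measurable] = La_meas[OF g] bounded_simple_sum(4)[OF G]
  obtain Y0 where Y0: "isI g Y0" using isI_exists[OF g] by blast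
  note [measurable] = isI_meas[OF Y0]
  have SI: "isI (\<lambda>s. G n s * indicator A s) (simple_integral_rm M (G n) A)" if "A \<in> sets borel" for n A
    by (rule simple_integral_isI[OF M G that])
  have "AE \<omega> in P. Y \<omega> - Y0 \<omega> = 0"
  proof (rule AE_zero_if_chf_one[OF prob_P])
    show "chf P (\<lambda>\<omega>. z * (Y \<omega> - Y0 \<omega>)) = 1" for z
    proof -
      define f where "f n s = \<Psi> (z * (G n s - g s))" for n s
      have La: "La (\<lambda>s. G n s - g s)" for n
        using isI_La[OF SI[of UNIV n]] by (intro La_diff g) auto
      have "(\<lambda>n. \<integral>s. f n s \<partial>lborel) \<longlonglongrightarrow> 0"
      proof (rule gliding_hump)
        show "integrable lborel (f n)" for n
          unfolding f_def by (rule Psi_integrable(1)[OF La_scale[OF La]])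
        show "AE s in lborel. (\<lambda>n. f n s) \<longlonglongrightarrow> 0"
          using Glim
        proof eventually_elim
          case (elim s)
          have "(\<lambda>n. \<Psi> (z * (G n s - g s))) \<longlonglongrightarrow> \<Psi> (z * (g s - g s))"
            using Psi_cont by (intro isCont_tendsto_compose[of _ \<Psi>] tendsto_intros elim) (auto simp: continuous_on_eq_continuous_at)
          then show ?case by (simp add: f_def Psi_0)
        qed
        fix A :: "real set" assume A: "A \<in> sets borel"
        obtain Z where [measurable]: "Z \<in> borel_measurable P" and Z: "tendsto_in_prob P (\<lambda>n. simple_integral_rm M (G n) A) Z sequentially"
          using GA[OF A] by blast
        obtain YA where YA: "isI (\<lambda>s. g s * indicator A s) YA" using isI_exists[OF La_restrict[OF g A]] by blast
        note [measurable] = isI_meas[OF YA] isI_meas[OF SI[OF A]]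
        have "tendsto_in_prob P (\<lambda>n \<omega>. simple_integral_rm M (G n) A \<omega> + (-1) * YA \<omega>) (\<lambda>\<omega>. Z \<omega> + (-1) * YA \<omega>) sequentially"
          by (rule tendsto_in_prob_lincomb[OF prob_P _ _ _ _ Z]) (auto simp: tendsto_in_prob_def)
        then have "(\<lambda>n. chf P (\<lambda>\<omega>. z * (simple_integral_rm M (G n) A \<omega> + (-1) * YA \<omega>))) \<longlonglongrightarrow> chf P (\<lambda>\<omega>. z * (Z \<omega> + (-1) * YA \<omega>))"
          by (intro tendsto_in_prob_chf prob_P) auto
        moreover have "chf P (\<lambda>\<omega>. z * (simple_integral_rm M (G n) A \<omega> + (-1) * YA \<omega>)) = of_real (exp (- (\<integral>s. f n s * indicator A s \<partial>lborel)))" for n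
        proof -
          have "z * (G n s * indicator A s + (-1) * (g s * indicator A s)) = (z * (G n s - g s)) * indicator A s" for s
            by (simp add: algebra_simps)
          moreover have "\<Psi> (x * indicator A s) = \<Psi> x * indicator A s" for x s
            by (auto simp: indicator_def Psi_0)
          ultimately show ?thesis
            using isI_chf[OF isI_lincomb[OF SI[OF A, of n] YA, of "-1"], of z] unfolding f_def by presburger
        qed
        ultimately have "(\<lambda>n. complex_of_real (exp (- (\<integral>s. f n s * indicator A s \<partial>lborel)))) \<longlonglongrightarrow> chf P (\<lambda>\<omega>. z * (Z \<omega> + (-1) * YA \<omega>))" by (simp only:)
        then have "(\<lambda>n. Re (complex_of_real (exp (- (\<integral>s. f n s * indicator A s \<partial>lborel))))) \<longlonglongrightarrow> Re (chf P (\<lambda>\<omega>. z * (Z \<omega> + (-1) * YA \<omega>)))"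
          by (rule tendsto_Re)
        then show "convergent (\<lambda>n. exp (- (\<integral>s. f n s * indicator A s \<partial>lborel)))"
          by (simp only: Re_complex_of_real) (rule convergentI)
      qed (auto simp: f_def Psi_nonneg)
      then have "(\<lambda>n. complex_of_real (exp (- (\<integral>s. f n s \<partial>lborel)))) \<longlonglongrightarrow> of_real (exp (- 0))"
        by (intro tendsto_intros)
      moreover have "chf P (\<lambda>\<omega>. z * (simple_integral_rm M (G n) UNIV \<omega> - Y0 \<omega>)) = of_real (exp (- (\<integral>s. f n s \<partial>lborel)))" for n
        using isI_chf[OF isI_diff[OF SI[of UNIV n] Y0], of z] by (simp add: f_def del: of_real_exp)
      moreover have "(\<lambda>n. chf P (\<lambda>\<omega>. z * (simple_integral_rm M (G n) UNIV \<omega> - Y0 \<omega>))) \<longlonglongrightarrow> chf P (\<lambda>\<omega>. z * (Y \<omega> - Y0 \<omega>))"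
      proof -
        note [measurable] = isI_meas[OF SI[of UNIV]]
        have "tendsto_in_prob P (\<lambda>n \<omega>. simple_integral_rm M (G n) UNIV \<omega> + (-1) * Y0 \<omega>) (\<lambda>\<omega>. Y \<omega> + (-1) * Y0 \<omega>) sequentially"
          by (rule tendsto_in_prob_lincomb[OF prob_P _ _ _ _ YG]) (auto simp: tendsto_in_prob_def)
        then show ?thesis by (intro tendsto_in_prob_chf prob_P) auto
      qed
      ultimately show ?thesis by (simp add: LIMSEQ_unique)
    qed
  qed auto
  then show ?thesis by (intro isI_cong_AE[OF Y0]) auto
qed

end

section \<open>Limits of isotropic laws\<close>

text \<open>
  The uniform distribution on \<open>[0, 2\<pi>)\<close>, by which isotropic laws are averaged.
\<close>
definition angle_measure :: "real measure" where
  "angle_measure = density lborel (\<lambda>\<theta>. ennreal (indicator {0..<2*pi} \<theta> / (2 * pi)))"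

lemma prob_angle: "prob_space angle_measure"
proof (rule prob_spaceI)
  have "emeasure angle_measure (space angle_measure) = (\<integral>\<^sup>+\<theta>. ennreal (1 / (2*pi)) * indicator {0..<2*pi} \<theta> \<partial>lborel)"
    unfolding angle_measure_def by (subst emeasure_density) (auto intro!: nn_integral_cong simp: indicator_def)
  also have "\<dots> = ennreal (1 / (2*pi)) * ennreal (2*pi)"
    by (subst nn_integral_cmult_indicator) auto
  also have "\<dots> = 1" by (subst ennreal_mult[symmetric]) auto
  finally show "emeasure angle_measure (space angle_measure) = 1" .
qed

lemma sets_angle [measurable_cong, simp]: "sets angle_measure = sets borel"
  unfolding angle_measure_def by simp

text \<open>
  The Bessel function \<open>J\<^sub>0\<close>, which is the characteristic function of a uniformly distributed point on the
  unit circle.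
\<close>
definition bessel :: "real \<Rightarrow> complex" where
  "bessel r = (CLINT \<theta>|angle_measure. cis (r * cos \<theta>))"

lemma isCont_bessel: "isCont bessel r"
proof -
  interpret real_distribution "distr angle_measure borel cos"
    by (intro real_distribution.intro prob_space.prob_space_distr prob_angle)
      (auto simp: real_distribution_axioms_def)
  have "bessel = char (distr angle_measure borel cos)"
    unfolding bessel_def char_def by (subst integral_distr) (auto simp: cis_conv_exp)
  then show ?thesis by (metis isCont_char)
qed

lemma bessel_measurable [measurable]: "bessel \<in> borel_measurable borel"
  by (intro borel_measurable_continuous_onI) (simp add: continuous_on_eq_continuous_at isCont_bessel)

lemma norm_bessel_le: "norm (bessel r) \<le> 1"
proof -
  interpret prob_space angle_measure by (rule prob_angle)
  have "norm (bessel r) \<le> (\<integral>\<theta>. norm (cis (r * cos \<theta>)) \<partial>angle_measure)"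
    unfolding bessel_def by (rule integral_norm_bound)
  then show ?thesis by (simp add: prob_space)
qed

lemma angle_integral:
  fixes g :: "real \<Rightarrow> complex"
  assumes [measurable]: "g \<in> borel_measurable borel"
  shows "(CLINT \<theta>|angle_measure. g \<theta>) = (CLINT \<theta>|lborel. indicator {0..<2*pi} \<theta> *\<^sub>R g \<theta>) / (2 * pi)"
  unfolding angle_measure_def
  by (subst integral_density) (auto simp: scaleR_conv_of_real)

text \<open>
  The average of a periodic function does not depend on the window of length \<open>2\<pi>\<close>.
\<close>
lemma angle_shift:
  fixes g :: "real \<Rightarrow> complex"
  assumes g: "continuous_on UNIV g" and per: "\<And>\<theta>. g (\<theta> + 2 * pi) = g \<theta>" and \<phi>: "0 \<le> \<phi>" "\<phi> < 2 * pi"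
  shows "(CLINT \<theta>|angle_measure. g (\<theta> + \<phi>)) = (CLINT \<theta>|angle_measure. g \<theta>)"
proof -
  have [measurable]: "g \<in> borel_measurable borel" using g by (rule borel_measurable_continuous_onI)
  have int: "integrable lborel (\<lambda>\<theta>. indicator {a..<b} \<theta> *\<^sub>R g \<theta>)" for a b
  proof -
    have "set_integrable lborel {a..b} g"
      using g by (intro borel_integrable_compact[unfolded set_integrable_def[symmetric]] continuous_on_subset[OF g]) auto
    then have "set_integrable lborel {a..<b} g" by (rule set_integrable_subset) auto
    then show ?thesis by (simp add: set_integrable_def)
  qed
  have "(CLINT \<theta>|lborel. indicator {0..<2*pi} \<theta> *\<^sub>R g (\<theta> + \<phi>)) = (CLINT \<theta>|lborel. indicator {\<phi>..<\<phi>+2*pi} \<theta> *\<^sub>R g \<theta>)"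
    by (subst lborel_integral_real_affine[of 1 "\<lambda>\<theta>. indicator {\<phi>..<\<phi>+2*pi} \<theta> *\<^sub>R g \<theta>" \<phi>])
      (auto intro!: Bochner_Integration.integral_cong simp: indicator_def add.commute)
  also have "\<dots> = (CLINT \<theta>|lborel. indicator {\<phi>..<2*pi} \<theta> *\<^sub>R g \<theta> + indicator {2*pi..<2*pi+\<phi>} \<theta> *\<^sub>R g \<theta>)"
    using \<phi> by (intro Bochner_Integration.integral_cong) (auto simp: indicator_def)
  also have "\<dots> = (CLINT \<theta>|lborel. indicator {\<phi>..<2*pi} \<theta> *\<^sub>R g \<theta>) + (CLINT \<theta>|lborel. indicator {2*pi..<2*pi+\<phi>} \<theta> *\<^sub>R g \<theta>)"
    by (intro Bochner_Integration.integral_add int)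
  also have "(CLINT \<theta>|lborel. indicator {2*pi..<2*pi+\<phi>} \<theta> *\<^sub>R g \<theta>) = (CLINT \<theta>|lborel. indicator {0..<\<phi>} \<theta> *\<^sub>R g \<theta>)"
    by (subst lborel_integral_real_affine[of 1 _ "2*pi"])
      (auto intro!: Bochner_Integration.integral_cong simp: indicator_def add.commute[of "2*pi"] per)
  also have "(CLINT \<theta>|lborel. indicator {\<phi>..<2*pi} \<theta> *\<^sub>R g \<theta>) + (CLINT \<theta>|lborel. indicator {0..<\<phi>} \<theta> *\<^sub>R g \<theta>) =
      (CLINT \<theta>|lborel. indicator {\<phi>..<2*pi} \<theta> *\<^sub>R g \<theta> + indicator {0..<\<phi>} \<theta> *\<^sub>R g \<theta>)"
    by (intro Bochner_Integration.integral_add[symmetric] int)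
  also have "\<dots> = (CLINT \<theta>|lborel. indicator {0..<2*pi} \<theta> *\<^sub>R g \<theta>)"
    using \<phi> by (intro Bochner_Integration.integral_cong) (auto simp: indicator_def)
  finally show ?thesis by (simp add: angle_integral)
qed

lemma bessel_rotation: "(CLINT \<theta>|angle_measure. cis (Re (cis \<theta> * w))) = bessel (norm w)"
proof -
  have w: "w = of_real (norm w) * cis (Arg2pi w)"
    using Arg2pi_eq[of w] by (simp add: cis_conv_exp)
  have "Re (cis \<theta> * w) = norm w * cos (\<theta> + Arg2pi w)" for \<theta>
    by (subst w) (simp add: cos_add algebra_simps)
  then have "(CLINT \<theta>|angle_measure. cis (Re (cis \<theta> * w))) = (CLINT \<theta>|angle_measure. cis (norm w * cos (\<theta> + Arg2pi w)))"
    by presburger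
  also have "\<dots> = (CLINT \<theta>|angle_measure. cis (norm w * cos \<theta>))"
    by (rule angle_shift) (auto intro!: continuous_intros Arg2pi_ge_0 Arg2pi_lt_2pi)
  finally show ?thesis unfolding bessel_def .
qed

text \<open>
  An isotropic law is that of its modulus times an independent uniform angle, and its characteristic
  function is the integral of \<open>bessel (norm z * x)\<close> against the law of the modulus. The laws of the moduli
  are tight, so Helly's selection theorem gives a limit law on the line, and spreading that one by a
  uniform angle realises the limit of the characteristic functions.
\<close>
theorem isotropic_limit_law:
  fixes X :: "nat \<Rightarrow> 'a \<Rightarrow> complex"
  assumes P: "prob_space P" and [measurable]: "\<And>n. X n \<in> borel_measurable P"
    and radial: "\<And>n z. chf P (\<lambda>\<omega>. z * X n \<omega>) = \<phi> n (norm z)"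
    and lim: "\<And>r. 0 \<le> r \<Longrightarrow> (\<lambda>n. \<phi> n r) \<longlonglongrightarrow> \<psi> r"
    and tail: "\<And>n e. 0 < e \<Longrightarrow> \<P>(\<omega> in P. norm (X n \<omega>) > e) \<le> c * e powr (-\<alpha>)" and "0 < \<alpha>"
  shows "\<exists>\<mu>. prob_space \<mu> \<and> sets \<mu> = sets borel \<and> (\<forall>z. chf \<mu> (\<lambda>x. z * x) = \<psi> (norm z))"
proof -
  interpret P: prob_space P by fact
  interpret A: prob_space angle_measure by (rule prob_angle)
  define R where "R n = distr P borel (\<lambda>\<omega>. norm (X n \<omega>))" for n
  have Rd: "real_distribution (R n)" for n
    unfolding R_def by (intro real_distribution.intro P.prob_space_distr) (auto simp: real_distribution_axioms_def)
  have "tight R"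
    unfolding tight_def
  proof (intro conjI allI impI Rd)
    fix \<epsilon> :: real assume \<epsilon>: "0 < \<epsilon>"
    have "((\<lambda>e. c * e powr (-\<alpha>)) \<longlongrightarrow> c * 0) at_top"
      using \<open>0 < \<alpha>\<close> by (intro tendsto_intros tendsto_neg_powr filterlim_ident) auto
    then have "\<forall>\<^sub>F e in at_top. c * e powr (-\<alpha>) < \<epsilon>" using \<epsilon> by (intro order_tendstoD(2)) auto
    then obtain e where e: "0 < e" "c * e powr (-\<alpha>) < \<epsilon>"
      using eventually_happens[OF eventually_conj[OF _ eventually_gt_at_top[of "0::real"]]] by auto
    have "1 - \<epsilon> < measure (R n) {-1<..e}" for n
    proof -
      have pos: "-1 < norm (X n \<omega>)" for \<omega> by (rule less_le_trans[of _ 0]) auto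
      have "measure (R n) {-1<..e} = \<P>(\<omega> in P. norm (X n \<omega>) \<le> e)"
        unfolding R_def by (subst measure_distr) (auto intro!: arg_cong[where f="measure P"] simp: pos)
      also have "\<dots> = 1 - \<P>(\<omega> in P. norm (X n \<omega>) > e)"
        by (subst P.prob_compl[symmetric]) (auto intro!: arg_cong[where f="measure P"])
      finally show ?thesis using tail[OF e(1), of n] e by linarith
    qed
    moreover have "-1 < e" using e by simp
    ultimately show "\<exists>a b. a < b \<and> (\<forall>n. 1 - \<epsilon> < measure (R n) {a<..b})" by blast
  qed
  from tight_imp_convergent_subsubsequence[OF this strict_mono_id]
  obtain r M where r: "strict_mono r" "real_distribution M" "weak_conv_m (R \<circ> id \<circ> r) M" by blast
  interpret M: real_distribution M by fact
  \<comment> \<open>Average over all rotations of the frequency, and exchange the integrals.\<close>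
  have E: "\<phi> n (norm z) = (CLINT x|R n. bessel (norm z * \<bar>x\<bar>))" for n and z :: complex
  proof -
    interpret AP: pair_prob_space angle_measure P ..
    have "\<phi> n (norm z) = (CLINT \<theta>|angle_measure. chf P (\<lambda>\<omega>. (cis \<theta> * z) * X n \<omega>))"
      unfolding radial by (simp add: norm_mult A.prob_space)
    also have "\<dots> = (CLINT \<theta>|angle_measure. CLINT \<omega>|P. cis (Re (cis \<theta> * (z * X n \<omega>))))"
      unfolding chf_def by (simp add: mult.assoc)
    also have "\<dots> = (CLINT \<omega>|P. CLINT \<theta>|angle_measure. cis (Re (cis \<theta> * (z * X n \<omega>))))"
      by (rule AP.Fubini_integral[symmetric]) (rule AP.P.integrable_const_bound[where B=1], auto simp: split_beta)
    also have "\<dots> = (CLINT \<omega>|P. bessel (norm z * \<bar>norm (X n \<omega>)\<bar>))"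
      unfolding bessel_rotation by (simp add: norm_mult)
    also have "\<dots> = (CLINT x|R n. bessel (norm z * \<bar>x\<bar>))"
      unfolding R_def
      by (subst integral_distr) auto
    finally show ?thesis .
  qed
  have L: "(CLINT x|M. bessel (norm z * \<bar>x\<bar>)) = \<psi> (norm z)" for z :: complex
  proof (rule LIMSEQ_unique)
    show "(\<lambda>n. CLINT x|R (r n). bessel (norm z * \<bar>x\<bar>)) \<longlonglongrightarrow> (CLINT x|M. bessel (norm z * \<bar>x\<bar>))"
    proof (rule weak_conv_imp_integral_bdd_continuous_conv[where B=1])
      show "weak_conv_m (\<lambda>n. R (r n)) M" using r(3) by (simp add: comp_def)
      show "isCont (\<lambda>x. bessel (norm z * \<bar>x\<bar>)) x" for x
        by (intro isCont_o2[OF _ isCont_bessel] continuous_intros)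
    qed (auto intro: Rd M.real_distribution_axioms norm_bessel_le)
    show "(\<lambda>n. CLINT x|R (r n). bessel (norm z * \<bar>x\<bar>)) \<longlonglongrightarrow> \<psi> (norm z)"
      unfolding E[symmetric] using LIMSEQ_subseq_LIMSEQ[OF lim[of "norm z"] r(1)] by (simp add: comp_def)
  qed
  interpret MA: pair_prob_space M angle_measure ..
  \<comment> \<open>The limit law: modulus distributed as \<open>M\<close>, with an independent uniform angle. A negative modulus would do
    no harm because \<open>bessel\<close> only sees the absolute value.\<close>
  define \<mu> where "\<mu> = distr (M \<Otimes>\<^sub>M angle_measure) borel (\<lambda>(x, \<theta>). complex_of_real x * cis \<theta>)"
  have m[measurable]: "(\<lambda>(x, \<theta>). complex_of_real x * cis \<theta>) \<in> borel_measurable (M \<Otimes>\<^sub>M angle_measure)"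
    by measurable
  have "chf \<mu> (\<lambda>x. z * x) = \<psi> (norm z)" for z
  proof -
    have "chf \<mu> (\<lambda>x. z * x) = (CLINT p|(M \<Otimes>\<^sub>M angle_measure). cis (Re (z * (complex_of_real (fst p) * cis (snd p)))))"
      unfolding \<mu>_def by (subst chf_distr[OF m]) (auto simp: chf_def split_beta)
    also have "\<dots> = (CLINT x|M. CLINT \<theta>|angle_measure. cis (Re (cis \<theta> * (z * complex_of_real x))))"
      using MA.integral_fst[of "\<lambda>x \<theta>. cis (Re (z * (complex_of_real x * cis \<theta>)))"]
      by (simp add: MA.P.integrable_const_bound[where B=1] case_prod_unfold mult_ac)
    also have "\<dots> = (CLINT x|M. bessel (norm z * \<bar>x\<bar>))"
      unfolding bessel_rotation by (simp add: norm_mult)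
    finally show ?thesis unfolding L .
  qed
  moreover have "prob_space \<mu>" unfolding \<mu>_def by (rule MA.P.prob_space_distr) simp
  ultimately show ?thesis by (intro exI[of _ \<mu>]) (auto simp: \<mu>_def)
qed

section \<open>Construction of stable Levy processes\<close>

lemma hstep_diff:
  assumes "a \<le> b"
  shows "hstep b s - hstep a s = indicator {a<..b} s"
  using assms by (auto simp: hstep_def indicator_def)

text \<open>
  On a grid containing \<open>J\<close> take independent increments with the laws of \<open>\<delta> powr (1/\<alpha>)\<close> times a
  variable distributed as \<open>\<mu>\<close>, where \<open>\<delta>\<close> is the length of the cell, and sum them up from the
  origin.
\<close>
lemma stable_fdd_exists:
  assumes \<mu>: "prob_space \<mu>" "sets \<mu> = sets borel" and \<alpha>: "0 < \<alpha>"
    and chf: "\<And>z. chf \<mu> (\<lambda>x. z * x) = of_real (exp (- (k * norm z powr \<alpha>)))" and "finite J"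
  shows "\<exists>\<rho>. prob_space \<rho> \<and> sets \<rho> = sets (Pi\<^sub>M J (\<lambda>_. borel :: complex measure)) \<and>
     (\<forall>w. chf \<rho> (\<lambda>x. \<Sum>t\<in>J. w t * x t) = of_real (exp (- (\<integral>s. k * norm (stepf J w s) powr \<alpha> \<partial>lborel))))"
proof -
  note \<mu>(2)[measurable_cong]
  obtain \<tau> N m where \<tau>: "strict_mono \<tau>" "J \<subseteq> \<tau> ` {..N::nat}" "m \<le> N" "\<tau> m = 0"
    using grid_exists[OF \<open>finite J\<close>] by blast
  define \<nu> where "\<nu> \<delta> = distr \<mu> borel (\<lambda>x. complex_of_real (\<delta> powr (1/\<alpha>)) * x)" for \<delta>
  have \<nu>: "prob_space (\<nu> \<delta>)" "sets (\<nu> \<delta>) = sets borel" for \<delta>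
    unfolding \<nu>_def using \<mu> by (auto intro!: prob_space.prob_space_distr)
  note \<nu>(2)[measurable_cong]
  have \<nu>chf: "chf (\<nu> \<delta>) (\<lambda>x. z * x) = of_real (exp (- (\<delta> * (k * norm z powr \<alpha>))))" if "0 \<le> \<delta>" for \<delta> z
  proof -
    have "chf (\<nu> \<delta>) (\<lambda>x. z * x) = chf \<mu> (\<lambda>x. (z * complex_of_real (\<delta> powr (1/\<alpha>))) * x)"
      unfolding \<nu>_def by (subst chf_distr) (auto intro!: arg_cong[where f="chf \<mu>"] ext)
    then show ?thesis using that \<alpha> unfolding chf by (simp add: norm_mult powr_mult powr_powr mult_ac)
  qed
  define PN where "PN = Pi\<^sub>M {..<N} (\<lambda>i. \<nu> (\<tau> (Suc i) - \<tau> i))"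
  have [measurable_cong]: "sets PN = sets (Pi\<^sub>M {..<N} (\<lambda>_. borel))"
    unfolding PN_def by (intro sets_PiM_cong) (auto simp: \<nu>)
  have pP: "prob_space PN" unfolding PN_def by (intro prob_space_PiM \<nu>)
  define g where "g x = (\<lambda>t\<in>J. \<Sum>i<N. complex_of_real (hstep t (\<tau> (Suc i))) * x i)" for x :: "nat \<Rightarrow> complex"
  have g[measurable]: "g \<in> measurable PN (Pi\<^sub>M J (\<lambda>_. borel))"
    unfolding g_def by (intro measurable_restrict borel_measurable_sum) auto
  have "chf (distr PN (Pi\<^sub>M J (\<lambda>_. borel)) g) (\<lambda>x. \<Sum>t\<in>J. w t * x t) =
      of_real (exp (- (\<integral>s. k * norm (stepf J w s) powr \<alpha> \<partial>lborel)))" for w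
  proof -
    have "(\<Sum>t\<in>J. w t * g x t) = (\<Sum>i<N. stepf J w (\<tau> (Suc i)) * x i)" for x
    proof -
      have "(\<Sum>t\<in>J. w t * g x t) = (\<Sum>t\<in>J. \<Sum>i<N. w t * complex_of_real (hstep t (\<tau> (Suc i))) * x i)"
        by (intro sum.cong) (auto simp: g_def sum_distrib_left mult.assoc)
      also have "\<dots> = (\<Sum>i<N. stepf J w (\<tau> (Suc i)) * x i)"
        unfolding stepf_def by (subst sum.swap) (simp add: sum_distrib_right)
      finally show ?thesis .
    qed
    then have "chf (distr PN (Pi\<^sub>M J (\<lambda>_. borel)) g) (\<lambda>x. \<Sum>t\<in>J. w t * x t) = chf PN (\<lambda>x. \<Sum>i<N. stepf J w (\<tau> (Suc i)) * x i)"
      by (subst chf_distr) auto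
    also have "\<dots> = (\<Prod>i<N. chf (\<nu> (\<tau> (Suc i) - \<tau> i)) (\<lambda>x. stepf J w (\<tau> (Suc i)) * x))"
      unfolding PN_def by (intro chf_PiM_sum \<nu>) auto
    also have "\<dots> = (\<Prod>i<N. of_real (exp (- ((\<tau> (Suc i) - \<tau> i) * (k * norm (stepf J w (\<tau> (Suc i))) powr \<alpha>)))))"
      by (intro prod.cong refl \<nu>chf) (simp add: strict_mono_less_eq[OF \<tau>(1)])
    also have "\<dots> = of_real (exp (\<Sum>i<N. - ((\<tau> (Suc i) - \<tau> i) * (k * norm (stepf J w (\<tau> (Suc i))) powr \<alpha>))))"
      by (simp add: exp_sum)
    also have "(\<Sum>i<N. - ((\<tau> (Suc i) - \<tau> i) * (k * norm (stepf J w (\<tau> (Suc i))) powr \<alpha>))) = - (\<integral>s. k * norm (stepf J w s) powr \<alpha> \<partial>lborel)"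
      using \<alpha> by (subst stepf_integral(2)[of \<tau> J N m "\<lambda>z. k * norm z powr \<alpha>", OF \<tau>]) (auto simp: sum_negf)
    finally show ?thesis .
  qed
  then show ?thesis
    by (intro exI[of _ "distr PN (Pi\<^sub>M J (\<lambda>_. borel)) g"]) (auto intro: prob_space.prob_space_distr[OF pP])
qed

text \<open>
  The laws provided by \<open>stable_fdd_exists\<close> are determined by their characteristic functions, which only
  depend on the step function \<open>stepf J w\<close>; extending \<open>w\<close> by \<open>0\<close> to a larger index set does not change
  it. Hence they are consistent, and Kolmogorov's extension theorem applies. The properties of a Levy
  process are then read off from the joint characteristic function of increments over disjoint
  intervals.
\<close>
theorem stable_process_exists:
  assumes \<mu>: "prob_space \<mu>" "sets \<mu> = sets borel" and \<alpha>: "0 < \<alpha>" "\<alpha> < 2" and k: "0 \<le> k"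
    and chf: "\<And>z. chf \<mu> (\<lambda>x. z * x) = of_real (exp (- (k * norm z powr \<alpha>)))"
  shows "\<exists>Q :: (real \<Rightarrow> complex) measure. levy_process Q (\<lambda>t \<omega>. \<omega> t) \<and>
    (\<forall>s t z. s \<le> t \<longrightarrow> chf Q (\<lambda>\<omega>. z * (\<omega> t - \<omega> s)) = of_real (exp (- (t - s) * (k * norm z powr \<alpha>))))"
proof -
  define F where "F J = (SOME \<rho>. prob_space \<rho> \<and> sets \<rho> = sets (Pi\<^sub>M J (\<lambda>_. borel :: complex measure)) \<and>
     (\<forall>w. chf \<rho> (\<lambda>x. \<Sum>t\<in>J. w t * x t) = of_real (exp (- (\<integral>s. k * norm (stepf J w s) powr \<alpha> \<partial>lborel)))))" for J
  have F: "prob_space (F J)" "sets (F J) = sets (Pi\<^sub>M J (\<lambda>_. borel :: complex measure))"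
     "chf (F J) (\<lambda>x. \<Sum>t\<in>J. w t * x t) = of_real (exp (- (\<integral>s. k * norm (stepf J w s) powr \<alpha> \<partial>lborel)))"
     if "finite J" for J w
    using someI_ex[OF stable_fdd_exists[OF \<mu> \<alpha>(1) chf that]] unfolding F_def by blast+
  interpret polish_projective UNIV F
  proof (intro polish_projective.intro projective_family.intro)
    fix J H :: "real set" assume JH: "J \<subseteq> H" "finite H"
    then have fJ: "finite J" by (rule finite_subset)
    note F(2)[OF JH(2), measurable_cong]
    have rm[measurable]: "(\<lambda>f. restrict f J) \<in> measurable (F H) (Pi\<^sub>M J (\<lambda>_. borel :: complex measure))"
      using JH by (intro measurable_restrict) auto
    show "F J = distr (F H) (Pi\<^sub>M J (\<lambda>_. borel)) (\<lambda>f. restrict f J)"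
    proof (rule PiM_measure_eqI[OF fJ F(1)[OF fJ] prob_space.prob_space_distr[OF F(1)[OF JH(2)] rm] F(2)[OF fJ]])
      fix w :: "real \<Rightarrow> complex"
      \<comment> \<open>Marginals on \<open>J\<close> correspond to frequencies that vanish outside of \<open>J\<close>.\<close>
      define w' where "w' t = (if t \<in> J then w t else 0)" for t
      have ext: "(\<Sum>t\<in>J. w t * x t) = (\<Sum>t\<in>H. w' t * x t)" for x :: "real \<Rightarrow> complex"
        using JH unfolding w'_def by (intro sum.mono_neutral_cong_left) auto
      have "chf (distr (F H) (Pi\<^sub>M J (\<lambda>_. borel)) (\<lambda>f. restrict f J)) (\<lambda>x. \<Sum>t\<in>J. w t * x t) = chf (F H) (\<lambda>x. \<Sum>t\<in>J. w t * x t)"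
        by (subst chf_distr) (auto intro!: arg_cong[where f="chf (F H)"] ext sum.cong)
      also have "\<dots> = chf (F H) (\<lambda>x. \<Sum>t\<in>H. w' t * x t)" unfolding ext ..
      also have "\<dots> = of_real (exp (- (\<integral>s. k * norm (stepf J w s) powr \<alpha> \<partial>lborel)))"
        unfolding F(3)[OF JH(2)] stepf_def ext ..
      finally show "chf (F J) (\<lambda>x. \<Sum>t\<in>J. w t * x t) = chf (distr (F H) (Pi\<^sub>M J (\<lambda>_. borel)) (\<lambda>f. restrict f J)) (\<lambda>x. \<Sum>t\<in>J. w t * x t)"
        unfolding F(3)[OF fJ] by simp
    qed simp
  next
    fix J :: "real set" assume "finite J"
    then show "prob_space (F J)" by (rule F(1))
  qed
  have [measurable_cong]: "sets lim = sets (Pi\<^sub>M UNIV (\<lambda>_. borel))" by simp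
  have cm[measurable]: "(\<lambda>\<omega>. \<omega> t) \<in> borel_measurable lim" for t by simp
  have pl: "prob_space lim" by (rule P.prob_space_axioms)
  have marg: "chf lim (\<lambda>\<omega>. \<Sum>t\<in>J. w t * \<omega> t) = of_real (exp (- (\<integral>s. k * norm (stepf J w s) powr \<alpha> \<partial>lborel)))"
    if fJ: "finite J" for J w
  proof -
    have rm[measurable]: "(\<lambda>f. restrict f J) \<in> measurable lim (Pi\<^sub>M J (\<lambda>_. borel :: complex measure))"
      by (intro measurable_restrict) auto
    have "distr lim (Pi\<^sub>M J (\<lambda>_. borel)) (\<lambda>f. restrict f J) = F J"
    proof (rule measure_eqI)
      fix X assume "X \<in> sets (distr lim (Pi\<^sub>M J (\<lambda>_. borel)) (\<lambda>f. restrict f J))"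
      then have X: "X \<in> sets (Pi\<^sub>M J (\<lambda>_. borel :: complex measure))" by simp
      have "emeasure (distr lim (Pi\<^sub>M J (\<lambda>_. borel)) (\<lambda>f. restrict f J)) X = emeasure lim (emb UNIV J X)"
        using X by (subst emeasure_distr[OF rm]) (auto simp: prod_emb_def space_PiM)
      also have "\<dots> = emeasure (F J) X" by (rule emeasure_lim_emb) (use fJ X in auto)
      finally show "emeasure (distr lim (Pi\<^sub>M J (\<lambda>_. borel)) (\<lambda>f. restrict f J)) X = emeasure (F J) X" .
    qed (simp add: F(2)[OF fJ])
    then have "chf lim (\<lambda>\<omega>. \<Sum>t\<in>J. w t * restrict \<omega> J t) = chf (F J) (\<lambda>x. \<Sum>t\<in>J. w t * x t)"
      using chf_distr[OF rm, of "\<lambda>x. \<Sum>t\<in>J. w t * x t"] by simp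
    then show ?thesis unfolding F(3)[OF fJ] by (simp cong: sum.cong)
  qed
  have incr: "chf lim (\<lambda>\<omega>. \<Sum>i\<in>I. z i * (\<omega> (b i) - \<omega> (a i))) =
      of_real (exp (- (\<Sum>i\<in>I. (b i - a i) * (k * norm (z i) powr \<alpha>))))"
    if I: "finite I" "\<And>i. i \<in> I \<Longrightarrow> a i \<le> b i" and dis: "disjoint_family_on (\<lambda>i. {a i<..b i}) I"
    for I :: "nat set" and a b z
  proof -
    define J where "J = a ` I \<union> b ` I"
    have fJ: "finite J" using I by (simp add: J_def)
    \<comment> \<open>Coefficients that express the increments through the values at the endpoints; endpoints may coincide.\<close>
    define w where "w t = (\<Sum>i\<in>I. z i * ((if t = b i then 1 else 0) - (if t = a i then 1 else 0)))" for t
    have lin: "(\<Sum>t\<in>J. w t * x t) = (\<Sum>i\<in>I. z i * (x (b i) - x (a i)))" for x :: "real \<Rightarrow> complex"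
    proof -
      have "(\<Sum>t\<in>J. w t * x t) = (\<Sum>i\<in>I. \<Sum>t\<in>J. z i * (((if t = b i then 1 else 0) - (if t = a i then 1 else 0)) * x t))"
        unfolding w_def sum_distrib_right by (subst sum.swap) (simp add: mult.assoc)
      also have "\<dots> = (\<Sum>i\<in>I. z i * (x (b i) - x (a i)))"
      proof (rule sum.cong[OF refl])
        fix i assume "i \<in> I"
        then have "a i \<in> J" "b i \<in> J" by (auto simp: J_def)
        then show "(\<Sum>t\<in>J. z i * (((if t = b i then 1 else 0) - (if t = a i then 1 else 0)) * x t)) = z i * (x (b i) - x (a i))"
          using fJ by (simp add: sum_distrib_left[symmetric] left_diff_distrib sum_subtractf if_distrib[of "\<lambda>u. u * _"] cong: if_cong)
      qed
      finally show ?thesis .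
    qed
    have st: "stepf J w s = (\<Sum>i\<in>I. z i * indicator {a i<..b i} s)" for s
      unfolding stepf_def lin using I hstep_diff
      by (intro sum.cong refl) (simp flip: of_real_diff add: hstep_diff, simp add: indicator_def)
    have "(\<integral>s. k * norm (stepf J w s) powr \<alpha> \<partial>lborel) = (\<Sum>i\<in>I. (b i - a i) * (k * norm (z i) powr \<alpha>))"
      unfolding st using I dis \<alpha>
      by (subst disjoint_indicator_sum_integral[where F="\<lambda>u. k * norm u powr \<alpha>"])
        (auto intro!: sum.cong bounded_subset[OF bounded_cbox] simp: measure_def emeasure_lborel_Ioc)
    then show ?thesis using marg[OF fJ, of w] unfolding lin by simp
  qed
  have incr1: "chf lim (\<lambda>\<omega>. z * (\<omega> t - \<omega> s)) = of_real (exp (- (t - s) * (k * norm z powr \<alpha>)))" if "s \<le> t" for s t z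
    using incr[of "{0}" "\<lambda>_. s" "\<lambda>_. t" "\<lambda>_. z"] that minus_mult_left[of "t - s" "k * norm z powr \<alpha>"]
    by (simp add: disjoint_family_on_def)
  have swap: "chf lim (\<lambda>\<omega>. z * (\<omega> s - \<omega> t)) = of_real (exp (- \<bar>t - s\<bar> * (k * norm z powr \<alpha>)))" for s t z
  proof (cases "s \<le> t")
    case True
    have "(\<lambda>\<omega>. z * (\<omega> s - \<omega> t)) = (\<lambda>\<omega> :: real \<Rightarrow> complex. (- z) * (\<omega> t - \<omega> s))" by (auto simp: algebra_simps)
    then show ?thesis using incr1[OF True, of "- z"] True by (simp add: left_diff_distrib)
  next
    case False
    then show ?thesis using incr1[of t s z] by (simp add: algebra_simps)
  qed
  have "levy_process lim (\<lambda>t \<omega>. \<omega> t)"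
    unfolding levy_process_def
  proof (intro conjI allI impI)
    show "AE \<omega> in lim. \<omega> 0 = 0"
    proof (rule AE_zero_if_chf_one[OF pl cm])
      show "chf lim (\<lambda>\<omega>. z * \<omega> 0) = 1" for z
      proof -
        have "hstep 0 s = 0" for s by (auto simp: hstep_def)
        then show ?thesis using marg[of "{0}" "\<lambda>_. z"] \<alpha> by (simp add: stepf_def)
      qed
    qed
  next
    fix n :: nat and t :: "nat \<Rightarrow> real" assume t: "strict_mono t"
    have le: "t k \<le> t (Suc k)" for k by (simp add: strict_mono_less_eq[OF t])
    show "prob_space.indep_vars lim (\<lambda>_. borel) (\<lambda>k \<omega>. \<omega> (t (Suc k)) - \<omega> (t k)) {..<n}"
    proof (rule indep_vars_if_chf_prod[OF pl])
      fix z :: "nat \<Rightarrow> complex"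
      have "chf lim (\<lambda>\<omega>. \<Sum>i<n. z i * (\<omega> (t (Suc i)) - \<omega> (t i))) = of_real (exp (- (\<Sum>i<n. (t (Suc i) - t i) * (k * norm (z i) powr \<alpha>))))"
      proof (rule incr)
        show "disjoint_family_on (\<lambda>i. {t i<..t (Suc i)}) {..<n}"
          unfolding disjoint_family_on_def
        proof (intro ballI impI)
          fix i j :: nat assume "i \<noteq> j"
          have "t (Suc i) \<le> t j \<or> t (Suc j) \<le> t i"
            using \<open>i \<noteq> j\<close> unfolding strict_mono_less_eq[OF t] by auto
          then show "{t i<..t (Suc i)} \<inter> {t j<..t (Suc j)} = {}" by auto
        qed
      qed (use le in auto)
      also have "\<dots> = (\<Prod>i<n. chf lim (\<lambda>\<omega>. z i * (\<omega> (t (Suc i)) - \<omega> (t i))))"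
        unfolding incr1[OF le] by (simp add: exp_sum sum_negf[symmetric] algebra_simps)
      finally show "chf lim (\<lambda>\<omega>. \<Sum>i<n. z i * (\<omega> (t (Suc i)) - \<omega> (t i))) = (\<Prod>i<n. chf lim (\<lambda>\<omega>. z i * (\<omega> (t (Suc i)) - \<omega> (t i))))" .
    qed auto
  next
    fix s t h :: real assume "s \<le> t"
    then show "distr lim borel (\<lambda>\<omega>. \<omega> (t + h) - \<omega> (s + h)) = distr lim borel (\<lambda>\<omega>. \<omega> t - \<omega> s)"
      by (intro distr_eq_if_chf_eq[OF pl pl]) (auto simp: incr1)
  next
    fix t :: real
    show "tendsto_in_prob lim (\<lambda>s \<omega>. \<omega> s) (\<lambda>\<omega>. \<omega> t) (at t)"
    proof (rule tendsto_in_prob_if_bounded[where b="\<lambda>s. \<bar>t - s\<bar>" and c="\<lambda>e. 48 * k * e powr (-\<alpha>)"])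
      fix s e :: real assume e: "0 < e"
      have "\<P>(\<omega> in lim. norm (\<omega> s - \<omega> t) > e) \<le> 48 * (\<bar>t - s\<bar> * k) * e powr (-\<alpha>)"
      proof (rule chf_tail_bound[OF pl _ \<alpha> _ _ e])
        fix z
        show "1 - Re (chf lim (\<lambda>\<omega>. z * (\<omega> s - \<omega> t))) \<le> \<bar>t - s\<bar> * k * norm z powr \<alpha>"
          unfolding swap using exp_ge_add_one_self[of "- \<bar>t - s\<bar> * (k * norm z powr \<alpha>)"] by (simp add: mult.assoc)
      qed (use k in auto)
      then show "\<P>(\<omega> in lim. dist (\<omega> s) (\<omega> t) > e) \<le> (48 * k * e powr (-\<alpha>)) * \<bar>t - s\<bar>"
        by (simp add: dist_norm mult_ac)
    next
      show "((\<lambda>s. \<bar>t - s\<bar>) \<longlongrightarrow> 0) (at t)" by (auto intro!: tendsto_eq_intros)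
    qed
  qed (auto intro: pl)
  then show ?thesis using incr1 by blast
qed

section \<open>Powers of the norm and the stable exponent\<close>

lemma dyadic_bracket:
  fixes y :: real
  assumes "1 \<le> y"
  shows "\<exists>n::nat. 2 ^ n \<le> y \<and> y < 2 ^ Suc n"
proof -
  define n where "n = (LEAST n::nat. y < 2 ^ Suc n)"
  obtain m :: nat where "y < real m" using reals_Archimedean2 by blast
  also have "real m < 2 ^ m" by (rule of_nat_less_two_power)
  also have "(2::real) ^ m \<le> 2 ^ Suc m" by simp
  finally have ex: "y < 2 ^ Suc m" .
  have 1: "y < 2 ^ Suc n" unfolding n_def using ex by (rule LeastI)
  have 2: "2 ^ n \<le> y"
  proof (cases n)
    case 0 then show ?thesis using assms by simp
  next
    case (Suc i)
    then have "\<not> y < 2 ^ Suc i" using not_less_Least[of i "\<lambda>n. y < 2 ^ Suc n"] unfolding n_def by simp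
    then show ?thesis using Suc by simp
  qed
  from 1 2 show ?thesis by blast
qed

lemma power_powr_commute: "0 < a \<Longrightarrow> (a ^ n) powr q = (a powr q) ^ n" for a q :: real
  by (induction n) (auto simp: powr_mult)

lemma half_powr: "(1/2) powr p = 2 powr (-p)" for p :: real
  by (simp add: powr_minus_divide powr_divide)

lemma cball_sets_borel [measurable]: "cball (a::'a::metric_space) r \<in> sets borel"
  by (rule borel_closed) (rule closed_cball)

text \<open>
  The power function is dominated by its values on dyadic shells, and the shells sit in balls of volume
  \<open>V * r ^ d\<close>. The two conditions on the exponents make the resulting geometric series converge, near
  the origin and at infinity respectively.
\<close>
lemma integrable_power_profile:
  fixes p q :: real
  assumes p: "- real DIM('a::euclidean_space) < p" and q: "q < - real DIM('a)"
  shows "integrable lborel (\<lambda>x :: 'a. if norm x \<le> 1 then norm x powr p else norm x powr q)"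
proof -
  define d where "d = DIM('a)"
  define V where "V = unit_ball_vol (real d)"
  have V: "0 \<le> V" by (simp add: V_def)
  have vol: "emeasure lborel (cball (0::'a) r) = ennreal (V * r ^ d)" if "0 \<le> r" for r
    using that by (simp add: emeasure_cball V_def d_def)
  \<comment> \<open>Bounds for the power function on the shells \<open>2^(-n-1) < norm x \<le> 2^(-n)\<close> and
    \<open>2^n \<le> norm x < 2^(n+1)\<close>; the factor \<open>2 powr \<bar>p\<bar>\<close> allows for either sign of \<open>p\<close>.\<close>
  define A where "A n = 2 powr \<bar>p\<bar> * (2 powr (-p)) ^ n" for n
  define B where "B n = (2 powr q) ^ n" for n
  define g where "g x = (\<Sum>n. ennreal (A n) * indicator (cball 0 ((1/2)^n)) x) + (\<Sum>n. ennreal (B n) * indicator (cball 0 (2 ^ Suc n)) x)" for x :: 'a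
  have bound: "ennreal (if norm x \<le> 1 then norm x powr p else norm x powr q) \<le> g x" for x :: 'a
  proof -
    have term_le: "f n \<le> suminf f" for f :: "nat \<Rightarrow> ennreal" and n
    proof -
      have "sum f {n} \<le> suminf f" by (intro sum_le_suminf) auto
      then show ?thesis by simp
    qed
    consider "x = 0" | "x \<noteq> 0" "norm x \<le> 1" | "1 < norm x" by fastforce
    then show ?thesis
    proof cases
      case 1 then show ?thesis by simp
    next
      case 2
      have nx: "0 < norm x" using 2 by simp
      have "1 \<le> 1 / norm x" using 2 by (simp add: field_simps)
      then obtain n :: nat where n: "2 ^ n \<le> 1 / norm x" "1 / norm x < 2 ^ Suc n" using dyadic_bracket by blast
      have up: "norm x \<le> (1/2)^n" using n(1) nx by (simp add: field_simps power_one_over)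
      have lo: "(1/2)^Suc n \<le> norm x" using n(2) nx by (simp add: field_simps power_one_over)
      have "norm x powr p \<le> A n"
      proof (cases "0 \<le> p")
        case True
        have "norm x powr p \<le> ((1/2)^n) powr p" using up True by (intro powr_mono2) auto
        also have "\<dots> = (2 powr (-p)) ^ n"
          by (simp only: power_powr_commute half_powr zero_less_divide_1_iff zero_less_numeral)
        also have "\<dots> \<le> A n" unfolding A_def using True ge_one_powr_ge_zero[of 2 "\<bar>p\<bar>"] by (simp add: mult_le_cancel_right1)
        finally show ?thesis .
      next
        case False
        have "norm x powr p \<le> ((1/2)^Suc n) powr p" using lo False by (intro powr_mono2') auto
        also have "\<dots> = (2 powr (-p)) ^ Suc n"
          by (simp only: power_powr_commute half_powr zero_less_divide_1_iff zero_less_numeral)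
        also have "\<dots> = A n" unfolding A_def using False by simp
        finally show ?thesis .
      qed
      then have "ennreal (norm x powr p) \<le> ennreal (A n) * indicator (cball 0 ((1/2)^n)) x"
        using up by (simp add: indicator_def ennreal_leI)
      also have "\<dots> \<le> g x" unfolding g_def by (rule add_increasing2[OF _ term_le]) simp
      finally show ?thesis using 2 by simp
    next
      case 3
      then obtain n :: nat where n: "2 ^ n \<le> norm x" "norm x < 2 ^ Suc n" using dyadic_bracket[of "norm x"] by auto
      have "norm x powr q \<le> (2 ^ n) powr q" using n q by (intro powr_mono2') auto
      also have "\<dots> = B n" by (simp only: B_def power_powr_commute zero_less_numeral)
      finally have "ennreal (norm x powr q) \<le> ennreal (B n) * indicator (cball 0 (2 ^ Suc n)) x"
        using n by (simp add: indicator_def ennreal_leI)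
      also have "\<dots> \<le> g x" unfolding g_def by (rule add_increasing[OF _ term_le]) simp
      finally show ?thesis using 3 by simp
    qed
  qed
  have s1: "(\<Sum>n. ennreal (A n) * ennreal (V * ((1/2)^n) ^ d)) < \<infinity>"
  proof -
    define \<rho> where "\<rho> = 2 powr (-p) * (1/2)^d"
    have \<rho>: "0 \<le> \<rho>" "\<rho> < 1"
    proof -
      have "(1/2::real)^d = 2 powr (- real d)"
        by (simp add: powr_minus_divide powr_realpow power_one_over)
      then have "\<rho> = 2 powr (- p + - real d)" by (simp only: \<rho>_def powr_add)
      also have "\<dots> < 2 powr 0" using p by (intro powr_less_mono) (auto simp: d_def)
      finally show "\<rho> < 1" by simp
    qed (simp add: \<rho>_def)
    have "ennreal (A n) * ennreal (V * ((1/2)^n) ^ d) = ennreal (2 powr \<bar>p\<bar> * V * \<rho> ^ n)" for n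
    proof -
      have "ennreal (A n) * ennreal (V * ((1/2)^n) ^ d) = ennreal (A n * (V * ((1/2)^n) ^ d))"
        using V by (subst ennreal_mult) (auto simp: A_def)
      also have "A n * (V * ((1/2)^n) ^ d) = 2 powr \<bar>p\<bar> * V * \<rho> ^ n"
        by (simp add: A_def \<rho>_def power_mult_distrib power_mult[symmetric] mult.commute[of n d])
      finally show ?thesis .
    qed
    moreover have "(\<Sum>n. ennreal (2 powr \<bar>p\<bar> * V * \<rho> ^ n)) = ennreal (\<Sum>n. 2 powr \<bar>p\<bar> * V * \<rho> ^ n)"
      using V \<rho> by (intro suminf_ennreal2) (auto intro!: summable_mult summable_geometric)
    ultimately show ?thesis by simp
  qed
  have s2: "(\<Sum>n. ennreal (B n) * ennreal (V * (2 ^ Suc n) ^ d)) < \<infinity>"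
  proof -
    define \<rho> where "\<rho> = 2 powr q * 2 ^ d"
    have \<rho>: "0 \<le> \<rho>" "\<rho> < 1"
    proof -
      have "\<rho> = 2 powr (q + real d)" by (simp add: \<rho>_def powr_add powr_realpow)
      also have "\<dots> < 2 powr 0" using q by (intro powr_less_mono) (auto simp: d_def)
      finally show "\<rho> < 1" by simp
    qed (simp add: \<rho>_def)
    have "ennreal (B n) * ennreal (V * (2 ^ Suc n) ^ d) = ennreal (V * 2 ^ d * \<rho> ^ n)" for n
    proof -
      have "ennreal (B n) * ennreal (V * (2 ^ Suc n) ^ d) = ennreal (B n * (V * (2 ^ Suc n) ^ d))"
        using V by (subst ennreal_mult) (auto simp: B_def)
      also have "B n * (V * (2 ^ Suc n) ^ d) = V * 2 ^ d * \<rho> ^ n"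
        by (simp add: B_def \<rho>_def power_mult_distrib power_mult[symmetric] mult.commute[of n d])
      finally show ?thesis .
    qed
    moreover have "(\<Sum>n. ennreal (V * 2 ^ d * \<rho> ^ n)) = ennreal (\<Sum>n. V * 2 ^ d * \<rho> ^ n)"
      using V \<rho> by (intro suminf_ennreal2) (auto intro!: summable_mult summable_geometric)
    ultimately show ?thesis by simp
  qed
  have "(\<integral>\<^sup>+x. g x \<partial>lborel) = (\<Sum>n. ennreal (A n) * ennreal (V * ((1/2)^n) ^ d)) + (\<Sum>n. ennreal (B n) * ennreal (V * (2 ^ Suc n) ^ d))"
    unfolding g_def
    by (subst nn_integral_add) (auto simp: nn_integral_suminf nn_integral_cmult_indicator vol simp del: power_Suc)
  then have "(\<integral>\<^sup>+x. g x \<partial>lborel) < \<infinity>" using s1 s2 by simp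
  moreover have "(\<integral>\<^sup>+x. ennreal (if norm x \<le> 1 then norm x powr p else norm x powr q) \<partial>(lborel :: 'a measure)) \<le> (\<integral>\<^sup>+x. g x \<partial>lborel)"
    by (intro nn_integral_mono bound)
  ultimately show ?thesis
    by (intro integrableI_bounded) (auto simp: if_distrib[of norm] if_distrib[of ennreal] cong: if_cong intro: le_less_trans)
qed

lemma lborel_integral_scale:
  fixes F :: "'a::euclidean_space \<Rightarrow> real"
  assumes [measurable]: "F \<in> borel_measurable borel" and "c \<noteq> 0"
  shows "(\<integral>x. F x \<partial>lborel) = \<bar>c\<bar> ^ DIM('a) * (\<integral>x. F (c *\<^sub>R x) \<partial>lborel)"
proof -
  have "(\<integral>x. F x \<partial>lborel) = (\<integral>x. F x \<partial>(density (distr lborel borel (\<lambda>x. 0 + c *\<^sub>R x)) (\<lambda>_. ennreal (\<bar>c\<bar> ^ DIM('a)))))"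
    using lborel_affine[of c "0::'a"] assms by simp
  also have "\<dots> = \<bar>c\<bar> ^ DIM('a) * (\<integral>x. F (c *\<^sub>R x) \<partial>lborel)"
    using assms by (subst integral_density) (auto simp: integral_distr)
  finally show ?thesis .
qed

text \<open>
  The exponent of the rotation invariant stable law with Levy density \<open>norm y powr (-2 - \<alpha>)\<close>.
\<close>
definition stable_profile :: "real \<Rightarrow> complex \<Rightarrow> real" where
  "stable_profile \<alpha> z = (\<integral>y. (1 - cos (z \<bullet> y)) * norm y powr (-2 - \<alpha>) \<partial>lborel)"

lemma one_minus_cos_le: "1 - cos u \<le> min 2 (u\<^sup>2)" for u :: real
proof -
  have "1 - cos u = 2 * (sin (u/2))\<^sup>2" using cos_double_sin[of "u/2"] by simp
  also have "\<dots> \<le> 2 * (u/2)\<^sup>2"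
    using abs_sin_x_le_abs_x[of "u/2"] unfolding abs_le_square_iff by (intro mult_left_mono) auto
  also have "\<dots> \<le> u\<^sup>2" by (simp add: power2_eq_square)
  finally show ?thesis using cos_ge_minus_one[of u] by linarith
qed

lemma integrable_min_stable:
  assumes "0 < \<alpha>" "\<alpha> < 2"
  shows "integrable lborel (\<lambda>y :: complex. min 1 ((norm y)\<^sup>2) * norm y powr (-2 - \<alpha>))"
proof -
  have "integrable lborel (\<lambda>y :: complex. if norm y \<le> 1 then norm y powr (-\<alpha>) else norm y powr (-2 - \<alpha>))"
    by (rule integrable_power_profile) (use assms in auto)
  moreover have "(if norm y \<le> 1 then norm y powr (-\<alpha>) else norm y powr (-2 - \<alpha>)) = min 1 ((norm y)\<^sup>2) * norm y powr (-2 - \<alpha>)" for y :: complex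
  proof (cases "norm y \<le> 1")
    case True
    have "(norm y)\<^sup>2 \<le> 1" using True by (simp add: power_le_one)
    moreover have "(norm y)\<^sup>2 * norm y powr (-2 - \<alpha>) = norm y powr (-\<alpha>)"
    proof (cases "y = 0")
      case False
      then have "(norm y)\<^sup>2 = norm y powr 2" by (simp add: powr_numeral)
      then have "(norm y)\<^sup>2 * norm y powr (-2 - \<alpha>) = norm y powr (2 + (-2 - \<alpha>))" by (simp only: powr_add)
      then show ?thesis by simp
    qed simp
    ultimately show ?thesis using True by (simp add: min_def)
  next
    case False
    then have "1 \<le> (norm y)\<^sup>2" by (simp add: one_le_power)
    then show ?thesis using False by (simp add: min_def)
  qed
  ultimately show ?thesis by simp
qed

lemma one_minus_cos_inner_le: "1 - cos (z \<bullet> y) \<le> (2 + (norm z)\<^sup>2) * min 1 ((norm y)\<^sup>2)" for z y :: complex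
proof -
  have "1 - cos (z \<bullet> y) \<le> min 2 ((z \<bullet> y)\<^sup>2)" by (rule one_minus_cos_le)
  also have "(z \<bullet> y)\<^sup>2 \<le> (norm z)\<^sup>2 * (norm y)\<^sup>2"
    using Cauchy_Schwarz_ineq2[of z y] by (simp add: abs_le_square_iff[symmetric] power_mult_distrib[symmetric] abs_mult)
  then have "min 2 ((z \<bullet> y)\<^sup>2) \<le> min 2 ((norm z)\<^sup>2 * (norm y)\<^sup>2)" by auto
  also have "\<dots> \<le> (2 + (norm z)\<^sup>2) * min 1 ((norm y)\<^sup>2)"
  proof (cases "(norm y)\<^sup>2 \<le> 1")
    case True
    then show ?thesis by (auto simp: min_def distrib_right intro: order_trans[of _ "(norm z)\<^sup>2 * (norm y)\<^sup>2"])
  next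
    case False
    have "min 2 ((norm z)\<^sup>2 * (norm y)\<^sup>2) \<le> 2 + (norm z)\<^sup>2" by (rule min.coboundedI1) simp
    then show ?thesis using False by (simp add: min.absorb1)
  qed
  finally show ?thesis .
qed

lemma stable_profile_integrable:
  fixes z :: complex
  assumes \<alpha>: "0 < \<alpha>" "\<alpha> < 2"
  shows "integrable lborel (\<lambda>y. (1 - cos (z \<bullet> y)) * norm y powr (-2 - \<alpha>))"
proof (rule Bochner_Integration.integrable_bound[OF integrable_mult_right[OF integrable_min_stable[OF \<alpha>], of "2 + (norm z)\<^sup>2"]])
  show "AE y in lborel. norm ((1 - cos (z \<bullet> y)) * norm y powr (-2 - \<alpha>)) \<le> norm ((2 + (norm z)\<^sup>2) * (min 1 ((norm y)\<^sup>2) * norm y powr (-2 - \<alpha>)))"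
  proof (rule AE_I2)
    fix y
    have "(1 - cos (z \<bullet> y)) * norm y powr (-2 - \<alpha>) \<le> ((2 + (norm z)\<^sup>2) * min 1 ((norm y)\<^sup>2)) * norm y powr (-2 - \<alpha>)"
      by (intro mult_right_mono one_minus_cos_inner_le) auto
    then show "norm ((1 - cos (z \<bullet> y)) * norm y powr (-2 - \<alpha>)) \<le> norm ((2 + (norm z)\<^sup>2) * (min 1 ((norm y)\<^sup>2) * norm y powr (-2 - \<alpha>)))"
      by (simp add: abs_mult)
  qed
qed simp

lemma stable_profile_nonneg: "0 \<le> stable_profile \<alpha> z"
  unfolding stable_profile_def by (intro integral_nonneg_AE AE_I2) auto

text \<open>
  The integrand is positive on the strip \<open>0 < Re y < 1\<close>, which meets the unit square in a set of positive
  measure.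
\<close>
lemma stable_profile_pos:
  assumes \<alpha>: "0 < \<alpha>" "\<alpha> < 2"
  shows "0 < stable_profile \<alpha> 1"
proof (rule ccontr)
  assume "\<not> ?thesis"
  then have "stable_profile \<alpha> 1 = 0" using stable_profile_nonneg[of \<alpha> 1] by simp
  then have "AE y :: complex in lborel. (1 - cos (1 \<bullet> y)) * norm y powr (-2 - \<alpha>) = 0"
    unfolding stable_profile_def using stable_profile_integrable[OF \<alpha>, of 1]
    by (subst (asm) integral_nonneg_eq_0_iff_AE) (auto simp: inner_complex_def)
  then have "AE y in lborel. y \<notin> box 0 (Complex 1 1)"
  proof eventually_elim
    case (elim y)
    show ?case
    proof
      assume "y \<in> box 0 (Complex 1 1)"
      then have y: "0 < Re y" "Re y < 1" by (auto simp: in_box_complex_iff)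
      then have "cos (Re y) < 1" using cos_monotone_0_pi[of 0 "Re y"] pi_gt3 by auto
      moreover have "y \<noteq> 0" using y by auto
      ultimately show False using elim by (simp add: inner_complex_def)
    qed
  qed
  then have "emeasure lborel (box 0 (Complex 1 1)) = 0"
    by (subst (asm) AE_iff_measurable[OF _ refl]) auto
  then show False by (subst (asm) emeasure_lborel_box_eq) (auto simp: Basis_complex_def)
qed

lemma stable_profile_homogeneous:
  assumes "0 < r"
  shows "stable_profile \<alpha> (of_real r * z) = r powr \<alpha> * stable_profile \<alpha> z"
proof -
  have "stable_profile \<alpha> z = \<bar>r\<bar> ^ DIM(complex) * (\<integral>y. (1 - cos (z \<bullet> (r *\<^sub>R y))) * norm (r *\<^sub>R y) powr (-2 - \<alpha>) \<partial>lborel)"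
    unfolding stable_profile_def by (rule lborel_integral_scale) (use assms in auto)
  also have "\<dots> = (\<integral>y. r powr (-\<alpha>) * ((1 - cos ((of_real r * z) \<bullet> y)) * norm y powr (-2 - \<alpha>)) \<partial>lborel)"
  proof -
    have "r\<^sup>2 * r powr (-2 - \<alpha>) = r powr 2 * r powr (-2 - \<alpha>)" using assms by (simp add: powr_numeral)
    also have "\<dots> = r powr (2 + (-2 - \<alpha>))" by (simp only: powr_add)
    finally have r2: "r\<^sup>2 * r powr (-2 - \<alpha>) = r powr (-\<alpha>)" by simp
    have "r\<^sup>2 * ((1 - cos (z \<bullet> (r *\<^sub>R y))) * norm (r *\<^sub>R y) powr (-2 - \<alpha>)) =
          (r\<^sup>2 * r powr (-2 - \<alpha>)) * ((1 - cos ((of_real r * z) \<bullet> y)) * norm y powr (-2 - \<alpha>))" for y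
    proof -
      have "(of_real r * z) \<bullet> y = z \<bullet> (r *\<^sub>R y)" by (simp add: scaleR_conv_of_real[symmetric])
      then show ?thesis using assms by (simp add: powr_mult)
    qed
    then show ?thesis unfolding r2 by (simp flip: Bochner_Integration.integral_mult_right_zero)
  qed
  also have "\<dots> = r powr (-\<alpha>) * stable_profile \<alpha> (of_real r * z)"
    unfolding stable_profile_def by (rule integral_mult_right_zero)
  finally show ?thesis using assms by (simp add: powr_minus field_simps)
qed

lemma levy_exponent_integrable:
  assumes "levy_measure \<nu>"
  shows "integrable \<nu> (\<lambda>x. exp (\<i> * of_real (z \<bullet> x)) - 1 - \<i> * of_real (z \<bullet> x) * indicator (cball 0 1) x)"
    and "integrable \<nu> (\<lambda>x. min 1 ((norm x)\<^sup>2))"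
proof -
  have [measurable_cong]: "sets \<nu> = sets borel" and fin: "(\<integral>\<^sup>+x. ennreal (min 1 ((norm x)\<^sup>2)) \<partial>\<nu>) < \<infinity>"
    using assms by (auto simp: levy_measure_def)
  show i: "integrable \<nu> (\<lambda>x. min 1 ((norm x)\<^sup>2))"
    using fin by (intro integrableI_bounded) auto
  show "integrable \<nu> (\<lambda>x. exp (\<i> * of_real (z \<bullet> x)) - 1 - \<i> * of_real (z \<bullet> x) * indicator (cball 0 1) x)"
  proof (rule Bochner_Integration.integrable_bound[OF integrable_mult_right[OF i, of "2 + (norm z)\<^sup>2"]])
    show "AE x in \<nu>. norm (exp (\<i> * of_real (z \<bullet> x)) - 1 - \<i> * of_real (z \<bullet> x) * indicator (cball 0 1) x) \<le> norm ((2 + (norm z)\<^sup>2) * min 1 ((norm x)\<^sup>2))"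
    proof (rule AE_I2)
      fix x
      show "norm (exp (\<i> * of_real (z \<bullet> x)) - 1 - \<i> * of_real (z \<bullet> x) * indicator (cball 0 1) x) \<le> norm ((2 + (norm z)\<^sup>2) * min 1 ((norm x)\<^sup>2))"
      proof (cases "norm x \<le> 1")
        case True
        have "norm (exp (\<i> * of_real (z \<bullet> x)) - 1 - \<i> * of_real (z \<bullet> x)) \<le> \<bar>z \<bullet> x\<bar>\<^sup>2 / 2"
          using iexp_approx1[of "z \<bullet> x" 1] by (simp add: power2_eq_square algebra_simps)
        also have "\<dots> \<le> (norm z * norm x)\<^sup>2 / 2"
          using Cauchy_Schwarz_ineq2[of z x] by (intro divide_right_mono power_mono) auto
        also have "\<dots> \<le> (2 + (norm z)\<^sup>2) * (norm x)\<^sup>2"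
          by (simp add: power_mult_distrib distrib_right)
        also have "(norm x)\<^sup>2 = min 1 ((norm x)\<^sup>2)" using True by (simp add: min.absorb2 power_le_one)
        finally show ?thesis using True by simp
      next
        case False
        have "norm (exp (\<i> * of_real (z \<bullet> x)) - 1) \<le> 1 + 1"
          by (rule order_trans[OF norm_triangle_ineq4]) simp
        moreover have "1 \<le> (norm x)\<^sup>2" using False by (simp add: one_le_power)
        ultimately show ?thesis using False by (simp add: min.absorb1) (insert zero_le_power2[of "norm z"], linarith)
      qed
    qed
  qed measurable
qed

lemma Re_levy_exponent:
  assumes "levy_measure \<nu>"
  shows "Re (levy_exponent (\<lambda>_. 0) \<nu> \<gamma> z) = - (\<integral>x. 1 - cos (z \<bullet> x) \<partial>\<nu>)"
proof -
  define g where "g x = exp (\<i> * of_real (z \<bullet> x)) - 1 - \<i> * of_real (z \<bullet> x) * indicator (cball 0 1) x" for x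
  have "Re (levy_exponent (\<lambda>_. 0) \<nu> \<gamma> z) = Re (\<integral>x. g x \<partial>\<nu>)"
    unfolding levy_exponent_def g_def by simp
  also have "\<dots> = (\<integral>x. Re (g x) \<partial>\<nu>)"
    using levy_exponent_integrable(1)[OF assms, of z] unfolding g_def by (rule integral_Re[symmetric])
  also have "\<dots> = (\<integral>x. - (1 - cos (z \<bullet> x)) \<partial>\<nu>)"
    unfolding g_def by (intro Bochner_Integration.integral_cong) (auto simp: cis_conv_exp[symmetric] indicator_def)
  also have "\<dots> = - (\<integral>x. 1 - cos (z \<bullet> x) \<partial>\<nu>)" by (rule Bochner_Integration.integral_minus)
  finally show ?thesis .
qed

text \<open>
  A logarithm of a continuous family of exponentials is unambiguous: at \<open>t = pi / \<bar>Im d\<bar>\<close> a nonzero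
  imaginary part \<open>Im d\<close> of the difference would show.
\<close>
lemma exp_times_inject:
  fixes a b :: complex
  assumes "\<And>t. 0 \<le> t \<Longrightarrow> exp (of_real t * a) = exp (of_real t * b)"
  shows "a = b"
proof -
  define d where "d = a - b"
  have e: "exp (of_real t * d) = 1" if "0 \<le> t" for t
    using assms[OF that] by (simp add: d_def right_diff_distrib exp_diff)
  have "norm (exp d) = 1" using e[of 1] by simp
  then have re: "Re d = 0" by simp
  have "Im d = 0"
  proof (rule ccontr)
    assume im: "Im d \<noteq> 0"
    define t where "t = pi / \<bar>Im d\<bar>"
    have "Re (exp (of_real t * d)) = cos (t * Im d)" using re by (simp add: Re_exp)
    also have "t * Im d = pi \<or> t * Im d = - pi" using im by (auto simp: t_def abs_if)
    then have "cos (t * Im d) = -1" by auto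
    finally show False using e[of t] by (simp add: t_def)
  qed
  then show ?thesis using re by (simp add: d_def complex_eq_iff)
qed

lemma levy_measure_stable:
  assumes \<alpha>: "0 < \<alpha>" "\<alpha> < 2" and c: "0 < c"
  shows "levy_measure (density lborel (\<lambda>x. ennreal (c * norm x powr (-2 - \<alpha>))))"
proof -
  have i: "integrable lborel (\<lambda>y :: complex. c * (min 1 ((norm y)\<^sup>2) * norm y powr (-2 - \<alpha>)))"
    by (intro integrable_mult_right integrable_min_stable \<alpha>)
  have "(\<integral>\<^sup>+x. ennreal (min 1 ((norm x)\<^sup>2)) \<partial>density lborel (\<lambda>x :: complex. ennreal (c * norm x powr (-2 - \<alpha>)))) =
      (\<integral>\<^sup>+x. ennreal (c * (min 1 ((norm x)\<^sup>2) * norm x powr (-2 - \<alpha>))) \<partial>(lborel :: complex measure))"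
    using c by (subst nn_integral_density) (auto intro!: nn_integral_cong simp: ennreal_mult'[symmetric] mult_ac)
  also have "\<dots> < \<infinity>"
    using i c by (subst nn_integral_eq_integral) auto
  finally show ?thesis
    unfolding levy_measure_def by (simp add: emeasure_density nn_integral_indicator_singleton)
qed

text \<open>
  The real part is \<open>Re_levy_exponent\<close>, and the imaginary part vanishes because its integrand is odd.
\<close>
lemma levy_exponent_stable:
  assumes \<alpha>: "0 < \<alpha>" "\<alpha> < 2" and c: "0 < c"
  shows "levy_exponent (\<lambda>_. 0) (density lborel (\<lambda>x. ennreal (c * norm x powr (-2 - \<alpha>)))) 0 z = - of_real (c * stable_profile \<alpha> z)"
proof -
  define \<nu> where "\<nu> = density lborel (\<lambda>x :: complex. ennreal (c * norm x powr (-2 - \<alpha>)))"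
  have lm: "levy_measure \<nu>" unfolding \<nu>_def by (rule levy_measure_stable[OF assms])
  define g where "g x = exp (\<i> * of_real (z \<bullet> x)) - 1 - \<i> * of_real (z \<bullet> x) * indicator (cball 0 1) x" for x
  have [measurable]: "g \<in> borel_measurable borel" unfolding g_def by measurable
  have gi: "integrable \<nu> g" unfolding g_def by (rule levy_exponent_integrable(1)[OF lm])
  have "Re (levy_exponent (\<lambda>_. 0) \<nu> 0 z) = - (c * stable_profile \<alpha> z)"
    unfolding Re_levy_exponent[OF lm] unfolding \<nu>_def stable_profile_def using c
    by (subst integral_density) (auto simp: mult_ac)
  moreover have "Im (levy_exponent (\<lambda>_. 0) \<nu> 0 z) = 0"
  proof -
    have dens: "(\<integral>x. Im (g x) \<partial>\<nu>) = (\<integral>x. c * norm x powr (-2 - \<alpha>) * Im (g x) \<partial>lborel)"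
      unfolding \<nu>_def using c by (subst integral_density) auto
    have "(\<integral>x. c * norm x powr (-2 - \<alpha>) * Im (g x) \<partial>lborel) = (\<integral>x. c * norm (- x) powr (-2 - \<alpha>) * Im (g (- x)) \<partial>lborel)"
      using lborel_integral_scale[of "\<lambda>x. c * norm x powr (-2 - \<alpha>) * Im (g x)" "-1"] by simp
    also have "\<dots> = (\<integral>x. - (c * norm x powr (-2 - \<alpha>) * Im (g x)) \<partial>lborel)"
      by (intro Bochner_Integration.integral_cong) (auto simp: g_def Im_exp indicator_def algebra_simps)
    also have "\<dots> = - (\<integral>x. c * norm x powr (-2 - \<alpha>) * Im (g x) \<partial>lborel)" by (rule Bochner_Integration.integral_minus)
    finally have "(\<integral>x. Im (g x) \<partial>\<nu>) = 0" unfolding dens by simp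
    then have "Im (\<integral>x. g x \<partial>\<nu>) = 0" using integral_Im[OF gi] by simp
    then show ?thesis unfolding levy_exponent_def g_def[symmetric] by simp
  qed
  ultimately show ?thesis unfolding \<nu>_def by (simp add: complex_eq_iff)
qed

section \<open>Levy densities with a stable tail\<close>

text \<open>
  Two hypotheses on the density with separate purposes: \<open>tail\<close> identifies the limit of the rescaled
  exponent, \<open>bound\<close> supplies the dominating function.
\<close>
locale stable_tail_density =
  fixes f :: "complex \<Rightarrow> real" and \<alpha> c0 C :: real
  assumes \<alpha>: "0 < \<alpha>" "\<alpha> < 2" and fm[measurable]: "f \<in> borel_measurable borel" and f0: "\<And>x. 0 \<le> f x"
    and c0: "0 < c0" and C: "0 < C"
    and tail: "((\<lambda>x. f x / (c0 * norm x powr (-2 - \<alpha>))) \<longlongrightarrow> 1) at_infinity"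
    and bound: "\<And>x. x \<noteq> 0 \<Longrightarrow> f x \<le> C * norm x powr (-2 - \<alpha>)"
begin

definition psi :: "complex \<Rightarrow> real" where
  "psi z = (\<integral>x. f x * (1 - cos (z \<bullet> x)) \<partial>lborel)"

lemma psi_nonneg: "0 \<le> psi z"
  unfolding psi_def by (intro integral_nonneg_AE AE_I2) (auto simp: f0)

lemma AE_nonzero: "AE x :: complex in lborel. x \<noteq> 0"
  using AE_lborel_singleton[of 0] by simp

lemma psi_le: "psi z \<le> C * stable_profile \<alpha> z"
proof -
  have i: "integrable lborel (\<lambda>y. C * ((1 - cos (z \<bullet> y)) * norm y powr (-2 - \<alpha>)))"
    by (intro integrable_mult_right stable_profile_integrable \<alpha>)
  have ae: "AE x in lborel. f x * (1 - cos (z \<bullet> x)) \<le> C * ((1 - cos (z \<bullet> x)) * norm x powr (-2 - \<alpha>))"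
    using AE_nonzero
  proof eventually_elim
    case (elim x)
    have "f x * (1 - cos (z \<bullet> x)) \<le> (C * norm x powr (-2 - \<alpha>)) * (1 - cos (z \<bullet> x))"
      by (intro mult_right_mono bound elim) auto
    then show ?case by (simp add: mult_ac)
  qed
  have "integrable lborel (\<lambda>x. f x * (1 - cos (z \<bullet> x)))"
    by (rule Bochner_Integration.integrable_bound[OF i]) (use ae C in \<open>auto simp: f0 abs_mult abs_of_pos elim!: eventually_mono\<close>)
  then show ?thesis
    unfolding psi_def stable_profile_def using i ae
    by (subst integral_mult_right_zero[symmetric]) (rule integral_mono_AE)
qed

text \<open>
  Rescaling the frequency by \<open>r\<close> is rescaling the jumps by \<open>1/r\<close>.
\<close>
lemma psi_rescaled:
  assumes "0 < r"
  shows "psi (of_real r * z) = (\<integral>y. (1 - cos (z \<bullet> y)) * (f (y /\<^sub>R r) / r\<^sup>2) \<partial>lborel)"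
proof -
  have "(\<integral>y. (1 - cos (z \<bullet> y)) * (f (y /\<^sub>R r) / r\<^sup>2) \<partial>lborel) =
      \<bar>r\<bar> ^ DIM(complex) * (\<integral>x. (1 - cos (z \<bullet> (r *\<^sub>R x))) * (f ((r *\<^sub>R x) /\<^sub>R r) / r\<^sup>2) \<partial>lborel)"
    by (rule lborel_integral_scale) (use assms in auto)
  also have "\<dots> = (\<integral>x. r\<^sup>2 * ((1 - cos (z \<bullet> (r *\<^sub>R x))) * (f ((r *\<^sub>R x) /\<^sub>R r) / r\<^sup>2)) \<partial>lborel)"
    by simp
  also have "\<dots> = psi (of_real r * z)"
    unfolding psi_def using assms
    by (intro Bochner_Integration.integral_cong) (auto simp: scaleR_conv_of_real[symmetric])
  finally show ?thesis by simp
qed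

text \<open>
  After the substitution the integrand contains \<open>f (y / r)\<close> with \<open>y / r\<close> tending to infinity, where
  \<open>f\<close> is asymptotically \<open>c0 * norm x powr (-2 - \<alpha>)\<close>; this power is homogeneous of the degree that
  cancels the normalisation. The bound on \<open>f\<close> is homogeneous in the same way and dominates.
\<close>
lemma psi_scaling_limit:
  "((\<lambda>r. psi (of_real r * z) / r powr \<alpha>) \<longlongrightarrow> c0 * stable_profile \<alpha> z) (at_right 0)"
proof (rule tendsto_at_right_sequentially[of 0 1])
  fix s :: "nat \<Rightarrow> real" assume s: "\<And>n. 0 < s n" "decseq s" "s \<longlonglongrightarrow> 0"
  define F where "F n y = (1 - cos (z \<bullet> y)) * (f (y /\<^sub>R s n) / (s n)\<^sup>2) / s n powr \<alpha>" for n y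
  \<comment> \<open>The Jacobian \<open>r\<^sup>2\<close> and the normalisation \<open>r powr \<alpha>\<close> together cancel the homogeneity of the density.\<close>
  have hom: "norm (y /\<^sub>R r) powr (-2 - \<alpha>) / r\<^sup>2 / r powr \<alpha> = norm y powr (-2 - \<alpha>)" if "0 < r" for r and y :: complex
  proof -
    have "r powr (-2 - \<alpha>) = inverse (r powr (2 + \<alpha>))"
      by (simp flip: powr_minus)
    also have "r powr (2 + \<alpha>) = r\<^sup>2 * r powr \<alpha>"
      using that by (simp add: powr_add powr_numeral)
    finally have "norm (y /\<^sub>R r) powr (-2 - \<alpha>) = norm y powr (-2 - \<alpha>) * (r\<^sup>2 * r powr \<alpha>)"
      using that by (simp add: divide_inverse[symmetric] mult.commute[of "inverse r"] powr_divide field_simps)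
    then show ?thesis using that by simp
  qed
  have "(\<lambda>n. \<integral>y. F n y \<partial>lborel) \<longlonglongrightarrow> (\<integral>y. c0 * ((1 - cos (z \<bullet> y)) * norm y powr (-2 - \<alpha>)) \<partial>lborel)"
  proof (rule integral_dominated_convergence[where w="\<lambda>y. C * ((1 - cos (z \<bullet> y)) * norm y powr (-2 - \<alpha>))"])
    show "integrable lborel (\<lambda>y. C * ((1 - cos (z \<bullet> y)) * norm y powr (-2 - \<alpha>)))"
      by (intro integrable_mult_right stable_profile_integrable \<alpha>)
    show "AE y in lborel. norm (F n y) \<le> C * ((1 - cos (z \<bullet> y)) * norm y powr (-2 - \<alpha>))" for n
      using AE_nonzero
    proof eventually_elim
      case (elim y)
      have "F n y \<le> (1 - cos (z \<bullet> y)) * (C * norm (y /\<^sub>R s n) powr (-2 - \<alpha>) / (s n)\<^sup>2) / s n powr \<alpha>"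
        unfolding F_def using elim s(1)[of n]
        by (intro divide_right_mono mult_left_mono bound) auto
      also have "\<dots> = C * ((1 - cos (z \<bullet> y)) * (norm (y /\<^sub>R s n) powr (-2 - \<alpha>) / (s n)\<^sup>2 / s n powr \<alpha>))" by simp
      also have "\<dots> = C * ((1 - cos (z \<bullet> y)) * norm y powr (-2 - \<alpha>))" by (subst hom[OF s(1)]) simp
      finally show ?case using f0 by (simp add: F_def)
    qed
    show "AE y in lborel. (\<lambda>n. F n y) \<longlonglongrightarrow> c0 * ((1 - cos (z \<bullet> y)) * norm y powr (-2 - \<alpha>))"
      using AE_nonzero
    proof eventually_elim
      case (elim y)
      have "filterlim (\<lambda>n. y /\<^sub>R s n) at_infinity sequentially"
      proof -
        have "filterlim (\<lambda>n. inverse (s n)) at_top sequentially"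
          using s by (intro filterlim_inverse_at_top) auto
        then have "filterlim (\<lambda>n. norm (y /\<^sub>R s n)) at_top sequentially"
          using elim s(1) filterlim_tendsto_pos_mult_at_top[OF tendsto_const, of "norm y" "\<lambda>n. inverse (s n)"]
          by (simp add: abs_of_pos mult.commute)
        then show ?thesis by (simp add: filterlim_at_infinity_conv_norm_at_top)
      qed
      then have lim: "(\<lambda>n. f (y /\<^sub>R s n) / (c0 * norm (y /\<^sub>R s n) powr (-2 - \<alpha>))) \<longlonglongrightarrow> 1"
        by (rule filterlim_compose[OF tail])
      have "F n y = (1 - cos (z \<bullet> y)) * (c0 * norm y powr (-2 - \<alpha>)) * (f (y /\<^sub>R s n) / (c0 * norm (y /\<^sub>R s n) powr (-2 - \<alpha>)))" for n
      proof -
        have "norm (y /\<^sub>R s n) powr (-2 - \<alpha>) \<noteq> 0" using elim s(1)[of n] by simp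
        then show ?thesis unfolding F_def using c0 by (subst hom[OF s(1)[of n], symmetric]) simp
      qed
      moreover have "(\<lambda>n. (1 - cos (z \<bullet> y)) * (c0 * norm y powr (-2 - \<alpha>)) * (f (y /\<^sub>R s n) / (c0 * norm (y /\<^sub>R s n) powr (-2 - \<alpha>))))
         \<longlonglongrightarrow> (1 - cos (z \<bullet> y)) * (c0 * norm y powr (-2 - \<alpha>)) * 1"
        by (intro tendsto_mult_left lim)
      ultimately show ?case by (simp add: mult_ac)
    qed
  qed (auto simp: F_def)
  moreover have "(\<integral>y. F n y \<partial>lborel) = psi (of_real (s n) * z) / s n powr \<alpha>" for n
    unfolding psi_rescaled[OF s(1)] F_def by simp
  ultimately show "(\<lambda>n. psi (of_real (s n) * z) / s n powr \<alpha>) \<longlonglongrightarrow> c0 * stable_profile \<alpha> z"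
    unfolding stable_profile_def by simp
qed simp

end

section \<open>The harmonizable kernel\<close>

lemma hf_kernel_measurable [measurable]: "hf_kernel \<alpha> H a b t \<in> borel_measurable borel"
  unfolding hf_kernel_def by measurable

text \<open>
  With \<open>\<beta> = 1 - H - 1/\<alpha>\<close> the kernel is bounded by a constant times \<open>\<bar>s\<bar> powr \<beta>\<close> near the origin, where
  \<open>\<bar>exp (\<i> t s) - 1\<bar> \<le> \<bar>t s\<bar>\<close>, and times \<open>\<bar>s\<bar> powr (\<beta> - 1)\<close> at infinity, where this modulus is at
  most \<open>2\<close>. The \<open>\<alpha>\<close>-th powers have the exponents \<open>\<alpha> * (1 - H) - 1 > -1\<close> and \<open>- \<alpha> * H - 1 < -1\<close>.
\<close>
lemma hf_kernel_apow_finite: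
  assumes \<alpha>: "0 < \<alpha>" and H: "0 < H" "H < 1"
  shows "apow \<alpha> (hf_kernel \<alpha> H a b t) < \<infinity>"
proof -
  define \<beta> where "\<beta> = -H - 1/\<alpha> + 1"
  define D where "D = ((\<bar>t\<bar> + 2) * (\<bar>a\<bar> + \<bar>b\<bar>)) powr \<alpha>"
  have p: "\<beta> * \<alpha> = \<alpha> * (1 - H) - 1" using \<alpha> by (simp add: \<beta>_def field_simps)
  have q: "(\<beta> - 1) * \<alpha> = - \<alpha> * H - 1" using \<alpha> by (simp add: \<beta>_def field_simps)
  have int: "integrable lborel (\<lambda>s :: real. if norm s \<le> 1 then norm s powr (\<beta> * \<alpha>) else norm s powr ((\<beta> - 1) * \<alpha>))"
    by (rule integrable_power_profile) (use \<alpha> H in \<open>simp_all add: p q\<close>)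
  have bound: "norm (hf_kernel \<alpha> H a b t s) powr \<alpha> \<le> D * (if norm s \<le> 1 then norm s powr (\<beta> * \<alpha>) else norm s powr ((\<beta> - 1) * \<alpha>))" for s
  proof (cases "s = 0")
    case True
    then show ?thesis by (simp add: hf_kernel_def)
  next
    case s: False
    define w where "w = a * (max s 0) powr \<beta> + b * (- min s 0) powr \<beta>"
    have "\<bar>w\<bar> \<le> \<bar>a\<bar> * \<bar>s\<bar> powr \<beta> + \<bar>b\<bar> * \<bar>s\<bar> powr \<beta>"
      unfolding w_def using s by (cases "0 < s") (auto simp: abs_mult)
    then have w: "\<bar>w\<bar> \<le> (\<bar>a\<bar> + \<bar>b\<bar>) * \<bar>s\<bar> powr \<beta>" by (simp add: distrib_right)
    define u where "u = (exp (\<i> * of_real (t * s)) - 1) / (\<i> * of_real s)"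
    have e1: "norm (exp (\<i> * of_real (t * s)) - 1) \<le> \<bar>t * s\<bar>" using iexp_approx1[of "t * s" 0] by simp
    have e2: "norm (exp (\<i> * of_real (t * s)) - 1) \<le> 2"
      by (rule order_trans[OF norm_triangle_ineq4]) simp
    have u: "norm u \<le> (\<bar>t\<bar> + 2) * (if norm s \<le> 1 then 1 else \<bar>s\<bar> powr (-1))"
    proof (cases "\<bar>s\<bar> \<le> 1")
      case True
      have "norm u \<le> \<bar>t\<bar>" unfolding u_def norm_divide using e1 s by (simp add: norm_mult abs_mult field_simps)
      then show ?thesis using True by simp
    next
      case False
      have "norm u \<le> 2 / \<bar>s\<bar>" unfolding u_def norm_divide using e2 s by (simp add: norm_mult divide_right_mono)
      also have "\<dots> \<le> (\<bar>t\<bar> + 2) / \<bar>s\<bar>" by (intro divide_right_mono) auto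
      finally show ?thesis using False s by (simp add: powr_minus_divide)
    qed
    have "norm (hf_kernel \<alpha> H a b t s) = norm u * \<bar>w\<bar>"
      unfolding hf_kernel_def u_def w_def \<beta>_def norm_mult norm_of_real ..
    also have "\<dots> \<le> ((\<bar>t\<bar> + 2) * (if norm s \<le> 1 then 1 else \<bar>s\<bar> powr (-1))) * ((\<bar>a\<bar> + \<bar>b\<bar>) * \<bar>s\<bar> powr \<beta>)"
      by (intro mult_mono u w) auto
    also have "\<dots> = ((\<bar>t\<bar> + 2) * (\<bar>a\<bar> + \<bar>b\<bar>)) * (if norm s \<le> 1 then norm s powr \<beta> else norm s powr (\<beta> - 1))"
      using s by (simp add: powr_diff powr_minus_divide)
    finally have "norm (hf_kernel \<alpha> H a b t s) powr \<alpha> \<le> (((\<bar>t\<bar> + 2) * (\<bar>a\<bar> + \<bar>b\<bar>)) * (if norm s \<le> 1 then norm s powr \<beta> else norm s powr (\<beta> - 1))) powr \<alpha>"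
      using \<alpha> by (intro powr_mono2) auto
    also have "\<dots> = D * (if norm s \<le> 1 then norm s powr (\<beta> * \<alpha>) else norm s powr ((\<beta> - 1) * \<alpha>))"
      by (simp add: D_def powr_mult powr_powr)
    finally show ?thesis .
  qed
  have "apow \<alpha> (hf_kernel \<alpha> H a b t) \<le> (\<integral>\<^sup>+s. ennreal (D * (if norm s \<le> 1 then norm s powr (\<beta> * \<alpha>) else norm s powr ((\<beta> - 1) * \<alpha>))) \<partial>(lborel :: real measure))"
    unfolding apow_def by (intro nn_integral_mono ennreal_leI bound)
  also have "\<dots> = ennreal (\<integral>s. D * (if norm s \<le> 1 then norm s powr (\<beta> * \<alpha>) else norm s powr ((\<beta> - 1) * \<alpha>)) \<partial>(lborel :: real measure))"
    by (intro nn_integral_eq_integral integrable_mult_right int) (auto simp: D_def)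
  finally show ?thesis by (simp add: le_less_trans)
qed

text \<open>
  The exponential only depends on the product of time and frequency; the factor \<open>1/s\<close> contributes
  \<open>\<epsilon>\<close> and the power of \<open>s\<close> contributes \<open>\<epsilon> powr (H + 1/\<alpha> - 1)\<close>.
\<close>
lemma hf_kernel_scaling:
  assumes "0 < \<epsilon>"
  shows "hf_kernel \<alpha> H a b (\<epsilon> * t) (r / \<epsilon>) = of_real (\<epsilon> powr (H + 1/\<alpha>)) * hf_kernel \<alpha> H a b t r"
proof -
  define \<beta> where "\<beta> = -H - 1/\<alpha> + 1"
  have m: "max (r / \<epsilon>) 0 = max r 0 / \<epsilon>" "- min (r / \<epsilon>) 0 = - min r 0 / \<epsilon>"
    using assms by (auto simp: max_def min_def zero_le_divide_iff divide_le_0_iff)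
  have pd: "(x / \<epsilon>) powr \<beta> = x powr \<beta> * \<epsilon> powr (-\<beta>)" if "0 \<le> x" for x
    using assms that by (simp add: powr_divide powr_minus_divide)
  have "\<epsilon> * \<epsilon> powr (-\<beta>) = \<epsilon> powr (1 + (-\<beta>))" using assms by (simp only: powr_add) simp
  also have "1 + (-\<beta>) = H + 1/\<alpha>" by (simp add: \<beta>_def)
  finally have e: "\<epsilon> powr (H + 1/\<alpha>) = \<epsilon> * \<epsilon> powr (-\<beta>)" ..
  have "hf_kernel \<alpha> H a b (\<epsilon> * t) (r / \<epsilon>) = (exp (\<i> * of_real (t * r)) - 1) / (\<i> * of_real (r / \<epsilon>)) *
     of_real ((a * (max r 0) powr \<beta> + b * (- min r 0) powr \<beta>) * \<epsilon> powr (-\<beta>))"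
    unfolding hf_kernel_def \<beta>_def[symmetric] m using assms
    by (subst pd, simp, subst pd, simp) (simp add: algebra_simps)
  also have "\<dots> = of_real (\<epsilon> powr (H + 1/\<alpha>)) * hf_kernel \<alpha> H a b t r"
    unfolding e hf_kernel_def \<beta>_def[symmetric] using assms by simp
  finally show ?thesis .
qed

section \<open>The exponent of a rotation invariant Levy process\<close>

lemma cos_inner_eq_Re: "Re (z * x) = cnj z \<bullet> x"
  by (simp add: inner_complex_def)

lemma isCont_cis: "isCont cis x"
proof -
  have "continuous_on UNIV cis" by (intro continuous_intros)
  then show ?thesis by (simp add: continuous_on_eq_continuous_at)
qed

lemma isCont_chf_scale:
  assumes P: "prob_space P" and [measurable]: "Y \<in> borel_measurable P"
  shows "isCont (\<lambda>z. chf P (\<lambda>\<omega>. z * Y \<omega>)) z"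
  unfolding continuous_at_sequentially comp_def chf_def
proof (intro allI impI)
  interpret prob_space P by fact
  fix x assume x: "x \<longlonglongrightarrow> z"
  show "(\<lambda>n. CLINT \<omega>|P. cis (Re (x n * Y \<omega>))) \<longlonglongrightarrow> (CLINT \<omega>|P. cis (Re (z * Y \<omega>)))"
    by (rule integral_dominated_convergence[where w="\<lambda>_. 1"])
      (auto intro!: AE_I2 isCont_tendsto_compose[OF isCont_cis] tendsto_intros x simp del: times_complex.simps)
qed

context stable_tail_density
begin

definition density_measure :: "complex measure" where
  "density_measure = density lborel (\<lambda>x. ennreal (f x))"

lemma integral_one_minus_cos: "(\<integral>x. 1 - cos (z \<bullet> x) \<partial>density_measure) = psi z"
  unfolding density_measure_def psi_def using f0 by (subst integral_density) auto

text \<open>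
  Rotation of \<open>L t\<close> is rotation of the frequency, so the complex exponent \<open>\<Phi>\<close> is radial; here the
  exponents, and not only their exponentials, agree by \<open>exp_times_inject\<close>. In particular \<open>\<Phi>\<close> is even,
  whereas \<open>z \<mapsto> -z\<close> conjugates it, so it is real and equal to its real part \<open>- psi (cnj z)\<close>. The
  conjugation stems from \<open>Re (z * x) = cnj z \<bullet> x\<close>.
\<close>
lemma rot_invariant_chf:
  assumes levy: "levy_process P L" and rot: "rot_invariant_process P L"
    and trip: "has_levy_triplet P L (\<lambda>_. 0) density_measure \<gamma>"
  shows chf_L_eq_psi: "0 \<le> t \<Longrightarrow> chf P (\<lambda>\<omega>. z * L t \<omega>) = of_real (exp (- t * psi (cnj z)))"
    and psi_radial: "norm v = norm w \<Longrightarrow> psi v = psi w"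
proof -
  define \<Phi> where "\<Phi> z = levy_exponent (\<lambda>_. 0) density_measure \<gamma> (cnj z)" for z
  have [measurable]: "L t \<in> borel_measurable P" for t using levy by (simp add: levy_process_def)
  have lm: "levy_measure density_measure" using trip by (simp add: has_levy_triplet_def)
  have chf: "chf P (\<lambda>\<omega>. z * L t \<omega>) = exp (of_real t * \<Phi> z)" if "0 \<le> t" for t z
    using trip that unfolding has_levy_triplet_def chf_def \<Phi>_def cos_inner_eq_Re cis_conv_exp by blast
  have ReP: "Re (\<Phi> z) = - psi (cnj z)" for z
    unfolding \<Phi>_def Re_levy_exponent[OF lm] integral_one_minus_cos ..
  have turn: "\<Phi> (z * exp (\<i> * of_real \<theta>)) = \<Phi> z" if \<theta>: "\<theta> \<in> {0..<2*pi}" for z \<theta>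
  proof (rule exp_times_inject)
    fix t :: real assume t: "0 \<le> t"
    have "rot_invariant P (\<lambda>\<omega>. \<Sum>n<1::nat. 1 * L t \<omega>)"
      using rot unfolding rot_invariant_process_def by (elim allE[of _ 1] allE[of _ "\<lambda>_. 1"] allE[of _ "\<lambda>_. t"])
    then have d: "distr P borel (\<lambda>\<omega>. exp (\<i> * of_real \<theta>) * L t \<omega>) = distr P borel (L t)"
      using \<theta> unfolding rot_invariant_def by simp
    have "chf P (\<lambda>\<omega>. (z * exp (\<i> * of_real \<theta>)) * L t \<omega>) = chf (distr P borel (\<lambda>\<omega>. exp (\<i> * of_real \<theta>) * L t \<omega>)) (\<lambda>x. z * x)"
      by (subst chf_distr) (auto simp: mult.assoc)
    also have "\<dots> = chf P (\<lambda>\<omega>. z * L t \<omega>)" unfolding d by (subst chf_distr) auto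
    finally show "exp (of_real t * \<Phi> (z * exp (\<i> * of_real \<theta>))) = exp (of_real t * \<Phi> z)"
      unfolding chf[OF t] .
  qed
  have rad: "\<Phi> z = \<Phi> w" if n: "norm z = norm w" for z w
  proof (cases "z = 0")
    case True
    then show ?thesis using n by simp
  next
    case False
    have "w \<noteq> 0" using False n by auto
    then have "norm (w / z) = 1" using False n by (simp add: norm_divide)
    then have "w / z = exp (\<i> * of_real (Arg2pi (w / z)))" using Arg2pi_eq[of "w / z"] by simp
    then have "w = z * exp (\<i> * of_real (Arg2pi (w / z)))" using False by (simp add: field_simps)
    then show ?thesis using turn[of "Arg2pi (w / z)" z] Arg2pi_ge_0[of "w / z"] Arg2pi_lt_2pi[of "w / z"] by auto
  qed
  show "psi v = psi w" if "norm v = norm w" for v w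
    using rad[of "cnj v" "cnj w"] that ReP[of "cnj v"] ReP[of "cnj w"] by simp
  have "\<Phi> (- z) = cnj (\<Phi> z)" for z
  proof (rule exp_times_inject)
    fix t :: real assume t: "0 \<le> t"
    have "exp (of_real t * \<Phi> (- z)) = cnj (exp (of_real t * \<Phi> z))"
      using chf_minus[of "\<lambda>\<omega>. z * L t \<omega>" P] chf[OF t, of "- z"] chf[OF t, of z] by simp
    then show "exp (of_real t * \<Phi> (- z)) = exp (of_real t * cnj (\<Phi> z))" by (simp add: exp_cnj)
  qed
  then have "cnj (\<Phi> z) = \<Phi> z" for z using rad[of "- z" z] by simp
  then have "Im (\<Phi> z) = 0" for z by (metis complex_cnj_cancel_iff cnj.sel(2) add.inverse_neutral equal_neg_zero)
  then have real: "\<Phi> z = of_real (- psi (cnj z))" for z using ReP[of z] by (simp add: complex_eq_iff)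
  show "chf P (\<lambda>\<omega>. z * L t \<omega>) = of_real (exp (- t * psi (cnj z)))" if "0 \<le> t" for t z
    unfolding chf[OF that] real by (simp flip: exp_of_real)
qed

text \<open>
  The stable exponent inherits radial symmetry from \<open>psi\<close> through the scaling limit, and the power law from
  its homogeneity.
\<close>
lemma stable_profile_radial:
  assumes rad: "\<And>v w. norm v = norm w \<Longrightarrow> psi v = psi w"
  shows "stable_profile \<alpha> z = stable_profile \<alpha> 1 * norm z powr \<alpha>"
proof (cases "z = 0")
  case True
  then show ?thesis by (simp add: stable_profile_def)
next
  case False
  define u where "u = z / of_real (norm z)"
  have u: "norm u = 1" using False by (simp add: u_def norm_divide)
  have "psi (of_real r * u) = psi (of_real r * 1)" for r by (rule rad) (simp add: norm_mult u)
  then have "c0 * stable_profile \<alpha> u = c0 * stable_profile \<alpha> 1"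
    using tendsto_unique[OF _ psi_scaling_limit[of u], of "c0 * stable_profile \<alpha> 1"] psi_scaling_limit[of 1] by simp
  then have "stable_profile \<alpha> u = stable_profile \<alpha> 1" using c0 by simp
  moreover have "z = of_real (norm z) * u" using False by (simp add: u_def)
  ultimately show ?thesis using stable_profile_homogeneous[of "norm z" \<alpha> u] False by (simp add: mult.commute)
qed

end

section \<open>The tangent process\<close>

locale rot_levy = stable_tail_density f \<alpha> c0 C for f \<alpha> c0 C +
  fixes P :: "'a measure" and L \<gamma>
  assumes levyL: "levy_process P L" and rotL: "rot_invariant_process P L"
    and tripL: "has_levy_triplet P L (\<lambda>_. 0) density_measure \<gamma>"
begin

abbreviation \<kappa> :: real where "\<kappa> \<equiv> stable_profile \<alpha> 1"

lemma prob_P: "prob_space P" and L_meas [measurable]: "L t \<in> borel_measurable P"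
  using levyL by (auto simp: levy_process_def)

lemma profile_eq: "stable_profile \<alpha> z = \<kappa> * norm z powr \<alpha>"
  by (rule stable_profile_radial) (rule psi_radial[OF levyL rotL tripL])

lemma psi_bound: "psi z \<le> (C * \<kappa>) * norm z powr \<alpha>"
  using psi_le[of z] unfolding profile_eq[of z] by (simp add: mult.assoc)

lemma psi_cnj: "psi (cnj z) = psi z"
  by (rule psi_radial[OF levyL rotL tripL]) simp

lemma chf_L: "0 \<le> t \<Longrightarrow> chf P (\<lambda>\<omega>. z * L t \<omega>) = of_real (exp (- t * psi z))"
  using chf_L_eq_psi[OF levyL rotL tripL] by (simp add: psi_cnj)

lemma psi_scaling: "((\<lambda>r. psi (of_real r * z) / r powr \<alpha>) \<longlongrightarrow> (c0 * \<kappa>) * norm z powr \<alpha>) (at_right 0)"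
  using psi_scaling_limit[of z] unfolding profile_eq[of z] by (simp add: mult.assoc)

text \<open>
  \<open>psi\<close> is minus the logarithm of a positive characteristic function.
\<close>
lemma continuous_psi: "continuous_on UNIV psi"
proof -
  have "psi z = - ln (Re (chf P (\<lambda>\<omega>. z * L 1 \<omega>)))" for z
    by (subst chf_L) simp_all
  then have eq: "psi = (\<lambda>z. - ln (Re (chf P (\<lambda>\<omega>. z * L 1 \<omega>))))" by blast
  have pos: "Re (chf P (\<lambda>\<omega>. z * L 1 \<omega>)) \<noteq> 0" for z by (subst chf_L) simp_all
  show ?thesis
    unfolding eq
    by (intro continuous_intros continuous_at_imp_continuous_on ballI isCont_chf_scale[OF prob_P] isCont_ln isCont_minus
        isCont_o2[of _ "\<lambda>z. Re (chf P (\<lambda>\<omega>. z * L 1 \<omega>))" ln] pos continuous_Re) (auto intro: L_meas)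
qed

sublocale N: levy_noise P L psi \<alpha> "C * \<kappa>"
  by (intro levy_noise.intro levyL \<alpha> psi_nonneg psi_bound continuous_psi chf_L)

lemma kernel_La: "0 < H \<Longrightarrow> H < 1 \<Longrightarrow> N.La (hf_kernel \<alpha> H a b t)"
  unfolding N.La_def using hf_kernel_apow_finite[OF \<alpha>(1)] by auto

text \<open>
  The stable law is the limit of the laws of \<open>n^(-1/\<alpha>) L_n\<close>: their exponents are
  \<open>n psi(n^(-1/\<alpha>) z)\<close>, which converges by \<open>psi_scaling\<close>, and \<open>psi_bound\<close> gives a tail bound that is
  uniform in \<open>n\<close>.
\<close>
lemma stable_law_exists:
  "\<exists>\<mu>. prob_space \<mu> \<and> sets \<mu> = sets borel \<and>
     (\<forall>z. chf \<mu> (\<lambda>x. z * x) = complex_of_real (exp (- ((c0 * \<kappa>) * norm z powr \<alpha>))))"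
proof -
  \<comment> \<open>Shifted by one to keep the index positive.\<close>
  define s where "s n = real (Suc n) powr (-1/\<alpha>)" for n
  have s: "0 < s n" "s n powr \<alpha> = 1 / real (Suc n)" for n
  proof -
    show "0 < s n" by (simp add: s_def)
    have "s n powr \<alpha> = real (Suc n) powr (-1/\<alpha> * \<alpha>)" by (simp only: s_def powr_powr)
    also have "-1/\<alpha> * \<alpha> = -1" using \<alpha> by simp
    finally show "s n powr \<alpha> = 1 / real (Suc n)" by (simp add: powr_minus_divide)
  qed
  have s0: "filterlim s (at_right 0) sequentially"
  proof -
    have "s \<longlonglongrightarrow> 0"
      unfolding s_def using \<alpha>
      by (intro tendsto_neg_powr filterlim_compose[OF filterlim_real_sequentially filterlim_Suc]) auto
    moreover have "s n \<noteq> 0" for n using s(1)[of n] by simp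
    ultimately show ?thesis using s(1) by (auto simp: filterlim_at)
  qed
  define X where "X n \<omega> = of_real (s n) * L (real (Suc n)) \<omega>" for n \<omega>
  have [measurable]: "X n \<in> borel_measurable P" for n unfolding X_def by measurable
  have chfX: "chf P (\<lambda>\<omega>. z * X n \<omega>) = of_real (exp (- (psi (of_real (s n) * z) / s n powr \<alpha>)))" for n z
    using chf_L[of "real (Suc n)" "of_real (s n) * z"] by (simp add: X_def s(2) algebra_simps)
  show ?thesis
  proof (rule isotropic_limit_law[OF prob_P, where X=X and \<alpha>=\<alpha> and c="48 * (C * \<kappa>)" and \<psi>="\<lambda>r. complex_of_real (exp (- ((c0 * \<kappa>) * r powr \<alpha>)))"
        and \<phi>="\<lambda>n r. complex_of_real (exp (- (psi (of_real (s n) * of_real r) / s n powr \<alpha>)))"])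
    show "chf P (\<lambda>\<omega>. z * X n \<omega>) = complex_of_real (exp (- (psi (of_real (s n) * of_real (norm z)) / s n powr \<alpha>)))" for n z
      unfolding chfX by (subst psi_radial[OF levyL rotL tripL, of _ "of_real (s n) * of_real (norm z)"]) (simp_all add: norm_mult)
    show "(\<lambda>n. complex_of_real (exp (- (psi (of_real (s n) * of_real r) / s n powr \<alpha>)))) \<longlonglongrightarrow> complex_of_real (exp (- ((c0 * \<kappa>) * r powr \<alpha>)))" if "0 \<le> r" for r
      using filterlim_compose[OF psi_scaling[of "of_real r"] s0] that by (intro tendsto_intros) (simp add: comp_def)
    show "\<P>(\<omega> in P. norm (X n \<omega>) > e) \<le> 48 * (C * \<kappa>) * e powr (-\<alpha>)" if "0 < e" for n e
    proof (rule chf_tail_bound[OF prob_P _ \<alpha> N.K_nonneg _ that])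
      fix z
      have "1 - exp (- (psi (of_real (s n) * z) / s n powr \<alpha>)) \<le> psi (of_real (s n) * z) / s n powr \<alpha>"
        using exp_ge_add_one_self[of "- (psi (of_real (s n) * z) / s n powr \<alpha>)"] by linarith
      also have "\<dots> \<le> ((C * \<kappa>) * norm (of_real (s n) * z) powr \<alpha>) / s n powr \<alpha>"
        by (intro divide_right_mono psi_bound) auto
      also have "\<dots> = (C * \<kappa>) * norm z powr \<alpha>" using s(1)[of n] by (simp add: norm_mult powr_mult)
      finally show "1 - Re (chf P (\<lambda>\<omega>. z * X n \<omega>)) \<le> C * \<kappa> * norm z powr \<alpha>" unfolding chfX by simp
    qed simp
  qed (use \<alpha> in auto)
qed

text \<open>
  The self-similarity of the kernel, after the substitution \<open>s = r / \<epsilon>\<close> in the exponent. The factor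
  \<open>\<epsilon> powr (H + 1/\<alpha>)\<close> loses \<open>\<epsilon> powr H\<close> to the normalisation of \<open>X\<close>.
\<close>
lemma rescaled_fdd_chf:
  fixes n :: nat
  assumes H: "0 < H" "H < 1" and X: "harmonizable_motion P L \<alpha> H a b X" and \<epsilon>: "0 < \<epsilon>"
  shows "chf P (\<lambda>\<omega>. \<Sum>k<n. z k * (X (\<epsilon> * t k) \<omega> / of_real (\<epsilon> powr H))) =
    of_real (exp (- (\<integral>r. psi (of_real (\<epsilon> powr (1/\<alpha>)) * (\<Sum>k<n. z k * hf_kernel \<alpha> H a b (t k) r)) / \<epsilon> \<partial>lborel)))"
proof -
  define c where "c k = z k / of_real (\<epsilon> powr H)" for k
  have XI: "N.isI (hf_kernel \<alpha> H a b u) (X u)" for u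
    using X kernel_La[OF H] unfolding harmonizable_motion_def by (intro N.isI_if_has_levy_integral) auto
  define g where "g s = (\<Sum>k<n. c k * hf_kernel \<alpha> H a b (\<epsilon> * t k) s)" for s
  have I: "N.isI g (\<lambda>\<omega>. \<Sum>k<n. c k * X (\<epsilon> * t k) \<omega>)"
    unfolding g_def by (rule N.isI_sum[OF _ XI]) simp
  have [measurable]: "g \<in> borel_measurable borel" "psi \<in> borel_measurable borel"
    using N.La_meas[OF N.isI_La[OF I]] N.Psi_meas by auto
  have "(\<integral>s. psi (g s) \<partial>lborel) = \<bar>1/\<epsilon>\<bar> ^ DIM(real) * (\<integral>r. psi (g ((1/\<epsilon>) *\<^sub>R r)) \<partial>lborel)"
    by (rule lborel_integral_scale) (use \<epsilon> in auto)
  also have "\<dots> = (\<integral>r. psi (g (r / \<epsilon>)) / \<epsilon> \<partial>lborel)"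
    using \<epsilon> by simp
  finally have sub: "(\<integral>s. psi (g s) \<partial>lborel) = (\<integral>r. psi (g (r / \<epsilon>)) / \<epsilon> \<partial>lborel)" .
  have gr: "g (r / \<epsilon>) = of_real (\<epsilon> powr (1/\<alpha>)) * (\<Sum>k<n. z k * hf_kernel \<alpha> H a b (t k) r)" for r
  proof -
    have "\<epsilon> powr (H + 1/\<alpha>) = \<epsilon> powr H * \<epsilon> powr (1/\<alpha>)" by (rule powr_add)
    then have "c k * of_real (\<epsilon> powr (H + 1/\<alpha>)) = of_real (\<epsilon> powr (1/\<alpha>)) * z k" for k
      using \<epsilon> by (simp add: c_def)
    then have "c k * hf_kernel \<alpha> H a b (\<epsilon> * t k) (r / \<epsilon>) = of_real (\<epsilon> powr (1/\<alpha>)) * (z k * hf_kernel \<alpha> H a b (t k) r)" for k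
      unfolding hf_kernel_scaling[OF \<epsilon>] by (simp add: mult.assoc[symmetric])
    then show ?thesis unfolding g_def sum_distrib_left by simp
  qed
  have "chf P (\<lambda>\<omega>. \<Sum>k<n. c k * X (\<epsilon> * t k) \<omega>) = of_real (exp (- (\<integral>r. psi (of_real (\<epsilon> powr (1/\<alpha>)) * (\<Sum>k<n. z k * hf_kernel \<alpha> H a b (t k) r)) / \<epsilon> \<partial>lborel)))"
    using N.isI_chf[OF I, of 1] by (simp add: sub gr)
  then show ?thesis by (simp add: c_def)
qed

text \<open>
  With \<open>r = \<epsilon> powr (1/\<alpha>)\<close>, the integrand is \<open>psi (r G) / r powr \<alpha>\<close>; \<open>psi_scaling\<close> gives the limit and
  \<open>psi_bound\<close> the domination.
\<close>
lemma rescaled_exponent_limit: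
  assumes G: "N.La G" and e: "\<And>i::nat. 0 < \<epsilon> i" "\<epsilon> \<longlonglongrightarrow> 0"
  shows "(\<lambda>i. \<integral>r. psi (of_real (\<epsilon> i powr (1/\<alpha>)) * G r) / \<epsilon> i \<partial>lborel) \<longlonglongrightarrow> (\<integral>r. (c0 * \<kappa>) * norm (G r) powr \<alpha> \<partial>lborel)"
proof (rule integral_dominated_convergence[where w="\<lambda>r. (C * \<kappa>) * norm (G r) powr \<alpha>"])
  note [measurable] = N.La_meas[OF G] N.Psi_meas
  show "(\<lambda>r. psi (of_real (\<epsilon> i powr (1/\<alpha>)) * G r) / \<epsilon> i) \<in> borel_measurable lborel" for i by measurable
  show "(\<lambda>r. (c0 * \<kappa>) * norm (G r) powr \<alpha>) \<in> borel_measurable lborel" by measurable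
  have "integrable lborel (\<lambda>r. norm (G r) powr \<alpha>)"
    using G unfolding N.La_def apow_def by (simp add: integrable_iff_bounded)
  then show "integrable lborel (\<lambda>r. (C * \<kappa>) * norm (G r) powr \<alpha>)" by (rule integrable_mult_right)
  have pw: "(\<epsilon> i powr (1/\<alpha>)) powr \<alpha> = \<epsilon> i" for i using \<alpha> e(1)[of i] by (simp add: powr_powr)
  have lim0: "filterlim (\<lambda>i. \<epsilon> i powr (1/\<alpha>)) (at_right 0) sequentially"
  proof -
    have "(\<lambda>i. \<epsilon> i powr (1/\<alpha>)) \<longlonglongrightarrow> 0 powr (1/\<alpha>)"
      using \<alpha> e by (intro tendsto_powr') (auto intro: always_eventually less_imp_le)
    moreover have "0 < \<epsilon> i powr (1/\<alpha>)" for i using e(1)[of i] by simp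
    ultimately show ?thesis by (auto simp: filterlim_at)
  qed
  show "AE r in lborel. (\<lambda>i. psi (of_real (\<epsilon> i powr (1/\<alpha>)) * G r) / \<epsilon> i) \<longlonglongrightarrow> (c0 * \<kappa>) * norm (G r) powr \<alpha>"
    using filterlim_compose[OF psi_scaling lim0] by (intro AE_I2) (simp add: pw)
  show "AE r in lborel. norm (psi (of_real (\<epsilon> i powr (1/\<alpha>)) * G r) / \<epsilon> i) \<le> (C * \<kappa>) * norm (G r) powr \<alpha>" for i
  proof (rule AE_I2)
    fix r
    have "psi (of_real (\<epsilon> i powr (1/\<alpha>)) * G r) / \<epsilon> i \<le> ((C * \<kappa>) * norm (of_real (\<epsilon> i powr (1/\<alpha>)) * G r) powr \<alpha>) / \<epsilon> i"
      using e(1)[of i] by (intro divide_right_mono psi_bound) auto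
    also have "\<dots> = (C * \<kappa>) * norm (G r) powr \<alpha>"
      using e(1)[of i] by (simp add: norm_mult powr_mult pw)
    finally show "norm (psi (of_real (\<epsilon> i powr (1/\<alpha>)) * G r) / \<epsilon> i) \<le> (C * \<kappa>) * norm (G r) powr \<alpha>"
      using psi_nonneg e(1)[of i] by simp
  qed
qed

text \<open>
  On the space of the stable process, \<open>T t\<close> is a version of the integral of the kernel. Convergence of the
  finite-dimensional laws reduces to \<open>rescaled_exponent_limit\<close>. The process is not degenerate since the
  kernel at time \<open>1\<close> does not vanish near the origin on the half-line on which its coefficient is
  nonzero.
\<close>
lemma tangent_process_exists:
  assumes H: "0 < H" "H < 1" and X: "harmonizable_motion P L \<alpha> H a b X"
  shows "\<exists>(Q :: (real \<Rightarrow> complex) measure) T.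
    harmonizable_fractional_stable_motion Q \<alpha> H T \<and>
    tendsto_fdd P (\<lambda>\<epsilon> t \<omega>. X (\<epsilon> * t) \<omega> / of_real (\<epsilon> powr H)) Q T (at_right 0) \<and>
    (a \<noteq> 0 \<or> b \<noteq> 0 \<longrightarrow> nondegenerate_process Q T)"
proof -
  \<comment> \<open>The exponent of the stable process with Levy density \<open>c0 * norm x powr (-2 - \<alpha>)\<close> is \<open>k * norm z powr \<alpha>\<close>.\<close>
  define k where "k = c0 * \<kappa>"
  have k: "0 < k" using c0 stable_profile_pos[OF \<alpha>] by (simp add: k_def)
  obtain \<mu> where \<mu>: "prob_space \<mu>" "sets \<mu> = sets borel" "\<And>z. chf \<mu> (\<lambda>x. z * x) = complex_of_real (exp (- (k * norm z powr \<alpha>)))"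
    using stable_law_exists unfolding k_def by blast
  obtain Q :: "(real \<Rightarrow> complex) measure" where levyQ: "levy_process Q (\<lambda>t \<omega>. \<omega> t)"
    and incQ: "\<And>s t z. s \<le> t \<Longrightarrow> chf Q (\<lambda>\<omega>. z * (\<omega> t - \<omega> s)) = of_real (exp (- (t - s) * (k * norm z powr \<alpha>)))"
    using stable_process_exists[OF \<mu>(1,2) \<alpha> less_imp_le[OF k] \<mu>(3)] by blast
  have pQ: "prob_space Q" and mQ[measurable]: "(\<lambda>\<omega>. \<omega> t) \<in> borel_measurable Q" and Q0: "AE \<omega> in Q. \<omega> 0 = 0" for t
    using levyQ by (auto simp: levy_process_def)
  have chfQ: "chf Q (\<lambda>\<omega>. z * \<omega> t) = of_real (exp (- t * (k * norm z powr \<alpha>)))" if "0 \<le> t" for t z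
  proof -
    have "chf Q (\<lambda>\<omega>. z * \<omega> t) = chf Q (\<lambda>\<omega>. z * (\<omega> t - \<omega> 0))"
      using Q0 by (intro chf_cong_AE) (auto elim: eventually_mono)
    then show ?thesis using incQ[OF that] by simp
  qed
  interpret S: levy_noise Q "\<lambda>t \<omega>. \<omega> t" "\<lambda>z. k * norm z powr \<alpha>" \<alpha> k
  proof (intro levy_noise.intro levyQ \<alpha> chfQ)
    show "continuous_on UNIV (\<lambda>z::complex. k * norm z powr \<alpha>)"
      using \<alpha> by (intro continuous_intros continuous_on_powr') auto
  qed (use k in auto)
  define g where "g = hf_kernel \<alpha> H a b"
  have gLa: "S.La (g t)" for t
    unfolding S.La_def g_def using hf_kernel_apow_finite[OF \<alpha>(1) H] by auto
  define T where "T t = (SOME Y. S.isI (g t) Y)" for t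
  have T: "S.isI (g t) (T t)" for t unfolding T_def by (rule someI_ex[OF S.isI_exists[OF gLa]])
  note [measurable] = S.isI_meas[OF T]
  have stableQ: "rot_invariant_stable_levy Q \<alpha> (\<lambda>t \<omega>. \<omega> t)"
    unfolding rot_invariant_stable_levy_def
  proof (intro conjI levyQ exI[of _ c0] c0)
    show "symmetric_increments Q (\<lambda>t \<omega>. \<omega> t)"
      unfolding symmetric_increments_def
    proof (intro allI)
      have sym: "chf Q (\<lambda>\<omega>. z * - (\<omega> t - \<omega> s)) = chf Q (\<lambda>\<omega>. z * (\<omega> t - \<omega> s))" for s t z
      proof (cases "s \<le> t")
        case True
        have "(\<lambda>\<omega> :: real \<Rightarrow> complex. z * - (\<omega> t - \<omega> s)) = (\<lambda>\<omega>. (- z) * (\<omega> t - \<omega> s))" by (auto simp: algebra_simps)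
        then show ?thesis using incQ[OF True, of "- z"] incQ[OF True, of z] by simp
      next
        case False
        have "(\<lambda>\<omega> :: real \<Rightarrow> complex. z * - (\<omega> t - \<omega> s)) = (\<lambda>\<omega>. z * (\<omega> s - \<omega> t))"
          "(\<lambda>\<omega> :: real \<Rightarrow> complex. z * (\<omega> t - \<omega> s)) = (\<lambda>\<omega>. (- z) * (\<omega> s - \<omega> t))" by (auto simp: algebra_simps)
        then show ?thesis using incQ[of t s "- z"] incQ[of t s z] False by (simp only: norm_minus_cancel)
      qed
      show "distr Q borel (\<lambda>\<omega>. - (\<omega> t - \<omega> s)) = distr Q borel (\<lambda>\<omega>. \<omega> t - \<omega> s)" for s t
        by (rule distr_eq_if_chf_eq[OF pQ pQ _ _ sym]) measurable
    qed
    show "purely_non_gaussian Q (\<lambda>t \<omega>. \<omega> t) (density lborel (\<lambda>x. ennreal (c0 * norm x powr (-2 - \<alpha>))))"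
      unfolding purely_non_gaussian_def has_levy_triplet_def
    proof (intro exI[of _ 0] conjI allI impI levy_measure_stable[OF \<alpha> c0])
      fix t :: real and z assume "0 \<le> t"
      have "(\<integral>\<omega>. exp (\<i> * of_real (z \<bullet> \<omega> t)) \<partial>Q) = chf Q (\<lambda>\<omega>. cnj z * \<omega> t)"
        unfolding chf_def cos_inner_eq_Re cis_conv_exp by simp
      also have "\<dots> = exp (of_real t * levy_exponent (\<lambda>_. 0) (density lborel (\<lambda>x. ennreal (c0 * norm x powr (-2 - \<alpha>)))) 0 z)"
        unfolding levy_exponent_stable[OF \<alpha> c0] chfQ[OF \<open>0 \<le> t\<close>] profile_eq[of z] by (simp add: k_def mult.assoc flip: exp_of_real)
      finally show "(\<integral>\<omega>. exp (\<i> * of_real (z \<bullet> \<omega> t)) \<partial>Q) = exp (of_real t * levy_exponent (\<lambda>_. 0) (density lborel (\<lambda>x. ennreal (c0 * norm x powr (-2 - \<alpha>)))) 0 z)" .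
    qed (auto intro: linear_zero)
  qed
  have "harmonizable_fractional_stable_motion Q \<alpha> H T"
    unfolding harmonizable_fractional_stable_motion_def harmonizable_motion_def
    using stableQ S.has_levy_integral_if_isI[OF T] unfolding g_def by blast
  moreover have "tendsto_fdd P (\<lambda>\<epsilon> t \<omega>. X (\<epsilon> * t) \<omega> / of_real (\<epsilon> powr H)) Q T (at_right 0)"
    unfolding tendsto_fdd_def
  proof (intro allI impI)
    fix n :: nat and t :: "nat \<Rightarrow> real" and h :: "(nat \<Rightarrow> complex) \<Rightarrow> real"
    assume h: "continuous_on UNIV h" "bounded (range h)"
    obtain D where D: "\<And>x. \<bar>h x\<bar> \<le> D" using h(2) unfolding bounded_iff by auto
    have Xm: "X u \<in> borel_measurable P" for u
      using X unfolding harmonizable_motion_def has_levy_integral_def by auto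
    show "((\<lambda>\<epsilon>. \<integral>\<omega>. h (\<lambda>k. if k < n then X (\<epsilon> * t k) \<omega> / of_real (\<epsilon> powr H) else 0) \<partial>P) \<longlongrightarrow>
        (\<integral>\<omega>. h (\<lambda>k. if k < n then T (t k) \<omega> else 0) \<partial>Q)) (at_right 0)"
    proof (rule tendsto_at_right_sequentially[of 0 1])
      fix s :: "nat \<Rightarrow> real" assume s: "\<And>n. 0 < s n" "s \<longlonglongrightarrow> 0"
      have "(\<lambda>i. \<integral>\<omega>. h (padded n (\<lambda>k \<omega>. X (s i * t k) \<omega> / of_real (s i powr H)) \<omega>) \<partial>P) \<longlonglongrightarrow> (\<integral>\<omega>. h (padded n (\<lambda>k. T (t k)) \<omega>) \<partial>Q)"
      proof (rule multivariate_levy_continuity[OF N.prob_P pQ _ _ _ h(1) D])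
        fix z :: "nat \<Rightarrow> complex"
        define G where "G r = (\<Sum>k<n. z k * g (t k) r)" for r
        have GI: "S.isI G (\<lambda>\<omega>. \<Sum>k<n. z k * T (t k) \<omega>)"
          unfolding G_def by (rule S.isI_sum[OF _ T]) simp
        have GN: "N.La G" using S.isI_La[OF GI] unfolding N.La_def S.La_def .
        have "(\<lambda>i. complex_of_real (exp (- (\<integral>r. psi (of_real (s i powr (1/\<alpha>)) * G r) / s i \<partial>lborel)))) \<longlonglongrightarrow>
            complex_of_real (exp (- (\<integral>r. k * norm (G r) powr \<alpha> \<partial>lborel)))"
          unfolding k_def by (intro tendsto_intros rescaled_exponent_limit[OF GN] s)
        then show "(\<lambda>i. chf P (\<lambda>\<omega>. \<Sum>k<n. z k * (X (s i * t k) \<omega> / of_real (s i powr H)))) \<longlonglongrightarrow> chf Q (\<lambda>\<omega>. \<Sum>k<n. z k * T (t k) \<omega>)"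
          using S.isI_chf[OF GI, of 1] unfolding rescaled_fdd_chf[OF H X s(1)] G_def g_def by simp
      qed (use Xm in auto)
      then show "(\<lambda>i. \<integral>\<omega>. h (\<lambda>k. if k < n then X (s i * t k) \<omega> / of_real (s i powr H) else 0) \<partial>P) \<longlonglongrightarrow>
        (\<integral>\<omega>. h (\<lambda>k. if k < n then T (t k) \<omega> else 0) \<partial>Q)"
        unfolding padded_def .
    qed simp
  qed
  moreover have "nondegenerate_process Q T" if ab: "a \<noteq> 0 \<or> b \<noteq> 0"
    unfolding nondegenerate_process_def
  proof (rule exI[of _ 1], rule notI, elim exE)
    fix c assume "AE \<omega> in Q. T 1 \<omega> = c"
    then have "chf Q (T 1) = chf Q (\<lambda>_. c)" by (intro chf_cong_AE) auto
    then have "norm (chf Q (T 1)) = 1" unfolding chf_def using prob_space.prob_space[OF pQ] by simp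
    then have "(\<integral>s. k * norm (g 1 s) powr \<alpha> \<partial>lborel) = 0"
      using S.isI_chf[OF T[of 1], of 1] by simp
    then have "AE s in lborel. k * norm (g 1 s) powr \<alpha> = 0"
      using S.Psi_integrable(1)[OF gLa[of 1]] k by (subst (asm) integral_nonneg_eq_0_iff_AE) auto
    then have ae: "AE s in lborel. g 1 s = 0" using k by simp
    \<comment> \<open>For \<open>0 < \<bar>s\<bar> < 1\<close> the factor \<open>exp (\<i> s) - 1\<close> has nonzero imaginary part.\<close>
    have nz: "g 1 s \<noteq> 0" if "s \<noteq> 0" "\<bar>s\<bar> < 1" "(0 < s \<and> a \<noteq> 0) \<or> (s < 0 \<and> b \<noteq> 0)" for s
    proof -
      have "sin s \<noteq> 0"
        using that sin_gt_zero[of s] sin_gt_zero[of "- s"] pi_gt3 by (cases "0 < s") auto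
      then have "exp (\<i> * of_real s) \<noteq> 1" by (auto simp: complex_eq_iff Im_exp)
      then show ?thesis using that by (auto simp: g_def hf_kernel_def)
    qed
    have null: False if "AE s in lborel. s \<notin> {u<..<u+1::real}" for u
    proof -
      have "{u<..<u+1} = {s \<in> space lborel. \<not> s \<notin> {u<..<u+1}}" by auto
      then have "emeasure lborel {u<..<u+1} = 0"
        using that AE_iff_measurable[of "{u<..<u+1}" lborel "\<lambda>s. s \<notin> {u<..<u+1}"] by simp
      moreover have "emeasure lborel {u<..<u+1} = 1" by simp
      ultimately show False by simp
    qed
    show False
    proof (cases "a \<noteq> 0")
      case True
      from ae have "AE s in lborel. s \<notin> {0<..<0+1::real}"
        by eventually_elim (use nz True in auto)
      then show False by (rule null)
    next
      case False
      from ae have "AE s in lborel. s \<notin> {-1<..<-1+1::real}"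
        by eventually_elim (use nz False ab in auto)
      then show False by (rule null)
    qed
  qed
  ultimately show ?thesis by blast
qed

end

theorem theorem1p3:
  fixes P :: "'a measure" and L :: "real \<Rightarrow> 'a \<Rightarrow> complex"
    and \<nu> :: "complex measure" and f :: "complex \<Rightarrow> real"
    and \<alpha> H a b c0 C :: real
  assumes "0 < \<alpha>" "\<alpha> < 2" "0 < H" "H < 1"
    and "levy_process P L"
    and "rot_invariant_process P L"
    and "purely_non_gaussian P L \<nu>"
    and "f \<in> borel_measurable borel" "\<And>x. 0 \<le> f x"
    and "\<nu> = density lborel (\<lambda>x. ennreal (f x))"
    and "0 < c0" "0 < C"
    and "((\<lambda>x. f x / (c0 * norm x powr (-2 - \<alpha>))) \<longlongrightarrow> 1) at_infinity"
    and "\<And>x. x \<noteq> 0 \<Longrightarrow> f x \<le> C * norm x powr (-2 - \<alpha>)"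
  shows "(\<forall>t. levy_integrable P L (hf_kernel \<alpha> H a b t)) \<and>
    (\<forall>X. harmonizable_motion P L \<alpha> H a b X \<longrightarrow>
      (\<exists>(Q :: (real \<Rightarrow> complex) measure) T.
         harmonizable_fractional_stable_motion Q \<alpha> H T \<and>
         tendsto_fdd P (\<lambda>\<epsilon> t \<omega>. X (\<epsilon> * t) \<omega> / of_real (\<epsilon> powr H)) Q T (at_right 0) \<and>
         (a \<noteq> 0 \<or> b \<noteq> 0 \<longrightarrow> locally_asymp_self_similar P X H Q T)))"
proof -
  interpret D: stable_tail_density f \<alpha> c0 C
    by (intro stable_tail_density.intro assms)
  obtain \<gamma> where "has_levy_triplet P L (\<lambda>_. 0) D.density_measure \<gamma>"
    using assms(7) unfolding purely_non_gaussian_def D.density_measure_def assms(10) by blast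
  then interpret R: rot_levy f \<alpha> c0 C P L \<gamma>
    by (intro rot_levy.intro rot_levy_axioms.intro D.stable_tail_density_axioms assms)
  have same: "of_real (\<epsilon> powr (-H)) * X (\<epsilon> * t) \<omega> = X (\<epsilon> * t) \<omega> / of_real (\<epsilon> powr H)"
    for \<epsilon> t \<omega> and X :: "real \<Rightarrow> 'a \<Rightarrow> complex"
    by (simp add: powr_minus_divide)
  show ?thesis
  proof (intro conjI allI impI)
    show "levy_integrable P L (hf_kernel \<alpha> H a b t)" for t
      by (rule R.N.levy_integrable_La[OF R.kernel_La[OF assms(3,4)]])
    fix X assume "harmonizable_motion P L \<alpha> H a b X"
    from R.tangent_process_exists[OF assms(3,4) this]
    show "\<exists>(Q :: (real \<Rightarrow> complex) measure) T.
         harmonizable_fractional_stable_motion Q \<alpha> H T \<and>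
         tendsto_fdd P (\<lambda>\<epsilon> t \<omega>. X (\<epsilon> * t) \<omega> / of_real (\<epsilon> powr H)) Q T (at_right 0) \<and>
         (a \<noteq> 0 \<or> b \<noteq> 0 \<longrightarrow> locally_asymp_self_similar P X H Q T)"
      unfolding locally_asymp_self_similar_def same by blast
  qed
qed

end
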